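(* Let $k\ge3$ be odd, and consider the affine Weyl group $W_a$ of type $\widetilde A_{k-1}$ with fundamental alcove $\mathcal A=\{x\in V:1+x_k>x_1>\cdots>x_k\}$. If $X$ is a reflectable process in $V$ (with respect to $W_a$), $x\in\mathcal A$, $t\ge 0$, and $\widetilde T$ is the first exit time of $X$ from $\mathcal A$, then $$\mathbb{P}_x(\widetilde T>t)=\sum_{A\in\mathcal I}\ \sum_{n\in\mathbb{N}}\ \sum_{\substack{v\in E_A\\ |v|_A=n}}\varepsilon_A\,\varepsilon^A_v\,\mathbb{P}_x(T_{A,v}>t)$$ if this sum converges.
   Context: $V=\mathbb{R}^k$ or $V=\{x\in\mathbb{R}^k:\sum_ix_i=0\}$; $\mathbb{N}=\{0,1,2,\dots\}$; $\Phi=\{e_i-e_j:i\ne j\}$, $\Phi^+=\{e_i-e_j:1\le i<j\le k\}$, $W=\mathfrak S_k$ acts by permuting the canonical basis vectors, with sign $\varepsilon(w)=\det w$. $W_a$ is the group generated by $W$ and the translations by $L=\{d\in\mathbb{Z}^k:\sum_id_i=0\}$. The collection $\mathcal I$ is taken from the finite type $A_{k-1}$: with $I=\{e_1-e_2,e_3-e_4,\dots,e_{k-2}-e_{k-1}\}$, let $\mathcal I=\{wI:w\in W,\ wI\subset\Phi^+\}$, and for $A\in\mathcal I$ let $\varepsilon_A=\varepsilon(w)$ for any $w\in W$ with $wI=A$ (this is well defined). For a set $A\subset\Phi$ of pairwise orthogonal roots define $E_A=\{v\in\mathrm{Span}(A):\langle v,\beta\rangle\in\mathbb{Z}\ \forall\beta\in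 A\}$, $\varepsilon^A_v=(-1)^{\#\{\beta\in A:\langle v,\beta\rangle>0\}}$, $|v|_A=\max\{|\langle v,\beta\rangle|:\beta\in A\}$. For $v\in V$, $\beta\in A$: $T_{\beta,v}=\inf\{t\ge0:\langle X_t,\beta\rangle=\langle v,\beta\rangle\}$ and $T_{A,v}=\min_{\beta\in A}T_{\beta,v}$. $X=(X_t)_{t\ge0}$ is a $V$-valued process, with law $\mathbb{P}_x$ when started at $x$; it is reflectable if it has the strong Markov property, almost surely continuous sample paths, and $W_a$-invariant law: $\mathbb{P}_x\circ(wX)^{-1}=\mathbb{P}_{wx}\circ X^{-1}$ for all $w\in W_a$, $x\in V$. *)

theory Defs
  imports "HOL-Probability.Probability"
begin

text \<open>
  The ambient space is \<open>real ^ 'n\<close> for a finite linearly ordered index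
  type \<open>'n\<close> with \<open>k = CARD('n)\<close> elements; the order of \<open>'n\<close> plays the role of the order
  \<open>1 < 2 < \<dots> < k\<close>, so that the position of an index \<open>i\<close> is \<open>card {..i}\<close>, and the first and
  last indices are \<open>Min UNIV\<close> and \<open>Max UNIV\<close>.
\<close>

abbreviation basis_vec :: "'n::finite \<Rightarrow> real ^ 'n"
  where "basis_vec i \<equiv> axis i 1"

definition pos :: "'n::{finite,linorder} \<Rightarrow> nat"
  where "pos i = card {..i}"

definition pos_roots :: "(real ^ 'n::{finite,linorder}) set"
  where "pos_roots = {basis_vec i - basis_vec j | i j. i < j}"

definition weyl_group :: "(real ^ 'n::{finite,linorder} \<Rightarrow> real ^ 'n::{finite,linorder}) set"
  where "weyl_group =
    {w. linear w \<and> (\<exists>p. p permutes UNIV \<and> (\<forall>i. w (basis_vec i) = basis_vec (p i)))}"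

definition weyl_sign :: "(real ^ 'n::{finite,linorder} \<Rightarrow> real ^ 'n::{finite,linorder}) \<Rightarrow> real"
  where "weyl_sign w = det (matrix w)"

definition transl_lattice :: "(real ^ 'n::{finite,linorder}) set"
  where "transl_lattice = {d. (\<forall>i. d $ i \<in> \<int>) \<and> (\<Sum>i\<in>UNIV. d $ i) = 0}"

inductive_set affine_weyl_group :: "(real ^ 'n::{finite,linorder} \<Rightarrow> real ^ 'n::{finite,linorder}) set"
  where
    weyl: "w \<in> weyl_group \<Longrightarrow> w \<in> affine_weyl_group"
  | transl: "d \<in> transl_lattice \<Longrightarrow> (\<lambda>x. x + d) \<in> affine_weyl_group"
  | comp: "f \<in> affine_weyl_group \<Longrightarrow> g \<in> affine_weyl_group \<Longrightarrow> f \<circ> g \<in> affine_weyl_group"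
  | inverse: "f \<in> affine_weyl_group \<Longrightarrow> inv f \<in> affine_weyl_group"

definition alcove :: "(real ^ 'n::{finite,linorder}) set \<Rightarrow> (real ^ 'n::{finite,linorder}) set"
  where "alcove V = {x \<in> V. 1 + x $ Max UNIV > x $ Min UNIV \<and> (\<forall>i j. i < j \<longrightarrow> x $ i > x $ j)}"

text \<open>
  For odd \<open>k\<close> the index at position \<open>k\<close> has no successor, so \<open>base_orth\<close> is
  \<open>{e\<^sub>1 - e\<^sub>2, e\<^sub>3 - e\<^sub>4, \<dots>, e\<^bsub>k-2\<^esub> - e\<^bsub>k-1\<^esub>}\<close>.
\<close>

definition base_orth :: "(real ^ 'n::{finite,linorder}) set"
  where "base_orth = {basis_vec i - basis_vec j | i j. odd (pos i) \<and> pos j = pos i + 1}"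

definition orth_collection :: "(real ^ 'n::{finite,linorder}) set set"
  where "orth_collection = {w ` base_orth | w. w \<in> weyl_group \<and> w ` base_orth \<subseteq> pos_roots}"

text \<open>The sign below does not depend on the choice of \<open>w\<close> when \<open>k\<close> is odd.\<close>

definition orth_sign :: "(real ^ 'n::{finite,linorder}) set \<Rightarrow> real"
  where "orth_sign A = weyl_sign (SOME w. w \<in> weyl_group \<and> w ` base_orth = A)"

definition E_set :: "(real ^ 'n::{finite,linorder}) set \<Rightarrow> (real ^ 'n::{finite,linorder}) set"
  where "E_set A = {v \<in> span A. \<forall>\<beta>\<in>A. v \<bullet> \<beta> \<in> \<int>}"

definition E_sign :: "(real ^ 'n::{finite,linorder}) set \<Rightarrow> real ^ 'n::{finite,linorder} \<Rightarrow> real"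
  where "E_sign A v = (- 1) ^ card {\<beta> \<in> A. v \<bullet> \<beta> > 0}"

definition E_norm :: "(real ^ 'n::{finite,linorder}) set \<Rightarrow> real ^ 'n::{finite,linorder} \<Rightarrow> real"
  where "E_norm A v = Max ((\<lambda>\<beta>. \<bar>v \<bullet> \<beta>\<bar>) ` A)"

text \<open>Times take values in \<open>[0, \<infinity>]\<close>; the infimum of the empty set is \<open>\<infinity>\<close>.\<close>

definition hit_time ::
    "(real \<Rightarrow> 'w \<Rightarrow> real ^ 'n::{finite,linorder}) \<Rightarrow> real ^ 'n::{finite,linorder} \<Rightarrow> real ^ 'n::{finite,linorder} \<Rightarrow> 'w \<Rightarrow> ennreal"
  where "hit_time X \<beta> v \<omega> = (INF t\<in>{t. 0 \<le> t \<and> X t \<omega> \<bullet> \<beta> = v \<bullet> \<beta>}. ennreal t)"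

definition hit_time_set ::
    "(real \<Rightarrow> 'w \<Rightarrow> real ^ 'n::{finite,linorder}) \<Rightarrow> (real ^ 'n::{finite,linorder}) set \<Rightarrow> real ^ 'n::{finite,linorder} \<Rightarrow> 'w \<Rightarrow> ennreal"
  where "hit_time_set X A v \<omega> = Min ((\<lambda>\<beta>. hit_time X \<beta> v \<omega>) ` A)"

definition exit_time ::
    "(real \<Rightarrow> 'w \<Rightarrow> real ^ 'n::{finite,linorder}) \<Rightarrow> (real ^ 'n::{finite,linorder}) set \<Rightarrow> 'w \<Rightarrow> ennreal"
  where "exit_time X C \<omega> = (INF t\<in>{t. 0 \<le> t \<and> X t \<omega> \<notin> C}. ennreal t)"

text \<open>
  A process is a map \<open>X\<close> on a measurable space \<open>M\<close> (whose own measure is irrelevant) together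
  with the laws \<open>P x\<close>, \<open>x \<in> V\<close>.  As \<open>M\<close> need not be complete and paths are continuous only
  almost surely, events depending on uncountably many times are measured by
  \<open>completion (P x)\<close>.
\<close>

definition path_space :: "(real \<Rightarrow> real ^ 'n::{finite,linorder}) measure"
  where "path_space = PiM {0..} (\<lambda>_. borel)"

definition natural_filtration ::
    "'w measure \<Rightarrow> (real \<Rightarrow> 'w \<Rightarrow> real ^ 'n::{finite,linorder}) \<Rightarrow> ennreal \<Rightarrow> 'w measure"
  where "natural_filtration M X t =
    sigma (space M) {X s -` B \<inter> space M | s B. 0 \<le> s \<and> ennreal s \<le> t \<and> B \<in> sets borel}"

lemma filtration_natural_filtration:
  "filtration (space M) (natural_filtration M X)"
proof
  show "space (natural_filtration M X i) = space M" for i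
    unfolding natural_filtration_def by (rule space_measure_of) auto
  show "sets (natural_filtration M X i) \<subseteq> sets (natural_filtration M X j)" if "i \<le> j" for i j
    unfolding natural_filtration_def using that
    by (subst (1 2) sets_measure_of) (auto intro!: sigma_sets_mono' intro: order_trans)
qed

definition process_with_laws ::
    "(real ^ 'n::{finite,linorder}) set \<Rightarrow> 'w measure \<Rightarrow> (real ^ 'n::{finite,linorder} \<Rightarrow> 'w measure)
      \<Rightarrow> (real \<Rightarrow> 'w \<Rightarrow> real ^ 'n::{finite,linorder}) \<Rightarrow> bool"
  where "process_with_laws V M P X \<longleftrightarrow>
    (\<forall>t\<ge>0. X t \<in> borel_measurable M) \<and>
    (\<forall>t\<ge>0. \<forall>\<omega>\<in>space M. X t \<omega> \<in> V) \<and>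
    (\<forall>x\<in>V. prob_space (P x) \<and> sets (P x) = sets M \<and> (AE \<omega> in P x. X 0 \<omega> = x)) \<and>
    (\<forall>B\<in>sets path_space.
       (\<lambda>x. emeasure (P x) {\<omega>\<in>space M. (\<lambda>t\<in>{0..}. X t \<omega>) \<in> B})
         \<in> borel_measurable (restrict_space borel V))"

text \<open>
  The strong Markov property with respect to the natural filtration, which is the weakest choice
  of a filtration to which \<open>X\<close> is adapted: given the \<open>\<sigma>\<close>-algebra of a (possibly infinite) stopping
  time \<open>T\<close>, on \<open>{T < \<infinity>}\<close> the process \<open>(X\<^bsub>T+t\<^esub>)\<^bsub>t\<ge>0\<^esub>\<close> has the law of \<open>X\<close> started at \<open>X\<^bsub>T\<^esub>\<close>.
\<close>

definition strong_markov ::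
    "(real ^ 'n::{finite,linorder}) set \<Rightarrow> 'w measure \<Rightarrow> (real ^ 'n::{finite,linorder} \<Rightarrow> 'w measure)
      \<Rightarrow> (real \<Rightarrow> 'w \<Rightarrow> real ^ 'n::{finite,linorder}) \<Rightarrow> bool"
  where "strong_markov V M P X \<longleftrightarrow>
    (\<forall>x\<in>V. \<forall>T. stopping_time (natural_filtration M X) T \<longrightarrow>
      (\<forall>F\<in>sets (filtration.pre_sigma (space M) (natural_filtration M X) T).
       \<forall>B\<in>sets path_space.
         emeasure (completion (P x))
           {\<omega>\<in>F. T \<omega> < \<infinity> \<and> (\<lambda>t\<in>{0..}. X (enn2real (T \<omega>) + t) \<omega>) \<in> B} =
         (\<integral>\<^sup>+\<omega>\<in>{\<omega>\<in>F. T \<omega> < \<infinity>}.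
            emeasure (P (X (enn2real (T \<omega>)) \<omega>)) {\<omega>'\<in>space M. (\<lambda>t\<in>{0..}. X t \<omega>') \<in> B}
          \<partial>completion (P x))))"

definition reflectable ::
    "(real ^ 'n::{finite,linorder}) set \<Rightarrow> 'w measure \<Rightarrow> (real ^ 'n::{finite,linorder} \<Rightarrow> 'w measure)
      \<Rightarrow> (real \<Rightarrow> 'w \<Rightarrow> real ^ 'n::{finite,linorder}) \<Rightarrow> bool"
  where "reflectable V M P X \<longleftrightarrow>
    process_with_laws V M P X \<and>
    strong_markov V M P X \<and>
    (\<forall>x\<in>V. AE \<omega> in P x. continuous_on {0..} (\<lambda>t. X t \<omega>)) \<and>
    (\<forall>w\<in>affine_weyl_group. \<forall>x\<in>V.
       distr (P x) path_space (\<lambda>\<omega>. \<lambda>t\<in>{0..}. w (X t \<omega>)) =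
       distr (P (w x)) path_space (\<lambda>\<omega>. \<lambda>t\<in>{0..}. X t \<omega>))"

end

theory Submission
  imports Defs
begin

text \<open>
  On the event that \<open>X\<close> stays in the alcove up to time \<open>t\<close> no hyperplane
  \<open>\<langle>\<cdot>, \<beta>\<rangle> = m\<close> is hit, and the signs add up to one.  The rest has to cancel by reflection at
  the wall through which the alcove is left.  The affine reflection does not respect the truncation
  \<open>|v|\<^sub>A \<le> N\<close> of the inner sums, so these are evaluated first.  For fixed \<open>A\<close> the indicator
  of \<open>T\<^bsub>A,v\<^esub> > t\<close> is a product over \<open>\<beta> \<in> A\<close>, and reflecting \<open>X\<close> when it leaves the strip
  \<open>0 < \<langle>\<cdot>, \<beta>\<rangle> < 1\<close> does not affect the other, orthogonal, directions.  This cancels almost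
  all levels \<open>m\<close> in the factor of \<open>\<beta>\<close>, and in the limit the inner sum is the expectation of
  \<open>\<Prod>\<^bsub>\<beta>\<in>A\<^esub> (1 + \<eta>\<^sub>\<beta>)\<close>, where \<open>\<eta>\<^sub>\<beta>\<close> is \<open>1\<close>, \<open>-1\<close> or \<open>0\<close> if up to time \<open>t\<close> the strip is
  left at level \<open>1\<close>, at level \<open>0\<close> or not at all.

  The sum over \<open>A\<close> of \<open>\<epsilon>\<^sub>A \<Prod>\<^bsub>\<beta>\<in>A\<^esub> (1 + \<eta>\<^sub>\<beta>)\<close> is a Pfaffian of odd order, bordered by ones,
  of the antisymmetric matrix \<open>a\<close> with \<open>a\<^bsub>ij\<^esub> = 1 + \<eta>\<^bsub>ij\<^esub>\<close> for \<open>i < j\<close>.  It is unchanged when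
  \<open>c\<^sub>i - c\<^sub>j\<close> is added to \<open>a\<^bsub>ij\<^esub>\<close>, and changes sign when two indices are exchanged.
  Reflection at the wall through which the alcove is left exchanges two indices up to such a shift.
\<close>

section \<open>Hitting times of continuous functions\<close>

text \<open>Summation by |v| on \<open>A\<close> matters because it is a maximum norm: the vectors
  of norm at most N form a box of independent integer levels, so a partial sum is a product of
  one-dimensional sums. Under the integral such a sum becomes 1, 0 or 2. If the strip is never left,
  N + 1 levels count 1 and N levels count -1. If it is left at 0, reflection maps m to -m and all
  cancels except level 0, which was hit. If it is left at 1, m goes to 2 - m, the truncation window
  moves by two, and half of the four unmatched boundary levels remain; for large N none of them is
  hit, which leaves 2. These are the values of 1 + \<eta>.

  The shift of the Pfaffian is needed because the affine reflection exchanges the levels 0 and 1 of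
  the roots sharing one index with the highest root: there 1 + \<eta> becomes 1 - \<eta> = -(1 +
  \<eta>) + 2.

  Reflection cannot be performed on the sample space, which need not contain a reflected path. It is
  performed on the joint law of the past and the future at a stopping time, and path functionals are
  controlled on continuous paths only.\<close>

text \<open>
  Paths are continuous only almost surely and the natural filtration is neither complete nor right
  continuous, so the hitting time of a hyperplane is redefined on the discontinuous paths to make it a
  stopping time.  Only rational times \<open>r\<close> are inspected, and only while the path restricted to the
  rationals up to \<open>r\<close> is uniformly continuous; this makes the event of having hit zero right continuous.
\<close>

definition rat_ucont :: "(real \<Rightarrow> real) \<Rightarrow> real \<Rightarrow> bool" where
  "rat_ucont f r \<longleftrightarrow> (\<forall>i::nat. \<exists>j::nat. \<forall>p\<in>\<rat> \<inter> {0..r}. \<forall>q\<in>\<rat> \<inter> {0..r}.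
     \<bar>p - q\<bar> < 1 / real (Suc j) \<longrightarrow> \<bar>f p - f q\<bar> < 1 / real (Suc i))"

definition rat_hits :: "(real \<Rightarrow> real) \<Rightarrow> real \<Rightarrow> bool" where
  "rat_hits f u \<longleftrightarrow> (\<forall>n::nat. \<exists>r\<in>\<rat> \<inter> {0..u}. rat_ucont f r \<and> \<bar>f r\<bar> < 1 / real (Suc n))"

definition zero_time :: "(real \<Rightarrow> real) \<Rightarrow> ennreal" where
  "zero_time f = (INF u\<in>{u. 0 \<le> u \<and> rat_hits f u}. ennreal u)"

lemma rat_ucont_antimono:
  assumes "rat_ucont f s" "r \<le> s"
  shows "rat_ucont f r"
proof -
  have "\<rat> \<inter> {0..r} \<subseteq> \<rat> \<inter> {0..s}" using assms(2) by auto
  then show ?thesis using assms(1) unfolding rat_ucont_def by (fast dest: subsetD)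
qed

lemma rat_hits_mono:
  assumes "rat_hits f r" "r \<le> s"
  shows "rat_hits f s"
proof -
  have "\<rat> \<inter> {0..r} \<subseteq> \<rat> \<inter> {0..s}" using assms(2) by auto
  then show ?thesis using assms(1) unfolding rat_hits_def by (fast dest: subsetD)
qed

lemma rat_approx:
  fixes s u \<delta> :: real
  assumes "0 \<le> s" "s \<le> u" "0 < \<delta>"
  obtains q where "q \<in> \<rat>" "0 \<le> q" "q \<le> s" "s - q < \<delta>"
proof (cases "s = 0")
  case True
  with assms show ?thesis by (intro that[of 0]) auto
next
  case False
  then have "max 0 (s - \<delta>) < s" using assms by auto
  from Rats_dense_in_real[OF this] show ?thesis using that by force
qed

lemma continuous_rat_ucont:
  assumes "continuous_on {0..} f"
  shows "rat_ucont f r"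
  unfolding rat_ucont_def
proof
  fix i :: nat
  have "uniformly_continuous_on {0..r} f"
    by (intro compact_uniformly_continuous continuous_on_subset[OF assms]) auto
  then obtain d where d: "d > 0" "\<And>x y. x \<in> {0..r} \<Longrightarrow> y \<in> {0..r} \<Longrightarrow> dist y x < d \<Longrightarrow> dist (f y) (f x) < 1 / real (Suc i)"
    unfolding uniformly_continuous_on_def by (metis divide_pos_pos of_nat_0_less_iff zero_less_Suc zero_less_one)
  obtain j where "1 / real (Suc j) < d" using d(1) by (rule nat_approx_posE)
  then show "\<exists>j. \<forall>p\<in>\<rat> \<inter> {0..r}. \<forall>q\<in>\<rat> \<inter> {0..r}. \<bar>p - q\<bar> < 1 / real (Suc j) \<longrightarrow> \<bar>f p - f q\<bar> < 1 / real (Suc i)"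
    using d(2) by (intro exI[of _ j]) (auto simp: dist_real_def)
qed

text \<open>On a compact interval |f| attains its minimum, so arbitrarily small values force a zero.
  Conversely a zero is approached by rational times from the left, which stay inside
  \<open>{0..u}\<close>.\<close>

lemma rat_hits_iff_zero:
  assumes f: "continuous_on {0..} f" and u: "0 \<le> u"
  shows "rat_hits f u \<longleftrightarrow> (\<exists>s\<in>{0..u}. f s = 0)"
proof
  assume hits: "rat_hits f u"
  show "\<exists>s\<in>{0..u}. f s = 0"
  proof (rule ccontr)
    assume no: "\<not> ?thesis"
    have "continuous_on {0..u} (\<lambda>s. \<bar>f s\<bar>)"
      by (intro continuous_intros continuous_on_subset[OF f]) auto
    then obtain z where z: "z \<in> {0..u}" "\<And>y. y \<in> {0..u} \<Longrightarrow> \<bar>f z\<bar> \<le> \<bar>f y\<bar>"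
      using continuous_attains_inf[of "{0..u}" "\<lambda>s. \<bar>f s\<bar>"] u by auto
    have "\<bar>f z\<bar> > 0" using no z(1) by auto
    then obtain n where n: "1 / real (Suc n) < \<bar>f z\<bar>" by (rule nat_approx_posE)
    obtain r where "r \<in> {0..u}" "\<bar>f r\<bar> < 1 / real (Suc n)" using hits unfolding rat_hits_def by blast
    with z(2) n show False by force
  qed
next
  assume "\<exists>s\<in>{0..u}. f s = 0"
  then obtain s where s: "0 \<le> s" "s \<le> u" "f s = 0" by auto
  show "rat_hits f u"
    unfolding rat_hits_def
  proof
    fix n :: nat
    have "continuous (at s within {0..}) f" using f s(1) by (auto simp: continuous_on_eq_continuous_within)
    then obtain d where d: "d > 0" "\<And>y. y \<in> {0..} \<Longrightarrow> dist y s < d \<Longrightarrow> dist (f y) (f s) < 1 / real (Suc n)"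
      unfolding continuous_within_eps_delta by (metis divide_pos_pos of_nat_0_less_iff zero_less_Suc zero_less_one)
    obtain q where "q \<in> \<rat>" "0 \<le> q" "q \<le> s" "s - q < d" using rat_approx[OF s(1,2) d(1)] .
    then show "\<exists>r\<in>\<rat> \<inter> {0..u}. rat_ucont f r \<and> \<bar>f r\<bar> < 1 / real (Suc n)"
      using d(2)[of q] s continuous_rat_ucont[OF f] by (intro bexI[of _ q]) (auto simp: dist_real_def)
  qed
qed

text \<open>This is what the clause \<open>rat_ucont f r\<close> buys: small values that occur only
  after \<open>u\<close> occur arbitrarily soon after it, and uniform continuity on a rational
  window reaching beyond \<open>u\<close> carries them back to a rational time that is not after
  \<open>u\<close>.\<close>

lemma rat_hits_right:
  assumes u: "0 \<le> u" and hits: "\<And>v. u < v \<Longrightarrow> rat_hits f v"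
  shows "rat_hits f u"
proof (rule ccontr)
  assume no: "\<not> rat_hits f u"
  then obtain n where no_n: "\<not> (\<exists>r\<in>\<rat> \<inter> {0..u}. rat_ucont f r \<and> \<bar>f r\<bar> < 1 / real (Suc n))"
    unfolding rat_hits_def by blast
  have n: "1 / real (Suc n) \<le> \<bar>f r\<bar>" if "r \<in> \<rat>" "0 \<le> r" "r \<le> u" "rat_ucont f r" for r
  proof (rule ccontr)
    assume "\<not> ?thesis"
    with that have "r \<in> \<rat> \<inter> {0..u}" "rat_ucont f r \<and> \<bar>f r\<bar> < 1 / real (Suc n)"
      by (simp_all only: not_le Int_iff atLeastAtMost_iff simp_thms)
    with no_n show False by blast
  qed
  have ex: "\<exists>r\<in>\<rat>. u < r \<and> r \<le> v \<and> rat_ucont f r \<and> \<bar>f r\<bar> < 1 / real (Suc m)" if uv: "u < v" and nm: "n \<le> m" for v m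
  proof -
    obtain r where r': "r \<in> \<rat> \<inter> {0..v}" and r: "rat_ucont f r" "\<bar>f r\<bar> < 1 / real (Suc m)"
      using hits[OF uv] unfolding rat_hits_def by blast
    then have "r \<in> \<rat>" "0 \<le> r" "r \<le> v" by auto
    note r = this r
    have "1 / real (Suc m) \<le> 1 / real (Suc n)" using nm by (simp add: frac_le)
    then have "u < r" using n[of r] r by linarith
    with r show ?thesis by blast
  qed
  obtain r1 where r1: "u < r1" "rat_ucont f r1" using ex[of "u + 1" n] by force
  \<comment> \<open>\<open>Suc (2 * n + 1)\<close> is twice \<open>Suc n\<close>: one half of the
    tolerance is spent on the value at \<open>r\<close> after \<open>u\<close>, the other on moving
    from \<open>r\<close> back to \<open>q \<le> u\<close>.\<close>
  obtain j where j: "\<And>p q. p \<in> \<rat> \<inter> {0..r1} \<Longrightarrow> q \<in> \<rat> \<inter> {0..r1} \<Longrightarrow> \<bar>p - q\<bar> < 1 / real (Suc j)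
      \<Longrightarrow> \<bar>f p - f q\<bar> < 1 / real (Suc (2 * n + 1))"
    using r1(2) unfolding rat_ucont_def by blast
  define \<delta> where "\<delta> = 1 / real (Suc j) / 2"
  have \<delta>: "\<delta> > 0" by (simp add: \<delta>_def)
  obtain r where r: "r \<in> \<rat>" "u < r" "r \<le> min r1 (u + \<delta>)" "\<bar>f r\<bar> < 1 / real (Suc (2 * n + 1))"
    using ex[of "min r1 (u + \<delta>)" "2 * n + 1"] r1 \<delta> by auto
  obtain q where q: "q \<in> \<rat>" "0 \<le> q" "q \<le> u" "u - q < \<delta>" using rat_approx[OF u order_refl \<delta>] .
  have "\<bar>f q - f r\<bar> < 1 / real (Suc (2 * n + 1))"
  proof (rule j)
    have "2 * \<delta> = 1 / real (Suc j)" by (simp add: \<delta>_def field_simps)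
    then show "\<bar>q - r\<bar> < 1 / real (Suc j)" using q r by (auto simp: abs_if)
  qed (use q r u in auto)
  moreover have "2 * (1 / real (Suc (2 * n + 1))) = 1 / real (Suc n)" by (simp add: field_simps)
  ultimately have "\<bar>f q\<bar> < 1 / real (Suc n)" using r(4) by linarith
  moreover have "rat_ucont f q" using rat_ucont_antimono[OF r1(2), of q] q r1 by auto
  ultimately show False using n[of q] q by auto
qed

text \<open>By right continuity (\<open>rat_hits_right\<close>) the infimum is attained, so the
  event is decided by countably many values of \<open>f\<close> on \<open>{0..u}\<close>.\<close>

lemma zero_time_le_iff:
  assumes "0 \<le> u"
  shows "zero_time f \<le> ennreal u \<longleftrightarrow> rat_hits f u"
proof
  assume le: "zero_time f \<le> ennreal u"
  show "rat_hits f u"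
  proof (rule rat_hits_right[OF assms])
    fix v assume "u < v"
    then have "ennreal u < ennreal v" using assms by (simp add: ennreal_less_iff)
    with le have "zero_time f < ennreal v" by (rule le_less_trans)
    then have "\<exists>w\<in>{w. 0 \<le> w \<and> rat_hits f w}. ennreal w < ennreal v"
      unfolding zero_time_def INF_less_iff .
    then obtain w where w: "w \<in> {w. 0 \<le> w \<and> rat_hits f w}" "ennreal w < ennreal v" by blast
    then have "w < v" by (simp add: ennreal_less_iff)
    with w show "rat_hits f v" using rat_hits_mono[of f w v] by simp
  qed
next
  assume "rat_hits f u"
  then show "zero_time f \<le> ennreal u" unfolding zero_time_def using assms by (intro INF_lower) auto
qed

lemma zero_time_le_iff_zero:
  assumes "continuous_on {0..} f" "0 \<le> u"
  shows "zero_time f \<le> ennreal u \<longleftrightarrow> (\<exists>s\<in>{0..u}. f s = 0)"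
  using zero_time_le_iff[OF assms(2)] rat_hits_iff_zero[OF assms] by simp

lemma zero_time_zero:
  assumes f: "continuous_on {0..} f" and "zero_time f = ennreal T" "0 \<le> T"
  shows "f T = 0"
proof -
  obtain s where s: "0 \<le> s" "s \<le> T" "f s = 0"
    using zero_time_le_iff_zero[OF f, of T] assms by auto
  then have "zero_time f \<le> ennreal s" using zero_time_le_iff_zero[OF f s(1)] by auto
  then have "T \<le> s" using assms s by (simp add: ennreal_le_iff)
  with s show ?thesis by auto
qed

section \<open>Stopping times built from events of the past\<close>

context filtration
begin

lemma borel_measurable_F_mono: "g \<in> borel_measurable (F i) \<Longrightarrow> i \<le> j \<Longrightarrow> g \<in> borel_measurable (F j)"
  using sets_F_mono[of i j] by (auto simp: measurable_def space_F)

text \<open>Within \<open>{T \<le> u}\<close> the complementary event \<open>S < T\<close> forces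
  \<open>S \<le> u\<close>. It is therefore visible at time \<open>u\<close>, because the strict
  comparison belongs to the sigma-algebra of \<open>S\<close>.\<close>

lemma pre_sigma_le:
  assumes T: "stopping_time F T" and S: "stopping_time F S"
  shows "{\<omega>\<in>\<Omega>. T \<omega> \<le> S \<omega>} \<in> sets (pre_sigma T)"
proof (rule sets_pre_sigmaI[OF T])
  fix u
  have "{\<omega>\<in>\<Omega>. S \<omega> < T \<omega>} \<in> sets (pre_sigma S)"
    using stopping_time_less[OF S T] by (simp add: pred_def space_pre_sigma)
  from sets_pre_sigmaD[OF S this] have "{\<omega>\<in>{\<omega>\<in>\<Omega>. S \<omega> < T \<omega>}. S \<omega> \<le> u} \<in> sets (F u)" .
  moreover have "{\<omega>\<in>\<Omega>. T \<omega> \<le> u} \<in> sets (F u)" using stopping_timeD[OF T, of u] by (simp add: pred_def space_F)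
  ultimately have "{\<omega>\<in>\<Omega>. T \<omega> \<le> u} - {\<omega>\<in>{\<omega>\<in>\<Omega>. S \<omega> < T \<omega>}. S \<omega> \<le> u} \<in> sets (F u)" by auto
  also have "{\<omega>\<in>\<Omega>. T \<omega> \<le> u} - {\<omega>\<in>{\<omega>\<in>\<Omega>. S \<omega> < T \<omega>}. S \<omega> \<le> u} = {\<omega> \<in> {\<omega>\<in>\<Omega>. T \<omega> \<le> S \<omega>}. T \<omega> \<le> u}"
    by (auto simp: not_less not_le)
  finally show "{\<omega> \<in> {\<omega>\<in>\<Omega>. T \<omega> \<le> S \<omega>}. T \<omega> \<le> u} \<in> sets (F u)" .
qed

end

lemma stopping_time_restrict:
  fixes F :: "ennreal \<Rightarrow> 'w measure"
  assumes "filtration \<Omega> F" and T: "stopping_time F T" and A: "A \<in> sets (filtration.pre_sigma \<Omega> F T)"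
  shows "stopping_time F (\<lambda>\<omega>. if \<omega> \<in> A then T \<omega> else \<infinity>)"
proof
  interpret filtration \<Omega> F by fact
  fix u
  show "Measurable.pred (F u) (\<lambda>\<omega>. (if \<omega> \<in> A then T \<omega> else \<infinity>) \<le> u)"
  proof (cases "u = \<infinity>")
    case False
    have "A \<subseteq> \<Omega>" using sets.sets_into_space[OF A] by (simp add: space_pre_sigma)
    then have "{\<omega>\<in>space (F u). (if \<omega> \<in> A then T \<omega> else \<infinity>) \<le> u} = {\<omega>\<in>A. T \<omega> \<le> u}"
      using False by (auto simp: space_F top_unique)
    with sets_pre_sigmaD[OF T A, of u] show ?thesis by (simp add: pred_def)
  qed simp
qed

text \<open>Every quantifier in \<open>rat_hits\<close> runs over naturals or over rationals in
  \<open>{0..u}\<close>, so the event lies in \<open>F u\<close> without completing the filtration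
  or passing to right limits.\<close>

lemma stopping_time_zero_time:
  fixes F :: "ennreal \<Rightarrow> 'w measure" and f :: "real \<Rightarrow> 'w \<Rightarrow> real"
  assumes "filtration \<Omega> F" and f: "\<And>u. 0 \<le> u \<Longrightarrow> f u \<in> borel_measurable (F (ennreal u))"
  shows "stopping_time F (\<lambda>\<omega>. zero_time (\<lambda>u. f u \<omega>))"
proof
  interpret filtration \<Omega> F by fact
  fix t :: ennreal
  show "Measurable.pred (F t) (\<lambda>\<omega>. zero_time (\<lambda>u. f u \<omega>) \<le> t)"
  proof (cases t)
    case (real u)
    have f_meas: "f r \<in> borel_measurable (F t)" if "r \<in> \<rat> \<inter> {0..u}" for r
    proof (rule borel_measurable_F_mono)
      show "f r \<in> borel_measurable (F (ennreal r))" using that by (intro f) auto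
      show "ennreal r \<le> t" using that real by (auto intro: ennreal_leI)
    qed
    have cnt: "countable (\<rat> \<inter> {0..r})" for r :: real by (rule countable_Int1[OF countable_rat])
    have uc: "Measurable.pred (F t) (\<lambda>\<omega>. rat_ucont (\<lambda>s. f s \<omega>) r)" if r: "r \<in> \<rat> \<inter> {0..u}" for r
    proof -
      have "Measurable.pred (F t) (\<lambda>\<omega>. \<bar>p - q\<bar> < 1 / real (Suc j) \<longrightarrow> \<bar>f p \<omega> - f q \<omega>\<bar> < 1 / real (Suc i))"
        if "p \<in> \<rat> \<inter> {0..r}" "q \<in> \<rat> \<inter> {0..r}" for p q i j
      proof -
        have [measurable]: "f p \<in> borel_measurable (F t)" "f q \<in> borel_measurable (F t)"
          using that r by (auto intro!: f_meas)
        show ?thesis by measurable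
      qed
      then show ?thesis unfolding rat_ucont_def
        by (intro pred_intros_countable(1,2) measurable_pred_countable cnt)
    qed
    have "Measurable.pred (F t) (\<lambda>\<omega>. rat_ucont (\<lambda>s. f s \<omega>) r \<and> \<bar>f r \<omega>\<bar> < 1 / real (Suc n))"
      if r: "r \<in> \<rat> \<inter> {0..u}" for r n
    proof -
      note [measurable] = f_meas[OF r] uc[OF r]
      show ?thesis by measurable
    qed
    then have "Measurable.pred (F t) (\<lambda>\<omega>. rat_hits (\<lambda>s. f s \<omega>) u)"
      unfolding rat_hits_def
      by (intro pred_intros_countable(1,2) measurable_pred_countable cnt)
    then show ?thesis using zero_time_le_iff[of u] real by simp
  qed simp
qed

section \<open>The reflection principle\<close>

text \<open>At a random time \<open>Z (S a) a\<close> need not be measurable, since nothing is known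
  about discontinuous paths. The limit of \<open>Z\<close> along grid times of mesh
  \<open>1 / Suc n\<close>, which take countably many values, is measurable and agrees with it on
  continuous paths.\<close>

lemma measurable_eval:
  fixes Z :: "real \<Rightarrow> 'a \<Rightarrow> 'b::{banach,second_countable_topology}"
  assumes Z: "\<And>u. 0 \<le> u \<Longrightarrow> Z u \<in> borel_measurable N" and S[measurable]: "S \<in> borel_measurable N"
  shows "\<exists>g. g \<in> borel_measurable N \<and>
    (\<forall>a. continuous_on {0..} (\<lambda>u. Z u a) \<longrightarrow> 0 \<le> S a \<longrightarrow> g a = Z (S a) a)"
proof (intro exI conjI allI impI)
  define disc where "disc n s = real_of_int \<lceil>real (Suc n) * s\<rceil> / real (Suc n)" for n s
  define g where "g a = lim (\<lambda>n. Z (max 0 (disc n (S a))) a)" for a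
  have "(\<lambda>a. Z (max 0 (disc n (S a))) a) \<in> borel_measurable N" for n
    unfolding disc_def
    by (rule measurable_compose_countable[where f="\<lambda>k a. Z (max 0 (real_of_int k / real (Suc n))) a"
          and g="\<lambda>a. \<lceil>real (Suc n) * S a\<rceil>"]) (auto intro!: Z)
  then show "g \<in> borel_measurable N" unfolding g_def by (rule borel_measurable_lim_metric)
  fix a assume cont: "continuous_on {0..} (\<lambda>u. Z u a)" and pos: "0 \<le> S a"
  have "(\<lambda>n. disc n (S a)) \<longlonglongrightarrow> S a"
  proof (rule tendsto_sandwich[OF _ _ tendsto_const LIMSEQ_inverse_real_of_nat_add])
    have "S a \<le> disc n (S a) \<and> disc n (S a) \<le> S a + inverse (real (Suc n))" for n
    proof -
      have "real (Suc n) * S a \<le> real_of_int \<lceil>real (Suc n) * S a\<rceil>"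
        "real_of_int \<lceil>real (Suc n) * S a\<rceil> \<le> real (Suc n) * S a + 1" by linarith+
      then show ?thesis unfolding disc_def by (simp add: field_simps del: of_nat_Suc)
    qed
    then show "\<forall>\<^sub>F n in sequentially. S a \<le> disc n (S a)"
      "\<forall>\<^sub>F n in sequentially. disc n (S a) \<le> S a + inverse (real (Suc n))" by auto
  qed
  then have "(\<lambda>n. max 0 (disc n (S a))) \<longlonglongrightarrow> max 0 (S a)" by (intro tendsto_max tendsto_const)
  then have "(\<lambda>n. max 0 (disc n (S a))) \<longlonglongrightarrow> S a" using pos by (simp add: max_def)
  then have "(\<lambda>n. Z (max 0 (disc n (S a))) a) \<longlonglongrightarrow> Z (S a) a"
    by (rule continuous_on_tendsto_compose[OF cont]) (use pos in auto)
  then show "g a = Z (S a) a" unfolding g_def by (rule limI)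
qed

lemma borel_measurable_completion_AE:
  fixes f :: "'a \<Rightarrow> 'b::topological_space"
  assumes g: "g \<in> borel_measurable (completion N)" and ae: "AE a in completion N. f a = g a"
  shows "f \<in> borel_measurable (completion N)"
proof (rule measurableI)
  fix B :: "'b set" assume B: "B \<in> sets borel"
  show "f -` B \<inter> space (completion N) \<in> sets (completion N)"
    using ae by (intro completion.in_sets_AE[OF _ measurable_sets[OF g B]]) (auto elim!: eventually_mono)
qed auto

text \<open>Agreement with a product-measurable \<open>h\<close> is demanded on continuous paths
  only, because hitting events depend on uncountably many times. The bound makes all expectations
  finite.\<close>

definition path_functional :: "((real \<Rightarrow> real ^ 'n::{finite,linorder}) \<Rightarrow> real) \<Rightarrow> bool" where
  "path_functional \<psi> \<longleftrightarrow> (\<exists>K. \<forall>p. \<bar>\<psi> p\<bar> \<le> K) \<and>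
    (\<exists>h\<in>borel_measurable path_space. \<forall>p. continuous_on {0..} p \<longrightarrow> \<psi> p = h (restrict p {0..}))"

lemma space_path_space: "space path_space = extensional {0..}"
  by (auto simp: path_space_def space_PiM PiE_def)

lemma path_functional_const [intro, simp]: "path_functional (\<lambda>_. c)"
  unfolding path_functional_def by (intro conjI exI[of _ "\<bar>c\<bar>"] bexI[of _ "\<lambda>_. c"]) auto

lemma path_functional_combine:
  fixes \<phi> \<psi> :: "(real \<Rightarrow> real ^ 'n::{finite,linorder}) \<Rightarrow> real"
  assumes "path_functional \<phi>" "path_functional \<psi>"
    and f: "\<And>g h. g \<in> borel_measurable path_space \<Longrightarrow> h \<in> borel_measurable path_space
      \<Longrightarrow> (\<lambda>p. f (g p) (h p)) \<in> borel_measurable (path_space :: (real \<Rightarrow> (real, 'n) vec) measure)"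
    and bound: "\<And>K L. \<exists>C. \<forall>a b. \<bar>a\<bar> \<le> K \<longrightarrow> \<bar>b\<bar> \<le> L \<longrightarrow> \<bar>f a b\<bar> \<le> C"
  shows "path_functional (\<lambda>p. f (\<phi> p) (\<psi> p))"
proof -
  obtain g h where "g \<in> borel_measurable path_space" "h \<in> borel_measurable path_space"
    "\<And>p. continuous_on {0..} p \<Longrightarrow> \<phi> p = g (restrict p {0..})"
    "\<And>p. continuous_on {0..} p \<Longrightarrow> \<psi> p = h (restrict p {0..})"
    using assms(1,2) unfolding path_functional_def by blast
  moreover obtain K L where "\<And>p. \<bar>\<phi> p\<bar> \<le> K" "\<And>p. \<bar>\<psi> p\<bar> \<le> L"
    using assms(1,2) unfolding path_functional_def by blast
  then have "\<exists>C. \<forall>p. \<bar>f (\<phi> p) (\<psi> p)\<bar> \<le> C" using bound[of K L] by blast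
  ultimately show ?thesis unfolding path_functional_def
    by (intro conjI bexI[of _ "\<lambda>p. f (g p) (h p)"] f) auto
qed

lemma path_functional_times [intro]:
  "path_functional \<phi> \<Longrightarrow> path_functional \<psi> \<Longrightarrow> path_functional (\<lambda>p. \<phi> p * \<psi> p)"
proof (rule path_functional_combine[where f="(*)"])
  show "\<exists>C. \<forall>a b. \<bar>a\<bar> \<le> K \<longrightarrow> \<bar>b\<bar> \<le> L \<longrightarrow> \<bar>a * b\<bar> \<le> C" for K L :: real
    by (rule exI[of _ "K * L"]) (auto simp: abs_mult intro!: mult_mono)
qed auto

lemma path_functional_add [intro]:
  "path_functional \<phi> \<Longrightarrow> path_functional \<psi> \<Longrightarrow> path_functional (\<lambda>p. \<phi> p + \<psi> p)"
proof (rule path_functional_combine[where f="(+)"])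
  show "\<exists>C. \<forall>a b. \<bar>a\<bar> \<le> K \<longrightarrow> \<bar>b\<bar> \<le> L \<longrightarrow> \<bar>a + b\<bar> \<le> C" for K L :: real
    by (rule exI[of _ "K + L"]) auto
qed auto

lemma path_functional_diff [intro]:
  "path_functional \<phi> \<Longrightarrow> path_functional \<psi> \<Longrightarrow> path_functional (\<lambda>p. \<phi> p - \<psi> p)"
proof (rule path_functional_combine[where f="(-)"])
  show "\<exists>C. \<forall>a b. \<bar>a\<bar> \<le> K \<longrightarrow> \<bar>b\<bar> \<le> L \<longrightarrow> \<bar>a - b\<bar> \<le> C" for K L :: real
    by (rule exI[of _ "K + L"]) auto
qed auto

lemma path_functional_sum [intro]:
  "(\<And>i. i \<in> I \<Longrightarrow> path_functional (\<phi> i)) \<Longrightarrow> path_functional (\<lambda>p. \<Sum>i\<in>I. \<phi> i p)"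
  by (induction I rule: infinite_finite_induct) auto

lemma path_functional_prod [intro]:
  "(\<And>i. i \<in> I \<Longrightarrow> path_functional (\<phi> i)) \<Longrightarrow> path_functional (\<lambda>p. \<Prod>i\<in>I. \<phi> i p)"
  by (induction I rule: infinite_finite_induct) auto

section \<open>The strong Markov property and the joint law of past and future\<close>

locale reflectable_process =
  fixes V :: "(real ^ 'n::{finite,linorder}) set" and M :: "'w measure"
    and P :: "(real, 'n) vec \<Rightarrow> 'w measure" and X :: "real \<Rightarrow> 'w \<Rightarrow> (real, 'n) vec" and x :: "(real, 'n) vec"
  assumes reflectable: "reflectable V M P X" and start_V: "x \<in> V"
begin

definition \<mu> where "\<mu> = completion (P x)"

definition path :: "'w \<Rightarrow> real \<Rightarrow> (real, 'n) vec" where "path \<omega> = (\<lambda>u. X u \<omega>)"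

definition reflect_from :: "('w \<Rightarrow> ennreal) \<Rightarrow> ((real, 'n) vec \<Rightarrow> (real, 'n) vec) \<Rightarrow> 'w \<Rightarrow> real \<Rightarrow> (real, 'n) vec" where
  "reflect_from T w \<omega> = (\<lambda>u. if T \<omega> \<le> ennreal u then w (X u \<omega>) else X u \<omega>)"

abbreviation "NF \<equiv> natural_filtration M X"

abbreviation "pre T \<equiv> filtration.pre_sigma (space M) NF T"

lemma X_meas: "0 \<le> u \<Longrightarrow> X u \<in> borel_measurable M"
  using reflectable unfolding reflectable_def process_with_laws_def by blast

lemma X_in_V: "0 \<le> u \<Longrightarrow> \<omega> \<in> space M \<Longrightarrow> X u \<omega> \<in> V"
  using reflectable unfolding reflectable_def process_with_laws_def by blast

lemma law: "y \<in> V \<Longrightarrow> prob_space (P y)" "y \<in> V \<Longrightarrow> sets (P y) = sets M" "y \<in> V \<Longrightarrow> space (P y) = space M"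
proof -
  show "y \<in> V \<Longrightarrow> prob_space (P y)" and s: "y \<in> V \<Longrightarrow> sets (P y) = sets M"
    using reflectable unfolding reflectable_def process_with_laws_def by blast+
  show "y \<in> V \<Longrightarrow> space (P y) = space M" using sets_eq_imp_space_eq[OF s] .
qed

lemma space_\<mu> [simp]: "space \<mu> = space M"
  using law(3)[OF start_V] by (simp add: \<mu>_def)

lemma sets_M_\<mu>: "A \<in> sets M \<Longrightarrow> A \<in> sets \<mu>"
  using law(2)[OF start_V] by (auto simp: \<mu>_def)

lemma measurable_M_\<mu>:
  assumes "f \<in> measurable M N"
  shows "f \<in> measurable \<mu> N"
proof (rule measurableI)
  show "f \<omega> \<in> space N" if "\<omega> \<in> space \<mu>" for \<omega> using measurable_space[OF assms] that by simp
  show "f -` A \<inter> space \<mu> \<in> sets \<mu>" if "A \<in> sets N" for A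
    using sets_M_\<mu>[OF measurable_sets[OF assms that]] by simp
qed

lemma prob_space_\<mu>: "prob_space \<mu>"
  unfolding \<mu>_def using law(1)[OF start_V] by (rule prob_space.prob_space_completion)

sublocale prob_space \<mu> by (rule prob_space_\<mu>)

lemma AE_start: "AE \<omega> in \<mu>. X 0 \<omega> = x"
  unfolding \<mu>_def using reflectable start_V unfolding reflectable_def process_with_laws_def by (blast intro: AE_completion)

lemma AE_continuous: "AE \<omega> in \<mu>. continuous_on {0..} (path \<omega>)"
  unfolding \<mu>_def path_def using reflectable start_V unfolding reflectable_def by (blast intro: AE_completion)

lemma filtration_NF: "filtration (space M) NF"
  by (rule filtration_natural_filtration)

lemma sets_NF: "sets (NF t) = sigma_sets (space M) {X s -` B \<inter> space M | s B. 0 \<le> s \<and> ennreal s \<le> t \<and> B \<in> sets borel}"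
  unfolding natural_filtration_def by (rule sets_measure_of) auto

lemma space_NF [simp]: "space (NF t) = space M"
  using filtration.space_F[OF filtration_NF] .

lemma sets_NF_M: "sets (NF t) \<subseteq> sets M"
  unfolding sets_NF by (rule sets.sigma_sets_subset) (auto intro!: measurable_sets[OF X_meas])

lemma X_adapted: "0 \<le> u \<Longrightarrow> ennreal u \<le> t \<Longrightarrow> X u \<in> borel_measurable (NF t)"
  by (rule measurableI) (auto simp: sets_NF intro!: sigma_sets.Basic)

lemma space_pre [simp]: "space (pre T) = space M"
  using filtration.space_pre_sigma[OF filtration_NF] .

lemma stopping_time_meas: "stopping_time NF T \<Longrightarrow> T \<in> borel_measurable M"
  by (rule measurable_stopping_time[where F=NF]) (use sets_NF_M in auto)

lemma sets_pre_M:
  assumes T: "stopping_time NF T"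
  shows "sets (pre T) \<subseteq> sets M"
proof
  fix A assume A: "A \<in> sets (pre T)"
  have "{\<omega>\<in>A. T \<omega> \<le> top} \<in> sets (NF top)"
    by (rule filtration.sets_pre_sigmaD[OF filtration_NF T A])
  then show "A \<in> sets M" using sets_NF_M by auto
qed

lemma measurable_pre_\<mu>:
  assumes "stopping_time NF T"
  shows "(\<lambda>\<omega>. \<omega>) \<in> measurable \<mu> (pre T)"
proof (rule measurableI)
  show "(\<lambda>\<omega>. \<omega>) -` A \<inter> space \<mu> \<in> sets \<mu>" if "A \<in> sets (pre T)" for A
    using sets_M_\<mu>[of A] subsetD[OF sets_pre_M[OF assms] that] sets.sets_into_space[OF that] by (simp add: Int_absorb2)
qed simp

lemma path_map_measurable:
  assumes "w \<in> borel_measurable borel"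
  shows "(\<lambda>\<theta>. \<lambda>u\<in>{0..}. w (\<theta> u)) \<in> measurable path_space (path_space :: (real \<Rightarrow> (real, 'n) vec) measure)"
  unfolding path_space_def
  by (rule measurable_restrict) (auto intro!: measurable_compose[OF _ assms])

lemma path_into_path_space: "N \<in> {M, \<mu>} \<Longrightarrow> (\<lambda>\<omega>. \<lambda>u\<in>{0..}. X u \<omega>) \<in> measurable N path_space"
  unfolding path_space_def by (rule measurable_restrict) (auto intro!: X_meas measurable_M_\<mu>)

lemma law_invariant:
  assumes y: "y \<in> V" and w: "w \<in> affine_weyl_group" "w y = y" "w \<in> borel_measurable borel" and B: "B \<in> sets path_space"
  shows "emeasure (P y) {\<omega>\<in>space M. (\<lambda>u\<in>{0..}. w (X u \<omega>)) \<in> B} = emeasure (P y) {\<omega>\<in>space M. (\<lambda>u\<in>{0..}. X u \<omega>) \<in> B}"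
proof -
  have X: "(\<lambda>\<omega>. \<lambda>u\<in>{0..}. X u \<omega>) \<in> measurable (P y) path_space"
    by (subst measurable_cong_sets[OF law(2)[OF y] refl]) (simp add: path_into_path_space)
  then have wX: "(\<lambda>\<omega>. \<lambda>u\<in>{0..}. w (X u \<omega>)) \<in> measurable (P y) path_space"
    using measurable_compose[OF X path_map_measurable[OF w(3)]] by (simp cong: restrict_cong)
  have "distr (P y) path_space (\<lambda>\<omega>. \<lambda>u\<in>{0..}. w (X u \<omega>)) = distr (P y) path_space (\<lambda>\<omega>. \<lambda>u\<in>{0..}. X u \<omega>)"
    using reflectable[unfolded reflectable_def, THEN conjunct2, THEN conjunct2, THEN conjunct2, rule_format, OF w(1) y] w(2)
    by simp
  then have "emeasure (distr (P y) path_space (\<lambda>\<omega>. \<lambda>u\<in>{0..}. w (X u \<omega>))) B =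
      emeasure (distr (P y) path_space (\<lambda>\<omega>. \<lambda>u\<in>{0..}. X u \<omega>)) B" by simp
  then show ?thesis
    by (simp add: emeasure_distr[OF X B] emeasure_distr[OF wX B] law(3)[OF y] vimage_def Int_def conj_commute)
qed

text \<open>Given the past, the future has the law of the process started at its position at time
  \<open>T\<close>. As \<open>w\<close> fixes this position, that law is invariant under
  \<open>w\<close>. The strong Markov property for \<open>B\<close> and for its preimage
  \<open>B'\<close> under \<open>w\<close> then compares the two futures.\<close>

lemma strong_markov_reflect:
  assumes T: "stopping_time NF T" and F: "F \<in> sets (pre T)" and B: "B \<in> sets path_space"
    and w: "w \<in> affine_weyl_group" "w \<in> borel_measurable borel"
    and fixed: "AE \<omega> in \<mu>. T \<omega> < \<infinity> \<longrightarrow> w (X (enn2real (T \<omega>)) \<omega>) = X (enn2real (T \<omega>)) \<omega>"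
  shows "emeasure \<mu> {\<omega>\<in>F. T \<omega> < \<infinity> \<and> (\<lambda>u\<in>{0..}. w (X (enn2real (T \<omega>) + u) \<omega>)) \<in> B}
    = emeasure \<mu> {\<omega>\<in>F. T \<omega> < \<infinity> \<and> (\<lambda>u\<in>{0..}. X (enn2real (T \<omega>) + u) \<omega>) \<in> B}"
proof -
  have sm: "emeasure \<mu> {\<omega>\<in>F. T \<omega> < \<infinity> \<and> (\<lambda>u\<in>{0..}. X (enn2real (T \<omega>) + u) \<omega>) \<in> B} =
         (\<integral>\<^sup>+\<omega>\<in>{\<omega>\<in>F. T \<omega> < \<infinity>}.
            emeasure (P (X (enn2real (T \<omega>)) \<omega>)) {\<omega>'\<in>space M. (\<lambda>t\<in>{0..}. X t \<omega>') \<in> B} \<partial>\<mu>)"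
    if "B \<in> sets path_space" for B
    unfolding \<mu>_def
    using reflectable[unfolded reflectable_def strong_markov_def, THEN conjunct2, THEN conjunct1, rule_format,
        OF start_V T F that] .
  define B' where "B' = (\<lambda>\<theta>. \<lambda>u\<in>{0..}. w (\<theta> u)) -` B \<inter> space path_space"
  have B': "B' \<in> sets path_space" unfolding B'_def using path_map_measurable[OF w(2)] B by (rule measurable_sets)
  have in_B': "(\<lambda>u\<in>{0..}. f u) \<in> B' \<longleftrightarrow> (\<lambda>u\<in>{0..}. w (f u)) \<in> B" for f
    by (simp add: B'_def space_path_space cong: restrict_cong)
  have F_sub: "F \<subseteq> space M" using sets.sets_into_space[OF F] by simp
  have "(\<integral>\<^sup>+\<omega>\<in>{\<omega>\<in>F. T \<omega> < \<infinity>}.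
            emeasure (P (X (enn2real (T \<omega>)) \<omega>)) {\<omega>'\<in>space M. (\<lambda>t\<in>{0..}. X t \<omega>') \<in> B'} \<partial>\<mu>) =
        (\<integral>\<^sup>+\<omega>\<in>{\<omega>\<in>F. T \<omega> < \<infinity>}.
            emeasure (P (X (enn2real (T \<omega>)) \<omega>)) {\<omega>'\<in>space M. (\<lambda>t\<in>{0..}. X t \<omega>') \<in> B} \<partial>\<mu>)"
  proof (rule nn_integral_cong_AE)
    show "AE \<omega> in \<mu>. emeasure (P (X (enn2real (T \<omega>)) \<omega>)) {\<omega>'\<in>space M. (\<lambda>t\<in>{0..}. X t \<omega>') \<in> B'}
          * indicator {\<omega>\<in>F. T \<omega> < \<infinity>} \<omega>
        = emeasure (P (X (enn2real (T \<omega>)) \<omega>)) {\<omega>'\<in>space M. (\<lambda>t\<in>{0..}. X t \<omega>') \<in> B} * indicator {\<omega>\<in>F. T \<omega> < \<infinity>} \<omega>"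
      using fixed
    proof eventually_elim
      case (elim \<omega>)
      show ?case
      proof (cases "\<omega> \<in> F \<and> T \<omega> < \<infinity>")
        case True
        then have "X (enn2real (T \<omega>)) \<omega> \<in> V" using F_sub by (intro X_in_V) auto
        then show ?thesis using law_invariant[of "X (enn2real (T \<omega>)) \<omega>" w B] w B elim True by (simp add: in_B')
      qed auto
    qed
  qed
  then show ?thesis using sm[OF B] sm[OF B'] by (simp add: in_B')
qed

text \<open>The zero path is a placeholder on \<open>T = \<infinity>\<close>; it makes the map total
  and does not involve \<open>w\<close>, so it never distinguishes a reflected future from an
  unreflected one.\<close>

definition shifted :: "('w \<Rightarrow> ennreal) \<Rightarrow> ((real, 'n) vec \<Rightarrow> (real, 'n) vec) \<Rightarrow> 'w \<Rightarrow> real \<Rightarrow> (real, 'n) vec" where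
  "shifted T w \<omega> = (if T \<omega> < \<infinity> then (\<lambda>u\<in>{0..}. w (X (enn2real (T \<omega>) + u) \<omega>)) else (\<lambda>u\<in>{0..}. 0))"

lemma finite_time_in_pre: "stopping_time NF T \<Longrightarrow> {\<omega>\<in>space M. T \<omega> < \<infinity>} \<in> sets (pre T)"
  using measurable_sets[OF filtration.measurable_stopping_time_pre_sigma[OF filtration_NF], of T "{..< \<infinity>}"]
  by (simp add: vimage_def Int_def conj_commute)

text \<open>The completed measure is essential: the value of \<open>X\<close> at a random time
  agrees with a measurable map almost surely, not everywhere.\<close>

lemma shift_measurable:
  assumes T: "stopping_time NF T" and w: "w \<in> borel_measurable borel"
  shows "(\<lambda>\<omega>. \<lambda>u\<in>{0..}. w (X (enn2real (T \<omega>) + u) \<omega>)) \<in> measurable \<mu> path_space"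
  unfolding path_space_def
proof (rule measurable_restrict)
  fix u :: real assume u: "u \<in> {0..}"
  have "(\<lambda>\<omega>. enn2real (T \<omega>) + u) \<in> borel_measurable M" using stopping_time_meas[OF T] by measurable
  from measurable_eval[OF X_meas this]
  obtain g where "g \<in> borel_measurable M \<and> (\<forall>\<omega>. continuous_on {0..} (\<lambda>u. X u \<omega>) \<longrightarrow>
      0 \<le> enn2real (T \<omega>) + u \<longrightarrow> g \<omega> = X (enn2real (T \<omega>) + u) \<omega>)" ..
  then have g: "g \<in> borel_measurable M"
    "\<And>\<omega>. continuous_on {0..} (\<lambda>u. X u \<omega>) \<Longrightarrow> 0 \<le> enn2real (T \<omega>) + u \<Longrightarrow> g \<omega> = X (enn2real (T \<omega>) + u) \<omega>"
    by simp_all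
  have "AE \<omega> in completion (P x). X (enn2real (T \<omega>) + u) \<omega> = g \<omega>"
    using AE_continuous unfolding \<mu>_def path_def by eventually_elim (use g(2) u in simp)
  moreover have "g \<in> borel_measurable (completion (P x))" using measurable_M_\<mu>[OF g(1)] by (simp add: \<mu>_def)
  ultimately have "(\<lambda>\<omega>. X (enn2real (T \<omega>) + u) \<omega>) \<in> borel_measurable \<mu>"
    unfolding \<mu>_def by (rule borel_measurable_completion_AE[rotated])
  then show "(\<lambda>\<omega>. w (X (enn2real (T \<omega>) + u) \<omega>)) \<in> borel_measurable \<mu>" by (rule measurable_compose[OF _ w])
qed

lemma shifted_measurable:
  assumes T: "stopping_time NF T" and w: "w \<in> borel_measurable borel"
  shows "shifted T w \<in> measurable \<mu> path_space"
  unfolding shifted_def[abs_def]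
proof (rule measurable_If)
  show "{\<omega> \<in> space \<mu>. T \<omega> < \<infinity>} \<in> sets \<mu>"
    using sets_M_\<mu>[OF subsetD[OF sets_pre_M[OF T] finite_time_in_pre[OF T]]] by simp
  show "(\<lambda>\<omega>. \<lambda>u\<in>{0..}. 0) \<in> measurable \<mu> path_space"
    by (rule measurable_const) (simp add: space_path_space)
qed (rule shift_measurable[OF T w])

text \<open>Rectangles of a past and a future event generate the product and are closed under
  intersection. On \<open>T < \<infinity>\<close> they are compared by
  \<open>strong_markov_reflect\<close>; elsewhere both futures are the placeholder.\<close>

lemma shifted_joint_law:
  assumes T: "stopping_time NF T" and w: "w \<in> affine_weyl_group" "w \<in> borel_measurable borel"
    and fixed: "AE \<omega> in \<mu>. T \<omega> < \<infinity> \<longrightarrow> w (X (enn2real (T \<omega>)) \<omega>) = X (enn2real (T \<omega>)) \<omega>"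
  shows "distr \<mu> (pre T \<Otimes>\<^sub>M path_space) (\<lambda>\<omega>. (\<omega>, shifted T w \<omega>)) =
    distr \<mu> (pre T \<Otimes>\<^sub>M path_space) (\<lambda>\<omega>. (\<omega>, shifted T (\<lambda>y. y) \<omega>))" (is "?D w = ?D (\<lambda>y. y)")
proof -
  let ?N = "pre T \<Otimes>\<^sub>M (path_space :: (real \<Rightarrow> (real, 'n) vec) measure)"
  let ?E = "{a \<times> b | a b. a \<in> sets (pre T) \<and> b \<in> sets (path_space :: (real \<Rightarrow> (real, 'n) vec) measure)}"
  have meas: "(\<lambda>\<omega>. (\<omega>, shifted T v \<omega>)) \<in> measurable \<mu> ?N" if "v \<in> borel_measurable borel" for v
    by (intro measurable_Pair measurable_pre_\<mu> shifted_measurable T that)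
  have split: "emeasure (?D v) (F \<times> B) = emeasure \<mu> {\<omega>\<in>F. T \<omega> < \<infinity> \<and> (\<lambda>u\<in>{0..}. v (X (enn2real (T \<omega>) + u) \<omega>)) \<in> B}
      + emeasure \<mu> {\<omega>\<in>F. \<not> T \<omega> < \<infinity> \<and> (\<lambda>u\<in>{0..}. 0) \<in> B}"
    if v: "v \<in> borel_measurable borel" and F: "F \<in> sets (pre T)" and B: "B \<in> sets path_space" for v F B
  proof -
    have F_sub: "F \<subseteq> space M" using sets.sets_into_space[OF F] by simp
    have F\<mu>: "F \<in> sets \<mu>" by (rule sets_M_\<mu>[OF subsetD[OF sets_pre_M[OF T] F]])
    have fin: "{\<omega>\<in>space M. T \<omega> < \<infinity>} \<in> sets \<mu>"
      by (rule sets_M_\<mu>[OF subsetD[OF sets_pre_M[OF T] finite_time_in_pre[OF T]]])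
    have 1: "{\<omega>\<in>F. T \<omega> < \<infinity> \<and> (\<lambda>u\<in>{0..}. v (X (enn2real (T \<omega>) + u) \<omega>)) \<in> B} =
        F \<inter> {\<omega>\<in>space M. T \<omega> < \<infinity>} \<inter> ((\<lambda>\<omega>. \<lambda>u\<in>{0..}. v (X (enn2real (T \<omega>) + u) \<omega>)) -` B \<inter> space \<mu>)"
      using F_sub by auto
    have 2: "{\<omega>\<in>F. \<not> T \<omega> < \<infinity> \<and> (\<lambda>u\<in>{0..}. 0) \<in> B} = (if (\<lambda>u\<in>{0..}. 0) \<in> B then F - {\<omega>\<in>space M. T \<omega> < \<infinity>} else {})"
      using F_sub by auto
    have "emeasure (?D v) (F \<times> B) = emeasure \<mu> ((\<lambda>\<omega>. (\<omega>, shifted T v \<omega>)) -` (F \<times> B) \<inter> space \<mu>)"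
      by (rule emeasure_distr[OF meas[OF v]]) (use F B in auto)
    also have "(\<lambda>\<omega>. (\<omega>, shifted T v \<omega>)) -` (F \<times> B) \<inter> space \<mu> =
      {\<omega>\<in>F. T \<omega> < \<infinity> \<and> (\<lambda>u\<in>{0..}. v (X (enn2real (T \<omega>) + u) \<omega>)) \<in> B} \<union> {\<omega>\<in>F. \<not> T \<omega> < \<infinity> \<and> (\<lambda>u\<in>{0..}. 0) \<in> B}"
      using F_sub by (auto simp: shifted_def split: if_splits)
    also have "emeasure \<mu> \<dots> = emeasure \<mu> {\<omega>\<in>F. T \<omega> < \<infinity> \<and> (\<lambda>u\<in>{0..}. v (X (enn2real (T \<omega>) + u) \<omega>)) \<in> B} +
      emeasure \<mu> {\<omega>\<in>F. \<not> T \<omega> < \<infinity> \<and> (\<lambda>u\<in>{0..}. 0) \<in> B}"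
    proof (rule plus_emeasure[symmetric])
      show "{\<omega>\<in>F. T \<omega> < \<infinity> \<and> (\<lambda>u\<in>{0..}. v (X (enn2real (T \<omega>) + u) \<omega>)) \<in> B} \<in> sets \<mu>"
        unfolding 1 by (intro sets.Int F\<mu> fin measurable_sets[OF shift_measurable[OF T v] B])
      show "{\<omega>\<in>F. \<not> T \<omega> < \<infinity> \<and> (\<lambda>u\<in>{0..}. 0) \<in> B} \<in> sets \<mu>"
        unfolding 2 using F\<mu> fin by auto
    qed auto
    finally show ?thesis .
  qed
  interpret D: prob_space "?D w" by (rule prob_space_distr[OF meas[OF w(2)]])
  show ?thesis
  proof (rule measure_eqI_generator_eq[OF Int_stable_pair_measure_generator[of "pre T" path_space], where A="\<lambda>_. space ?N"])
    show "?E \<subseteq> Pow (space ?N)"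
      using sets.space_closed[of "pre T"] sets.space_closed[of path_space] by (auto simp: space_pair_measure)
    show "sets (?D w) = sigma_sets (space ?N) ?E" "sets (?D (\<lambda>y. y)) = sigma_sets (space ?N) ?E"
      by (simp_all add: sets_pair_measure space_pair_measure)
    show "range (\<lambda>_::nat. space ?N) \<subseteq> ?E"
      using sets.top[of "pre T"] sets.top[of "path_space :: (real \<Rightarrow> (real, 'n) vec) measure"]
      unfolding space_pair_measure by blast
    show "emeasure (?D w) (space ?N) \<noteq> \<infinity>" by (rule D.emeasure_finite[unfolded infinity_ennreal_def[symmetric]])
    fix C assume "C \<in> ?E"
    then obtain F B where "C = F \<times> B" "F \<in> sets (pre T)" "B \<in> sets path_space" by blast
    then show "emeasure (?D w) C = emeasure (?D (\<lambda>y. y)) C"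
      using split[OF w(2), of F B] split[of "\<lambda>y. y" F B] strong_markov_reflect[OF T _ _ w fixed, of F B] by simp
  qed auto
qed

text \<open>This recovers the path before \<open>T\<close> from the past alone. For a level
  \<open>v\<close> up to \<open>u\<close> the value on \<open>{T \<le> v}\<close> is 0; for a later
  \<open>v\<close> the variable \<open>X u\<close> is already known at \<open>v\<close>.\<close>

lemma pre_stopped_measurable:
  assumes T: "stopping_time NF T" and u: "0 \<le> u"
  shows "(\<lambda>\<omega>. if T \<omega> \<le> ennreal u then 0 else X u \<omega>) \<in> borel_measurable (pre T)"
proof (rule measurableI)
  interpret filtration "space M" NF by (rule filtration_NF)
  fix B :: "(real, 'n) vec set" assume B: "B \<in> sets borel"
  show "(\<lambda>\<omega>. if T \<omega> \<le> ennreal u then 0 else X u \<omega>) -` B \<inter> space (pre T) \<in> sets (pre T)"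
  proof (rule sets_pre_sigmaI[OF T])
    fix v
    have Tv: "{\<omega>\<in>space M. T \<omega> \<le> v} \<in> sets (NF v)" using stopping_timeD[OF T, of v] by (simp add: pred_def)
    show "{\<omega> \<in> (\<lambda>\<omega>. if T \<omega> \<le> ennreal u then 0 else X u \<omega>) -` B \<inter> space (pre T). T \<omega> \<le> v} \<in> sets (NF v)"
    proof (cases "v \<le> ennreal u")
      case True
      then have "{\<omega> \<in> (\<lambda>\<omega>. if T \<omega> \<le> ennreal u then 0 else X u \<omega>) -` B \<inter> space (pre T). T \<omega> \<le> v} =
        (if 0 \<in> B then {\<omega>\<in>space M. T \<omega> \<le> v} else {})" by auto
      then show ?thesis using Tv by simp
    next
      case False
      then have le: "ennreal u \<le> v" by simp
      have Tu: "{\<omega>\<in>space M. T \<omega> \<le> ennreal u} \<in> sets (NF v)"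
        using stopping_time_le_const[OF T le] by (simp add: pred_def)
      have XB: "X u -` B \<inter> space M \<in> sets (NF v)" using measurable_sets[OF X_adapted[OF u le] B] by simp
      have "{\<omega> \<in> (\<lambda>\<omega>. if T \<omega> \<le> ennreal u then 0 else X u \<omega>) -` B \<inter> space (pre T). T \<omega> \<le> v} =
        (if 0 \<in> B then {\<omega>\<in>space M. T \<omega> \<le> ennreal u} else {}) \<union>
        ((X u -` B \<inter> space M) \<inter> {\<omega>\<in>space M. T \<omega> \<le> v} - {\<omega>\<in>space M. T \<omega> \<le> ennreal u})"
        using le by (auto split: if_splits)
      also have "\<dots> \<in> sets (NF v)" by (intro sets.Un sets.Diff sets.Int XB Tv Tu) (use Tu in auto)
      finally show ?thesis .
    qed
  qed
qed simp

lemma path_functional_measurable: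
  assumes "path_functional \<psi>"
  shows "(\<lambda>\<omega>. \<psi> (path \<omega>)) \<in> borel_measurable \<mu>"
proof -
  obtain h where h: "h \<in> borel_measurable path_space" "\<And>p. continuous_on {0..} p \<Longrightarrow> \<psi> p = h (restrict p {0..})"
    using assms unfolding path_functional_def by blast
  have "(\<lambda>\<omega>. h (\<lambda>u\<in>{0..}. X u \<omega>)) \<in> borel_measurable \<mu>"
    by (rule measurable_compose[OF path_into_path_space h(1)]) simp
  moreover have "AE \<omega> in \<mu>. \<psi> (path \<omega>) = h (\<lambda>u\<in>{0..}. X u \<omega>)"
    using AE_continuous by eventually_elim (use h(2) in \<open>simp add: path_def\<close>)
  ultimately show ?thesis unfolding \<mu>_def by (rule borel_measurable_completion_AE)
qed

lemma path_functional_integrable: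
  assumes \<psi>: "path_functional \<psi>"
  shows "integrable \<mu> (\<lambda>\<omega>. \<psi> (path \<omega>))"
proof -
  obtain K where "\<And>p. \<bar>\<psi> p\<bar> \<le> K" using \<psi> unfolding path_functional_def by blast
  then show ?thesis by (intro integrable_const_bound[of _ K] path_functional_measurable[OF \<psi>]) auto
qed

lemma continuous_reflect_from:
  assumes p: "continuous_on {0..} (path \<omega>)" and w: "continuous_on UNIV w"
    and fixed: "T \<omega> < \<infinity> \<longrightarrow> w (X (enn2real (T \<omega>)) \<omega>) = X (enn2real (T \<omega>)) \<omega>"
  shows "continuous_on {0..} (reflect_from T w \<omega>)"
proof (cases "T \<omega>")
  case (real s)
  have eq: "reflect_from T w \<omega> u = (if u \<le> s then path \<omega> u else w (path \<omega> u))" if "u \<in> {0..}" for u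
    using that real fixed by (auto simp: reflect_from_def path_def ennreal_le_iff)
  have "continuous_on ({0..s} \<union> {s..}) (\<lambda>u. if u \<le> s then path \<omega> u else w (path \<omega> u))"
  proof (rule continuous_on_cases)
    show "continuous_on {0..s} (path \<omega>)" by (rule continuous_on_subset[OF p]) auto
    show "continuous_on {s..} (\<lambda>u. w (path \<omega> u))"
      by (rule continuous_on_compose2[OF w continuous_on_subset[OF p]]) (use real in auto)
    show "\<forall>u. u \<in> {0..s} \<and> \<not> u \<le> s \<or> u \<in> {s..} \<and> u \<le> s \<longrightarrow> path \<omega> u = w (path \<omega> u)"
      using fixed real by (auto simp: path_def)
  qed auto
  moreover have "{0..s} \<union> {s..} = {0..}" using real by auto
  moreover have "continuous_on {0..} (reflect_from T w \<omega>) \<longleftrightarrow>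
      continuous_on {0..} (\<lambda>u. if u \<le> s then path \<omega> u else w (path \<omega> u))"
    by (rule continuous_on_cong) (simp_all add: eq)
  ultimately show ?thesis by simp
next
  case top
  then have "reflect_from T w \<omega> = path \<omega>" by (auto simp: reflect_from_def path_def top_unique)
  with p show ?thesis by simp
qed

text \<open>
  The reflection principle.  The pair of the past up to \<open>T\<close> and the future after \<open>T\<close> has the same
  joint law whether or not the future is reflected, and the path is glued from the two pieces by
  evaluating the future at the random time \<open>u - T\<close>.
\<close>

theorem reflection_principle:
  assumes T: "stopping_time NF T" and w: "w \<in> affine_weyl_group" "continuous_on UNIV w"
    and fixed: "AE \<omega> in \<mu>. T \<omega> < \<infinity> \<longrightarrow> w (X (enn2real (T \<omega>)) \<omega>) = X (enn2real (T \<omega>)) \<omega>"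
    and \<psi>: "path_functional \<psi>" and C: "C \<in> sets (pre T)"
  shows "(\<integral>\<omega>. indicator C \<omega> * \<psi> (path \<omega>) \<partial>\<mu>) = (\<integral>\<omega>. indicator C \<omega> * \<psi> (reflect_from T w \<omega>) \<partial>\<mu>)"
proof -
  let ?N = "pre T \<Otimes>\<^sub>M (path_space :: (real \<Rightarrow> (real, 'n) vec) measure)"
  obtain h where h: "h \<in> borel_measurable path_space" "\<And>p. continuous_on {0..} p \<Longrightarrow> \<psi> p = h (restrict p {0..})"
    using \<psi> unfolding path_functional_def by blast
  have w_meas: "w \<in> borel_measurable borel" using w(2) by (rule borel_measurable_continuous_onI)
  have T_meas: "T \<in> borel_measurable (pre T)"
    by (rule filtration.measurable_stopping_time_pre_sigma[OF filtration_NF T])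
  have fst_meas: "fst \<in> measurable ?N (pre T)" by (rule measurable_fst)
  have "\<exists>g. g \<in> borel_measurable ?N \<and> (\<forall>a. continuous_on {0..} (snd a) \<longrightarrow> 0 \<le> u - enn2real (T (fst a))
      \<longrightarrow> g a = snd a (u - enn2real (T (fst a))))" for u
  proof -
    have "(\<lambda>a. snd a v) \<in> borel_measurable ?N" if "0 \<le> v" for v
      unfolding path_space_def
      by (rule measurable_compose[OF measurable_snd measurable_component_singleton]) (use that in auto)
    moreover have "(\<lambda>a. u - enn2real (T (fst a))) \<in> borel_measurable ?N"
      using measurable_compose[OF fst_meas T_meas] by measurable
    ultimately show ?thesis
      using measurable_eval[of "\<lambda>v a. snd a v" ?N "\<lambda>a. u - enn2real (T (fst a))"] by simp
  qed
  then obtain g where g: "\<And>u. g u \<in> borel_measurable ?N"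
    "\<And>u a. continuous_on {0..} (snd a) \<Longrightarrow> 0 \<le> u - enn2real (T (fst a)) \<Longrightarrow> g u a = snd a (u - enn2real (T (fst a)))"
    by metis
  \<comment> \<open>The inner conditional gives the second branch the form of
    \<open>pre_stopped_measurable\<close>, so that it is measurable for \<open>pre T\<close>;
    \<open>X u\<close> by itself need not be.\<close>
  define glue where "glue a = (\<lambda>u\<in>{0..}. if T (fst a) \<le> ennreal u then g u a
      else (if T (fst a) \<le> ennreal u then 0 else X u (fst a)))" for a
  have "glue \<in> measurable ?N path_space"
    unfolding glue_def[abs_def] path_space_def
  proof (rule measurable_restrict, rule measurable_If)
    fix u :: real assume u: "u \<in> {0..}"
    show "g u \<in> borel_measurable (pre T \<Otimes>\<^sub>M PiM {0..} (\<lambda>_. borel))" using g(1)[of u] by (simp add: path_space_def)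
    show "(\<lambda>a. if T (fst a) \<le> ennreal u then 0 else X u (fst a)) \<in> borel_measurable (pre T \<Otimes>\<^sub>M PiM {0..} (\<lambda>_. borel))"
      using measurable_compose[OF measurable_fst pre_stopped_measurable[OF T]] u by auto
    show "{a \<in> space (pre T \<Otimes>\<^sub>M PiM {0..} (\<lambda>_. borel)). T (fst a) \<le> ennreal u} \<in> sets (pre T \<Otimes>\<^sub>M PiM {0..} (\<lambda>_. borel))"
      using measurable_sets[OF measurable_compose[OF measurable_fst T_meas], of "{..ennreal u}" "PiM {0..} (\<lambda>_. borel)"]
      by (simp add: vimage_def Int_def conj_commute)
  qed
  then have H: "(\<lambda>a. indicator C (fst a) * h (glue a)) \<in> borel_measurable ?N"
    using h(1) C by measurable
  have meas: "(\<lambda>\<omega>. (\<omega>, shifted T v \<omega>)) \<in> measurable \<mu> ?N" if "v \<in> borel_measurable borel" for v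
    by (intro measurable_Pair measurable_pre_\<mu> shifted_measurable T that)
  have glue_eq: "h (glue (\<omega>, shifted T v \<omega>)) = \<psi> (reflect_from T v \<omega>)"
    if "continuous_on {0..} (path \<omega>)" and v: "continuous_on UNIV v"
      "T \<omega> < \<infinity> \<longrightarrow> v (X (enn2real (T \<omega>)) \<omega>) = X (enn2real (T \<omega>)) \<omega>" for \<omega> v
  proof -
    have "glue (\<omega>, shifted T v \<omega>) = restrict (reflect_from T v \<omega>) {0..}"
    proof
      fix u
      show "glue (\<omega>, shifted T v \<omega>) u = restrict (reflect_from T v \<omega>) {0..} u"
      proof (cases "0 \<le> u \<and> T \<omega> \<le> ennreal u")
        case True
        then have fin: "T \<omega> < \<infinity>" by (auto simp: less_top[symmetric] top_unique)
        then obtain s where s: "T \<omega> = ennreal s" "0 \<le> s" by (cases "T \<omega>") auto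
        with True have su: "s \<le> u" by auto
        have "continuous_on {0..} (\<lambda>r. v (path \<omega> (s + r)))"
          by (intro continuous_on_compose2[OF v(1)] continuous_on_compose2[OF that(1)] continuous_intros) (use s in auto)
        moreover have "continuous_on {0..} (shifted T v \<omega>) \<longleftrightarrow> continuous_on {0..} (\<lambda>r. v (path \<omega> (s + r)))"
          by (rule continuous_on_cong) (use s in \<open>simp_all add: shifted_def path_def\<close>)
        ultimately have "continuous_on {0..} (shifted T v \<omega>)" by simp
        then have "g u (\<omega>, shifted T v \<omega>) = shifted T v \<omega> (u - s)"
          using g(2)[of "(\<omega>, shifted T v \<omega>)" u] su s by simp
        then show ?thesis using True fin s su by (simp add: glue_def reflect_from_def shifted_def)
      qed (auto simp: glue_def reflect_from_def)
    qed
    then show ?thesis using h(2)[OF continuous_reflect_from[of \<omega> v T, OF that]] by simp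
  qed
  \<comment> \<open>The unreflected path is the case of the identity map, so the single computation
    \<open>eq\<close> below serves both ends of the final chain.\<close>
  have id_reflect: "reflect_from T (\<lambda>y. y) \<omega> = path \<omega>" for \<omega> by (auto simp: reflect_from_def path_def)
  have eq: "(\<integral>\<omega>. indicator C \<omega> * h (glue (\<omega>, shifted T v \<omega>)) \<partial>\<mu>) = (\<integral>\<omega>. indicator C \<omega> * \<psi> (reflect_from T v \<omega>) \<partial>\<mu>)"
    if v: "continuous_on UNIV v"
      and fv: "AE \<omega> in \<mu>. T \<omega> < \<infinity> \<longrightarrow> v (X (enn2real (T \<omega>)) \<omega>) = X (enn2real (T \<omega>)) \<omega>" for v
  proof (rule integral_cong_AE)
    show ae: "AE \<omega> in \<mu>. indicator C \<omega> * h (glue (\<omega>, shifted T v \<omega>)) = indicator C \<omega> * \<psi> (reflect_from T v \<omega>)"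
      using AE_continuous fv by eventually_elim (use glue_eq[OF _ v] in simp)
    show m: "(\<lambda>\<omega>. indicator C \<omega> * h (glue (\<omega>, shifted T v \<omega>))) \<in> borel_measurable \<mu>"
      using measurable_compose[OF meas[OF borel_measurable_continuous_onI[OF v]] H] by simp
    show "(\<lambda>\<omega>. indicator C \<omega> * \<psi> (reflect_from T v \<omega>)) \<in> borel_measurable \<mu>"
      unfolding \<mu>_def
      by (rule borel_measurable_completion_AE[OF m[unfolded \<mu>_def]], rule eventually_mono[OF ae[unfolded \<mu>_def]], rule sym)
  qed
  have "(\<integral>\<omega>. indicator C \<omega> * \<psi> (path \<omega>) \<partial>\<mu>) = (\<integral>\<omega>. indicator C \<omega> * h (glue (\<omega>, shifted T (\<lambda>y. y) \<omega>)) \<partial>\<mu>)"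
    using eq[of "\<lambda>y. y"] by (simp add: id_reflect)
  also have "\<dots> = (\<integral>a. indicator C (fst a) * h (glue a) \<partial>distr \<mu> ?N (\<lambda>\<omega>. (\<omega>, shifted T (\<lambda>y. y) \<omega>)))"
    using integral_distr[OF meas[of "\<lambda>y. y"] H] by simp
  also have "\<dots> = (\<integral>a. indicator C (fst a) * h (glue a) \<partial>distr \<mu> ?N (\<lambda>\<omega>. (\<omega>, shifted T w \<omega>)))"
    using shifted_joint_law[OF T w(1) w_meas fixed] by simp
  also have "\<dots> = (\<integral>\<omega>. indicator C \<omega> * h (glue (\<omega>, shifted T w \<omega>)) \<partial>\<mu>)"
    using integral_distr[OF meas[OF w_meas] H] by simp
  also have "\<dots> = (\<integral>\<omega>. indicator C \<omega> * \<psi> (reflect_from T w \<omega>) \<partial>\<mu>)" by (rule eq[OF w(2) fixed])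
  finally show ?thesis .
qed

end

section \<open>Hyperplanes and strips\<close>

text \<open>On continuous paths this is the hitting time of the hyperplane; the detour through
  \<open>zero_time\<close> keeps it a stopping time of the natural filtration.\<close>

definition wall_time :: "(real, 'n::{finite,linorder}) vec \<Rightarrow> real \<Rightarrow> (real \<Rightarrow> (real, 'n) vec) \<Rightarrow> ennreal" where
  "wall_time \<beta> m p = zero_time (\<lambda>u. p u \<bullet> \<beta> - m)"

definition hits :: "real \<Rightarrow> (real, 'n::{finite,linorder}) vec \<Rightarrow> real \<Rightarrow> (real \<Rightarrow> (real, 'n) vec) \<Rightarrow> bool" where
  "hits t \<beta> m p \<longleftrightarrow> (\<exists>s\<in>{0..t}. p s \<bullet> \<beta> = m)"

definition exits :: "real \<Rightarrow> (real, 'n::{finite,linorder}) vec \<Rightarrow> real \<Rightarrow> real \<Rightarrow> (real \<Rightarrow> (real, 'n) vec) \<Rightarrow> bool" where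
  "exits t \<beta> m m' p \<longleftrightarrow> (\<exists>s\<in>{0..t}. p s \<bullet> \<beta> = m \<and> (\<forall>r\<in>{0..s}. p r \<bullet> \<beta> \<noteq> m'))"

lemma wall_time_le_iff:
  assumes "continuous_on {0..} p" "0 \<le> u"
  shows "wall_time \<beta> m p \<le> ennreal u \<longleftrightarrow> hits u \<beta> m p"
  unfolding wall_time_def hits_def
  by (subst zero_time_le_iff_zero) (use assms in \<open>auto intro!: continuous_intros\<close>)

lemma wall_time_attained:
  assumes "continuous_on {0..} p" "wall_time \<beta> m p < \<infinity>"
  shows "p (enn2real (wall_time \<beta> m p)) \<bullet> \<beta> = m"
proof -
  obtain s where s: "wall_time \<beta> m p = ennreal s" "0 \<le> s" using assms(2) by (cases "wall_time \<beta> m p") auto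
  have "p s \<bullet> \<beta> - m = 0"
    by (rule zero_time_zero[of "\<lambda>u. p u \<bullet> \<beta> - m"]) (use assms(1) s in \<open>auto intro!: continuous_intros simp: wall_time_def\<close>)
  then show ?thesis using s by simp
qed

lemma exits_iff_wall_time:
  assumes p: "continuous_on {0..} p" and t: "0 \<le> t"
  shows "exits t \<beta> m m' p \<longleftrightarrow> wall_time \<beta> m p \<le> ennreal t \<and> wall_time \<beta> m p < wall_time \<beta> m' p"
proof
  assume "exits t \<beta> m m' p"
  then obtain s where s: "0 \<le> s" "s \<le> t" "p s \<bullet> \<beta> = m" "\<forall>r\<in>{0..s}. p r \<bullet> \<beta> \<noteq> m'"
    unfolding exits_def by auto
  have 1: "wall_time \<beta> m p \<le> ennreal s" using s by (subst wall_time_le_iff[OF p s(1)]) (auto simp: hits_def)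
  moreover have "\<not> wall_time \<beta> m' p \<le> ennreal s" using s by (subst wall_time_le_iff[OF p s(1)]) (auto simp: hits_def)
  ultimately show "wall_time \<beta> m p \<le> ennreal t \<and> wall_time \<beta> m p < wall_time \<beta> m' p"
    using s(2) by (meson ennreal_leI le_less_trans not_le order_trans)
next
  assume a: "wall_time \<beta> m p \<le> ennreal t \<and> wall_time \<beta> m p < wall_time \<beta> m' p"
  then obtain s where s: "wall_time \<beta> m p = ennreal s" "0 \<le> s" by (cases "wall_time \<beta> m p") auto
  have "s \<le> t" using a s t by (simp add: ennreal_le_iff)
  moreover have "p s \<bullet> \<beta> = m" using wall_time_attained[OF p, of \<beta> m] s by simp
  moreover have "\<forall>r\<in>{0..s}. p r \<bullet> \<beta> \<noteq> m'"
    using a s wall_time_le_iff[OF p s(2), of \<beta> m'] by (auto simp: hits_def not_le[symmetric])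
  ultimately show "exits t \<beta> m m' p" unfolding exits_def using s(2) by (intro bexI[of _ s]) auto
qed

text \<open>A filtration that is constant in time reduces measurability on \<open>path_space\<close>
  to the lemma on stopping times.\<close>

lemma wall_time_measurable: "wall_time \<beta> m \<in> borel_measurable (path_space :: (real \<Rightarrow> (real, 'n::{finite,linorder}) vec) measure)"
proof -
  let ?F = "\<lambda>_ :: ennreal. path_space :: (real \<Rightarrow> (real, 'n) vec) measure"
  have F: "filtration (space path_space) ?F" by standard auto
  have "stopping_time ?F (\<lambda>p. zero_time (\<lambda>u. p u \<bullet> \<beta> - m))"
  proof (rule stopping_time_zero_time[OF F])
    fix u :: real assume "0 \<le> u"
    then have "(\<lambda>p. p u) \<in> borel_measurable (?F (ennreal u))"
      unfolding path_space_def by (intro measurable_component_singleton) simp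
    then show "(\<lambda>p. p u \<bullet> \<beta> - m) \<in> borel_measurable (?F (ennreal u))" by measurable
  qed
  then show ?thesis unfolding wall_time_def[abs_def]
    by (rule measurable_stopping_time) auto
qed

lemma continuous_restrict_path:
  assumes "continuous_on {0..} p"
  shows "continuous_on {0..} (restrict p {0..})"
  using assms by (subst continuous_on_cong[of "{0..}" "{0..}" _ p]) auto

lemma hits_restrict [simp]: "hits t \<beta> m (restrict p {0..}) \<longleftrightarrow> hits t \<beta> m p"
  unfolding hits_def by auto

lemma exits_restrict [simp]: "exits t \<beta> m m' (restrict p {0..}) \<longleftrightarrow> exits t \<beta> m m' p"
  unfolding exits_def by auto

lemma path_functional_of_bool:
  assumes "\<And>p. continuous_on {0..} p \<Longrightarrow> Q p \<longleftrightarrow> R (restrict p {0..})" "Measurable.pred path_space R"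
  shows "path_functional (\<lambda>p. of_bool (Q p))"
  unfolding path_functional_def
proof (intro conjI exI[of _ 1] bexI allI impI)
  show "(\<lambda>p. of_bool (R p)) \<in> borel_measurable path_space" using assms(2) by measurable
  show "\<bar>of_bool (Q p)\<bar> \<le> (1 :: real)" for p by simp
qed (simp add: assms(1))

lemma path_functional_hits [intro]:
  assumes "0 \<le> t"
  shows "path_functional (\<lambda>p. of_bool (hits t \<beta> m p))"
proof (rule path_functional_of_bool[where R="\<lambda>p. wall_time \<beta> m p \<le> ennreal t"])
  show "hits t \<beta> m p \<longleftrightarrow> wall_time \<beta> m (restrict p {0..}) \<le> ennreal t" if "continuous_on {0..} p" for p
    using wall_time_le_iff[OF continuous_restrict_path[OF that] assms] by simp
  show "Measurable.pred path_space (\<lambda>p. wall_time \<beta> m p \<le> ennreal t)"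
    using wall_time_measurable[of \<beta> m] by measurable
qed

lemma path_functional_exits [intro]:
  assumes "0 \<le> t"
  shows "path_functional (\<lambda>p. of_bool (exits t \<beta> m m' p))"
proof (rule path_functional_of_bool[where R="\<lambda>p. wall_time \<beta> m p \<le> ennreal t \<and> wall_time \<beta> m p < wall_time \<beta> m' p"])
  let ?Q = "\<lambda>p. wall_time \<beta> m p \<le> ennreal t \<and> wall_time \<beta> m p < wall_time \<beta> m' p"
  show "exits t \<beta> m m' p \<longleftrightarrow> ?Q (restrict p {0..})" if "continuous_on {0..} p" for p
    using exits_iff_wall_time[OF continuous_restrict_path[OF that] assms] by simp
  show "Measurable.pred path_space ?Q"
    using wall_time_measurable[of \<beta> m] wall_time_measurable[of \<beta> m'] by measurable
qed

lemma path_functional_not_hits [intro]: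
  "0 \<le> t \<Longrightarrow> path_functional (\<lambda>p. of_bool (\<not> hits t \<beta> m p))"
  unfolding of_bool_not_iff by (intro path_functional_diff path_functional_const path_functional_hits)

lemma stays_in_strip:
  fixes f :: "real \<Rightarrow> real"
  assumes f: "continuous_on {0..} f" and f0: "0 < f 0" "f 0 < 1" and s: "0 \<le> s"
    and no: "\<And>r. 0 \<le> r \<Longrightarrow> r \<le> s \<Longrightarrow> f r \<noteq> 0 \<and> f r \<noteq> 1"
  shows "0 < f s \<and> f s < 1"
proof (rule ccontr)
  assume "\<not> ?thesis"
  then consider "f s \<le> 0" | "1 \<le> f s" by linarith
  then show False
  proof cases
    case 1
    then obtain r where "0 \<le> r" "r \<le> s" "f r = 0"
      using IVT2'[of f s 0 0] f0 s continuous_on_subset[OF f, of "{0..s}"] by auto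
    with no show False by auto
  next
    case 2
    then obtain r where "0 \<le> r" "r \<le> s" "f r = 1"
      using IVT'[of f 0 1 s] f0 s continuous_on_subset[OF f, of "{0..s}"] by auto
    with no show False by auto
  qed
qed

section \<open>Affine reflections and the levels of one root\<close>

definition reflect_at :: "(real, 'n::{finite,linorder}) vec \<Rightarrow> real \<Rightarrow> (real, 'n) vec \<Rightarrow> (real, 'n) vec" where
  "reflect_at \<beta> m y = y - (y \<bullet> \<beta> - m) *\<^sub>R \<beta>"

definition roots :: "(real, 'n::{finite,linorder}) vec set" where
  "roots = {basis_vec i - basis_vec j | i j. i \<noteq> j}"

lemma roots_norm: "\<beta> \<in> roots \<Longrightarrow> \<beta> \<bullet> \<beta> = 2"
  by (auto simp: roots_def inner_diff_left inner_diff_right inner_axis_axis)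

lemma inner_basis_vec [simp]: "y \<bullet> basis_vec i = y $ i" "basis_vec i \<bullet> y = y $ i"
  by (simp_all add: inner_axis inner_axis')

lemma continuous_reflect_at: "continuous_on UNIV (reflect_at \<beta> m)"
  unfolding reflect_at_def[abs_def] by (intro continuous_intros)

lemma reflect_at_fixed: "y \<bullet> \<beta> = m \<Longrightarrow> reflect_at \<beta> m y = y"
  by (simp add: reflect_at_def)

text \<open>Roots have squared length 2, so the reflection formula carries no scalar factor and
  \<open>reflect_at \<beta> 0\<close> exchanges two coordinates. What remains is the translation by
  m times \<beta>, a lattice vector because m is an integer.\<close>

lemma reflect_at_affine:
  assumes "\<beta> \<in> roots" "m \<in> \<int>"
  shows "reflect_at \<beta> m \<in> affine_weyl_group"
proof -
  obtain i j where ij: "\<beta> = basis_vec i - basis_vec j" "i \<noteq> j" using assms(1) by (auto simp: roots_def)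
  have "linear (reflect_at \<beta> 0)"
    unfolding reflect_at_def[abs_def] by (rule linearI) (simp_all add: inner_add_left algebra_simps)
  moreover have "reflect_at \<beta> 0 (basis_vec l) = basis_vec (Transposition.transpose i j l)" for l
  proof -
    have "basis_vec l \<bullet> \<beta> = (if l = i then 1 else 0) - (if l = j then 1 else 0)"
      unfolding ij(1) inner_diff_right inner_basis_vec by (simp add: axis_def)
    then show ?thesis
      using ij(2) by (cases "l = i"; cases "l = j") (simp_all add: reflect_at_def ij(1) Transposition.transpose_def)
  qed
  moreover have "Transposition.transpose i j permutes UNIV" by (rule permutes_swap_id) auto
  ultimately have w: "reflect_at \<beta> 0 \<in> weyl_group" unfolding weyl_group_def by blast
  have "(\<Sum>l\<in>UNIV. m * (basis_vec i $ l - basis_vec j $ l)) = 0"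
    by (simp add: sum_distrib_left[symmetric] sum_subtractf axis_def)
  then have "m *\<^sub>R \<beta> \<in> transl_lattice"
    unfolding transl_lattice_def using assms(2) by (auto simp: ij axis_def)
  then have "(\<lambda>y. y + m *\<^sub>R \<beta>) \<circ> reflect_at \<beta> 0 \<in> affine_weyl_group"
    by (intro affine_weyl_group.comp affine_weyl_group.transl affine_weyl_group.weyl w)
  also have "(\<lambda>y. y + m *\<^sub>R \<beta>) \<circ> reflect_at \<beta> 0 = reflect_at \<beta> m"
    by (auto simp: reflect_at_def algebra_simps)
  finally show ?thesis .
qed

lemma reflect_at_inner: "\<beta> \<in> roots \<Longrightarrow> reflect_at \<beta> m y \<bullet> \<beta> = 2 * m - y \<bullet> \<beta>"
  using roots_norm[of \<beta>] by (simp add: reflect_at_def inner_diff_left)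

lemma reflect_at_orthogonal: "\<gamma> \<bullet> \<beta> = 0 \<Longrightarrow> reflect_at \<beta> m y \<bullet> \<gamma> = y \<bullet> \<gamma>"
  by (simp add: reflect_at_def inner_diff_left inner_commute[of \<beta> \<gamma>])

text \<open>The factor that a root whose inner product with v is m contributes to
  \<open>E_sign\<close>.\<close>

definition half_sign :: "int \<Rightarrow> real" where "half_sign m = (if m > 0 then -1 else 1)"

text \<open>The share of one root in the lattice sum: expanding the product of these sums over the
  roots of an orthogonal set gives the sum over all lattice vectors of norm at most
  \<open>N\<close>.\<close>

definition trunc_factor :: "nat \<Rightarrow> real \<Rightarrow> (real, 'n::{finite,linorder}) vec \<Rightarrow> (real \<Rightarrow> (real, 'n) vec) \<Rightarrow> real" where
  "trunc_factor N t \<beta> p = (\<Sum>m\<in>{- int N..int N}. half_sign m * of_bool (\<not> hits t \<beta> (of_int m) p))"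

text \<open>
  Reflection at level \<open>1\<close> pairs the levels \<open>m\<close> and \<open>2 - m\<close>, whose half signs are opposite unless
  \<open>m = 1\<close>.  The four levels below are those in exactly one of \<open>{-N..N}\<close> and \<open>{2-N..N+2}\<close>.
\<close>

definition boundary_hits :: "nat \<Rightarrow> real \<Rightarrow> (real, 'n::{finite,linorder}) vec \<Rightarrow> (real \<Rightarrow> (real, 'n) vec) \<Rightarrow> real" where
  "boundary_hits N t \<beta> p = (\<Sum>m\<in>{- int N, 1 - int N, int N + 1, int N + 2}. of_bool (\<not> hits t \<beta> (of_int m) p))"

text \<open>What is left of \<open>trunc_factor\<close> after reflection at the exit from the strip:
  1 without an exit, 0 after an exit at level 0, half of the boundary levels after an exit at level
  1.\<close>

definition folded_factor :: "nat \<Rightarrow> real \<Rightarrow> (real, 'n::{finite,linorder}) vec \<Rightarrow> (real \<Rightarrow> (real, 'n) vec) \<Rightarrow> real" where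
  "folded_factor N t \<beta> p = of_bool (\<not> hits t \<beta> 0 p) * of_bool (\<not> hits t \<beta> 1 p) +
    of_bool (exits t \<beta> 1 0 p) * (boundary_hits N t \<beta> p * (1 / 2))"

text \<open>The \<eta> of the overview.\<close>

definition exit_sign :: "real \<Rightarrow> (real, 'n::{finite,linorder}) vec \<Rightarrow> (real \<Rightarrow> (real, 'n) vec) \<Rightarrow> real" where
  "exit_sign t \<beta> p = of_bool (exits t \<beta> 1 0 p) - of_bool (exits t \<beta> 0 1 p)"

lemma path_functional_trunc_factor [intro]: "0 \<le> t \<Longrightarrow> path_functional (trunc_factor N t \<beta>)"
  unfolding trunc_factor_def[abs_def] by (intro path_functional_sum path_functional_times path_functional_const path_functional_not_hits)

lemma path_functional_boundary_hits [intro]: "0 \<le> t \<Longrightarrow> path_functional (boundary_hits N t \<beta>)"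
  unfolding boundary_hits_def[abs_def] by (intro path_functional_sum path_functional_not_hits)

lemma path_functional_folded_factor [intro]: "0 \<le> t \<Longrightarrow> path_functional (folded_factor N t \<beta>)"
  unfolding folded_factor_def[abs_def]
  by (intro path_functional_times path_functional_add path_functional_const path_functional_not_hits
      path_functional_exits path_functional_boundary_hits)

lemma path_functional_exit_sign [intro]: "0 \<le> t \<Longrightarrow> path_functional (exit_sign t \<beta>)"
  unfolding exit_sign_def[abs_def] by (intro path_functional_diff path_functional_exits)

lemma boundary_hits_bounds: "0 \<le> boundary_hits N t \<beta> p" "boundary_hits N t \<beta> p \<le> 4"
proof -
  show "0 \<le> boundary_hits N t \<beta> p" unfolding boundary_hits_def by (intro sum_nonneg) auto
  show "boundary_hits N t \<beta> p \<le> 4" unfolding boundary_hits_def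
    by (rule order_trans[OF sum_bounded_above[where K=1]]) (auto simp: card_insert_if)
qed

text \<open>The bound is 1 + 4/2. Being independent of \<open>N\<close>, it supplies the majorant
  for dominated convergence.\<close>

lemma abs_folded_factor_le: "\<bar>folded_factor N t \<beta> p\<bar> \<le> 3"
  using boundary_hits_bounds[of N t \<beta> p] unfolding folded_factor_def by (auto simp: of_bool_def)

lemma hits_cong: "(\<And>u. 0 \<le> u \<Longrightarrow> p u \<bullet> \<beta> = q u \<bullet> \<beta>) \<Longrightarrow> hits t \<beta> m p = hits t \<beta> m q"
  by (auto simp: hits_def)

lemma exits_cong:
  assumes "\<And>u. 0 \<le> u \<Longrightarrow> p u \<bullet> \<beta> = q u \<bullet> \<beta>"
  shows "exits t \<beta> m m' p = exits t \<beta> m m' q"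
  unfolding exits_def using assms by (intro bex_cong refl) auto

lemma trunc_factor_cong: "(\<And>u. 0 \<le> u \<Longrightarrow> p u \<bullet> \<beta> = q u \<bullet> \<beta>) \<Longrightarrow> trunc_factor N t \<beta> p = trunc_factor N t \<beta> q"
  using hits_cong[of p \<beta> q t] by (simp add: trunc_factor_def)

lemma folded_factor_cong: "(\<And>u. 0 \<le> u \<Longrightarrow> p u \<bullet> \<beta> = q u \<bullet> \<beta>) \<Longrightarrow> folded_factor N t \<beta> p = folded_factor N t \<beta> q"
  using hits_cong[of p \<beta> q t] exits_cong[of p \<beta> q t] by (simp add: folded_factor_def boundary_hits_def)

lemma strip_trichotomy:
  assumes p: "continuous_on {0..} p" and t: "0 \<le> t"
  shows "of_bool (\<not> hits t \<beta> 0 p) * of_bool (\<not> hits t \<beta> 1 p) + of_bool (exits t \<beta> 0 1 p) + of_bool (exits t \<beta> 1 0 p) = (1::real)"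
proof -
  \<comment> \<open>At a common finite hitting time the path would lie on the levels 0 and 1 at
    once, so ties cannot occur.\<close>
  have neq: "wall_time \<beta> 0 p \<noteq> wall_time \<beta> 1 p" if "wall_time \<beta> 0 p < \<infinity>"
    using wall_time_attained[OF p, of \<beta> 0] wall_time_attained[OF p, of \<beta> 1] that by auto
  have fin: "wall_time \<beta> 0 p < \<infinity>" if "wall_time \<beta> 0 p \<le> ennreal t"
    using le_less_trans[OF that, of \<infinity>] by simp
  show ?thesis
    unfolding exits_iff_wall_time[OF assms] wall_time_le_iff[OF assms, symmetric]
    using neq fin by (auto simp: of_bool_def not_le not_less dest: order_trans le_less_trans less_le_trans)
qed

lemma sum_half_sign: "(\<Sum>m\<in>{- int N..int N}. half_sign m) = 1"
proof (induction N)
  case (Suc N)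
  have "{- int (Suc N)..int (Suc N)} = insert (- int (Suc N)) (insert (int (Suc N)) {- int N..int N})" by auto
  then show ?case using Suc by (simp add: half_sign_def)
qed (simp add: half_sign_def)

section \<open>The sum over the lattice for a fixed orthogonal set\<close>

text \<open>\<open>half_sign\<close> is odd away from 0, and the exceptional level drops out because
  \<open>h\<close> vanishes there: in the application it has been hit.\<close>

lemma sum_half_sign_reflect_0:
  assumes "h 0 = (0::real)"
  shows "(\<Sum>m\<in>{- int N..int N}. half_sign m * h (- m)) = - (\<Sum>m\<in>{- int N..int N}. half_sign m * h m)"
proof -
  have "(\<Sum>m\<in>{- int N..int N}. half_sign m * h (- m)) = (\<Sum>m\<in>{- int N..int N}. half_sign (- m) * h m)"
    by (rule sum.reindex_bij_witness[of _ uminus uminus]) auto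
  also have "\<dots> = (\<Sum>m\<in>{- int N..int N}. - (half_sign m * h m))"
    using assms by (intro sum.cong) (auto simp: half_sign_def)
  finally show ?thesis by (simp add: sum_negf)
qed

text \<open>The surviving boundary levels all carry the coefficient 1: the lower two because they
  are not positive, the upper two because the reflection reverses their negative half sign.\<close>

lemma sum_half_sign_reflect_1:
  assumes "h 1 = (0::real)" "1 \<le> N"
  shows "(\<Sum>m\<in>{- int N..int N}. half_sign m * h (2 - m)) =
    (\<Sum>m\<in>{- int N, 1 - int N, int N + 1, int N + 2}. h m) - (\<Sum>m\<in>{- int N..int N}. half_sign m * h m)"
proof -
  have "(\<Sum>m\<in>{- int N..int N}. half_sign m * h (2 - m)) = (\<Sum>m\<in>{2 - int N..int N + 2}. half_sign (2 - m) * h m)"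
    by (rule sum.reindex_bij_witness[of _ "\<lambda>m. 2 - m" "\<lambda>m. 2 - m"]) auto
  also have "\<dots> = (\<Sum>m\<in>{2 - int N..int N + 2}. - (half_sign m * h m))"
  proof (rule sum.cong)
    show "half_sign (2 - m) * h m = - (half_sign m * h m)" for m
      using assms(1) by (cases "m = 1") (auto simp: half_sign_def)
  qed simp
  also have "{2 - int N..int N + 2} = insert (int N + 1) (insert (int N + 2) {2 - int N..int N})" using assms(2) by auto
  finally have 1: "(\<Sum>m\<in>{- int N..int N}. half_sign m * h (2 - m)) =
      h (int N + 1) + h (int N + 2) - (\<Sum>m\<in>{2 - int N..int N}. half_sign m * h m)"
    by (simp add: sum_negf half_sign_def)
  have "{- int N..int N} = insert (- int N) (insert (1 - int N) {2 - int N..int N})" using assms(2) by auto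
  then have "(\<Sum>m\<in>{- int N..int N}. half_sign m * h m) =
      h (- int N) + h (1 - int N) + (\<Sum>m\<in>{2 - int N..int N}. half_sign m * h m)"
    using assms(2) by (simp add: half_sign_def)
  with 1 assms(2) show ?thesis by simp
qed

context reflectable_process
begin

definition good :: "'w \<Rightarrow> bool" where "good \<omega> \<longleftrightarrow> continuous_on {0..} (path \<omega>) \<and> path \<omega> 0 = x \<and> \<omega> \<in> space M"

lemma AE_good: "AE \<omega> in \<mu>. good \<omega>"
  using AE_continuous AE_start AE_space by eventually_elim (auto simp: good_def path_def)

lemma integral_cong_good:
  fixes f g :: "'w \<Rightarrow> real"
  assumes g: "g \<in> borel_measurable \<mu>" and eq: "\<And>\<omega>. good \<omega> \<Longrightarrow> f \<omega> = g \<omega>"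
  shows "(\<integral>\<omega>. f \<omega> \<partial>\<mu>) = (\<integral>\<omega>. g \<omega> \<partial>\<mu>)"
proof -
  have ae: "AE \<omega> in \<mu>. f \<omega> = g \<omega>" using AE_good by eventually_elim (rule eq)
  moreover have "f \<in> borel_measurable \<mu>"
    using borel_measurable_completion_AE[OF g[unfolded \<mu>_def] ae[unfolded \<mu>_def]] by (simp add: \<mu>_def)
  ultimately show ?thesis using g by (intro integral_cong_AE)
qed

text \<open>Strict comparison with \<open>S\<close> and weak comparison with \<open>R\<close> allow
  ties to be broken by a ranking. The value \<open>\<infinity>\<close> discards the paths on which a
  comparison is lost.\<close>

definition first_at :: "(real, 'n) vec \<times> real \<Rightarrow> ((real, 'n) vec \<times> real) set \<Rightarrow> ((real, 'n) vec \<times> real) set \<Rightarrow> 'w \<Rightarrow> ennreal" where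
  "first_at h S R \<omega> = (if (\<forall>g\<in>S. case_prod wall_time h (path \<omega>) < case_prod wall_time g (path \<omega>)) \<and>
      (\<forall>g\<in>R. case_prod wall_time h (path \<omega>) \<le> case_prod wall_time g (path \<omega>))
    then case_prod wall_time h (path \<omega>) else \<infinity>)"

lemma stopping_time_wall_time: "stopping_time NF (\<lambda>\<omega>. case_prod wall_time h (path \<omega>))"
proof -
  have "(\<lambda>\<omega>. X u \<omega> \<bullet> fst h - snd h) \<in> borel_measurable (NF (ennreal u))" if "0 \<le> u" for u
    using X_adapted[OF that order_refl] by measurable
  from stopping_time_zero_time[OF filtration_NF this] show ?thesis
    by (simp add: wall_time_def path_def case_prod_beta)
qed

lemma stopping_time_first_at:
  assumes "finite S" "finite R"
  shows "stopping_time NF (first_at h S R)"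
proof -
  interpret filtration "space M" NF by (rule filtration_NF)
  let ?T = "\<lambda>h \<omega>. case_prod wall_time h (path \<omega>)"
  have "{\<omega>\<in>space (pre (?T h)). ?T h \<omega> < ?T g \<omega>} \<in> sets (pre (?T h))" for g
    using stopping_time_less[OF stopping_time_wall_time[of h] stopping_time_wall_time[of g]] by (simp add: pred_def)
  moreover have "{\<omega>\<in>space (pre (?T h)). ?T h \<omega> \<le> ?T g \<omega>} \<in> sets (pre (?T h))" for g
    using pre_sigma_le[OF stopping_time_wall_time[of h] stopping_time_wall_time[of g]] by simp
  ultimately have "{\<omega>\<in>space (pre (?T h)). (\<forall>g\<in>S. ?T h \<omega> < ?T g \<omega>) \<and> (\<forall>g\<in>R. ?T h \<omega> \<le> ?T g \<omega>)} \<in> sets (pre (?T h))"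
    using assms by (intro sets.sets_Collect_conj sets.sets_Collect_finite_All)
  from stopping_time_restrict[OF filtration_NF stopping_time_wall_time this]
  show ?thesis
    by (rule iffD1[OF stopping_time_cong, rotated]) (auto simp: first_at_def)
qed

lemma first_at_attained:
  assumes "good \<omega>" "first_at (\<beta>, m) S R \<omega> < \<infinity>"
  shows "X (enn2real (first_at (\<beta>, m) S R \<omega>)) \<omega> \<bullet> \<beta> = m"
  using assms wall_time_attained[of "path \<omega>" \<beta> m] by (auto simp: first_at_def good_def path_def split: if_splits)

lemma integrable_stopped:
  assumes T: "stopping_time NF T" and \<psi>: "path_functional \<psi>"
  shows "integrable \<mu> (\<lambda>\<omega>. of_bool (T \<omega> \<le> t) * \<psi> (path \<omega>))"
proof -
  have "T \<in> borel_measurable \<mu>" by (rule measurable_M_\<mu>[OF stopping_time_meas[OF T]])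
  then have "{\<omega>\<in>space \<mu>. T \<omega> \<le> t} \<in> sets \<mu>" by measurable
  from integrable_mult_indicator[OF this path_functional_integrable[OF \<psi>]]
  show ?thesis by (rule Bochner_Integration.integrable_cong[THEN iffD1, rotated -1]) (auto simp: indicator_def)
qed

lemma wall_reflection:
  assumes fin: "finite S" "finite R" and \<beta>: "\<beta> \<in> roots" "m \<in> \<int>" and \<psi>: "path_functional \<psi>"
  defines "T \<equiv> first_at (\<beta>, m) S R"
  shows "(\<integral>\<omega>. of_bool (T \<omega> \<le> t) * \<psi> (path \<omega>) \<partial>\<mu>) =
    (\<integral>\<omega>. of_bool (T \<omega> \<le> t) * \<psi> (reflect_from T (reflect_at \<beta> m) \<omega>) \<partial>\<mu>)"
proof -
  have T: "stopping_time NF T" unfolding T_def by (rule stopping_time_first_at[OF fin])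
  have C: "{\<omega>\<in>space M. T \<omega> \<le> t} \<in> sets (pre T)"
    using measurable_sets[OF filtration.measurable_stopping_time_pre_sigma[OF filtration_NF T], of "{..t}"]
    by (simp add: vimage_def Int_def conj_commute)
  have fixed: "AE \<omega> in \<mu>. T \<omega> < \<infinity> \<longrightarrow> reflect_at \<beta> m (X (enn2real (T \<omega>)) \<omega>) = X (enn2real (T \<omega>)) \<omega>"
    using AE_good by eventually_elim (auto simp: T_def intro!: reflect_at_fixed first_at_attained)
  have "(\<integral>\<omega>. of_bool (T \<omega> \<le> t) * \<phi> \<omega> \<partial>\<mu>) = (\<integral>\<omega>. indicator {\<omega>\<in>space M. T \<omega> \<le> t} \<omega> * \<phi> \<omega> \<partial>\<mu>)" for \<phi> :: "'w \<Rightarrow> real"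
    by (rule Bochner_Integration.integral_cong) (auto simp: indicator_def)
  then show ?thesis
    using reflection_principle[OF T reflect_at_affine[OF \<beta>] continuous_reflect_at fixed \<psi> C] by simp
qed

lemma reflect_from_first_at:
  assumes \<omega>: "good \<omega>" and T: "T \<omega> = ennreal s" "0 \<le> s" and u: "0 \<le> u"
  shows "reflect_from T w \<omega> u = (if s \<le> u then w (path \<omega> u) else path \<omega> u)"
  using T u by (auto simp: reflect_from_def path_def ennreal_le_iff)

text \<open>Before the exit the path lies strictly between 0 and 1 and meets no integer level. Hence
  reflecting only from the exit onwards permutes the integer levels exactly as reflecting the whole
  path would.\<close>

lemma strip_reflected_hits:
  assumes \<omega>: "good \<omega>" and \<beta>: "\<beta> \<in> roots" "0 < x \<bullet> \<beta>" "x \<bullet> \<beta> < 1" and m1: "m1 \<in> {0, 1}" and t: "0 \<le> t"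
    and le: "first_at (\<beta>, of_int m1) {(\<beta>, of_int (1 - m1))} {} \<omega> \<le> ennreal t" (is "?T \<omega> \<le> _")
  shows "hits t \<beta> (of_int m) (reflect_from ?T (reflect_at \<beta> (of_int m1)) \<omega>) \<longleftrightarrow> hits t \<beta> (of_int (2 * m1 - m)) (path \<omega>)"
    and "hits t \<beta> (of_int m1) (path \<omega>)"
proof -
  have p: "continuous_on {0..} (path \<omega>)" using \<omega> by (simp add: good_def)
  have fin: "?T \<omega> < \<infinity>" using le_less_trans[OF le, of \<infinity>] by simp
  have wt: "wall_time \<beta> (of_int m1) (path \<omega>) < wall_time \<beta> (of_int (1 - m1)) (path \<omega>)"
    and T_eq: "?T \<omega> = wall_time \<beta> (of_int m1) (path \<omega>)"
    using fin by (auto simp: first_at_def split: if_splits)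
  obtain s where s: "?T \<omega> = ennreal s" "0 \<le> s" using fin by (cases "?T \<omega>") auto
  show "hits t \<beta> (of_int m1) (path \<omega>)"
    using le unfolding T_eq wall_time_le_iff[OF p t] by simp
  have inside: "0 < path \<omega> u \<bullet> \<beta> \<and> path \<omega> u \<bullet> \<beta> < 1" if u: "0 \<le> u" "u < s" for u
  proof (rule stays_in_strip[of "\<lambda>u. path \<omega> u \<bullet> \<beta>"])
    show "continuous_on {0..} (\<lambda>u. path \<omega> u \<bullet> \<beta>)" using p by (intro continuous_intros)
    show "0 < path \<omega> 0 \<bullet> \<beta>" "path \<omega> 0 \<bullet> \<beta> < 1" using \<beta> \<omega> by (auto simp: good_def)
    show "0 \<le> u" by fact
    fix r assume r: "0 \<le> r" "r \<le> u"
    have "ennreal u < ennreal s" using u by (simp add: ennreal_less_iff)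
    then have "ennreal u < wall_time \<beta> (of_int m1) (path \<omega>)" using s(1) T_eq by simp
    then have "\<not> wall_time \<beta> (of_int m1) (path \<omega>) \<le> ennreal u" "\<not> wall_time \<beta> (of_int (1 - m1)) (path \<omega>) \<le> ennreal u"
      using less_trans[OF _ wt] by (simp_all only: not_le)
    then have "\<not> hits u \<beta> (of_int m1) (path \<omega>)" "\<not> hits u \<beta> (of_int (1 - m1)) (path \<omega>)"
      unfolding wall_time_le_iff[OF p u(1)] .
    then show "path \<omega> r \<bullet> \<beta> \<noteq> 0 \<and> path \<omega> r \<bullet> \<beta> \<noteq> 1" using r m1 by (auto simp: hits_def)
  qed
  have "reflect_from ?T (reflect_at \<beta> (of_int m1)) \<omega> u \<bullet> \<beta> = of_int m \<longleftrightarrow> path \<omega> u \<bullet> \<beta> = of_int (2 * m1 - m)"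
    if u: "u \<in> {0..t}" for u
  proof (cases "s \<le> u")
    case True
    then show ?thesis using reflect_from_first_at[of \<omega> ?T s u, OF \<omega> s] u reflect_at_inner[OF \<beta>(1)] by auto
  next
    case False
    then have i: "0 < path \<omega> u \<bullet> \<beta>" "path \<omega> u \<bullet> \<beta> < 1" using inside[of u] u by auto
    then have no: "path \<omega> u \<bullet> \<beta> \<noteq> of_int l" for l :: int by auto
    show ?thesis using reflect_from_first_at[of \<omega> ?T s u, OF \<omega> s] u False no[of m] no[of "2 * m1 - m"] by simp
  qed
  then show "hits t \<beta> (of_int m) (reflect_from ?T (reflect_at \<beta> (of_int m1)) \<omega>) \<longleftrightarrow> hits t \<beta> (of_int (2 * m1 - m)) (path \<omega>)"
    unfolding hits_def by (intro bex_cong refl)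
qed

lemma first_at_strip_le_iff:
  assumes "good \<omega>" "0 \<le> t"
  shows "first_at (\<beta>, m) {(\<beta>, m')} {} \<omega> \<le> ennreal t \<longleftrightarrow> exits t \<beta> m m' (path \<omega>)"
  using exits_iff_wall_time[of "path \<omega>" t \<beta> m m'] assms by (auto simp: first_at_def good_def top_unique)

lemma no_exit_no_hits:
  assumes \<omega>: "good \<omega>" and \<beta>: "0 < x \<bullet> \<beta>" "x \<bullet> \<beta> < 1"
    and no: "\<not> hits t \<beta> 0 (path \<omega>)" "\<not> hits t \<beta> 1 (path \<omega>)"
  shows "\<not> hits t \<beta> (of_int m) (path \<omega>)"
proof
  assume "hits t \<beta> (of_int m) (path \<omega>)"
  then obtain s where s: "0 \<le> s" "s \<le> t" "path \<omega> s \<bullet> \<beta> = of_int m" by (auto simp: hits_def)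
  have "0 < path \<omega> s \<bullet> \<beta> \<and> path \<omega> s \<bullet> \<beta> < 1"
  proof (rule stays_in_strip[of "\<lambda>u. path \<omega> u \<bullet> \<beta>"])
    show "continuous_on {0..} (\<lambda>u. path \<omega> u \<bullet> \<beta>)" using \<omega> by (intro continuous_intros) (simp add: good_def)
    show "0 < path \<omega> 0 \<bullet> \<beta>" "path \<omega> 0 \<bullet> \<beta> < 1" using \<beta> \<omega> by (auto simp: good_def)
    show "0 \<le> s" by fact
    show "path \<omega> r \<bullet> \<beta> \<noteq> 0 \<and> path \<omega> r \<bullet> \<beta> \<noteq> 1" if "0 \<le> r" "r \<le> s" for r
      using no that s(2) by (auto simp: hits_def)
  qed
  with s(3) show False by auto
qed

text \<open>Such a functional has the same value on a path and on its reflection along \<beta>,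
  whenever the reflection starts. This lets the factors of the other roots pass through
  unchanged.\<close>

definition orthogonal_invariant :: "(real, 'n) vec \<Rightarrow> ((real \<Rightarrow> (real, 'n) vec) \<Rightarrow> real) \<Rightarrow> bool" where
  "orthogonal_invariant \<beta> G \<longleftrightarrow> (\<forall>p q. (\<forall>u\<ge>0. \<forall>\<gamma>. \<gamma> \<bullet> \<beta> = 0 \<longrightarrow> p u \<bullet> \<gamma> = q u \<bullet> \<gamma>) \<longrightarrow> G p = G q)"

text \<open>Reflection turns the integral I on the left into \<open>m1\<close> R - I, where R is the
  integral with the boundary levels. Solving for I produces the factor 1/2; for
  \<open>m1 = 0\<close> the contribution vanishes.\<close>

lemma strip_exit_trunc_factor:
  assumes \<beta>: "\<beta> \<in> roots" "0 < x \<bullet> \<beta>" "x \<bullet> \<beta> < 1" and m1: "m1 \<in> {0, 1}" and t: "0 \<le> t" and N: "1 \<le> N"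
    and G: "path_functional G" "orthogonal_invariant \<beta> G"
  defines "T \<equiv> first_at (\<beta>, of_int m1) {(\<beta>, of_int (1 - m1))} {}"
  shows "(\<integral>\<omega>. of_bool (T \<omega> \<le> ennreal t) * (G (path \<omega>) * trunc_factor N t \<beta> (path \<omega>)) \<partial>\<mu>) =
    (\<integral>\<omega>. of_bool (T \<omega> \<le> ennreal t) * (G (path \<omega>) * (of_int m1 * boundary_hits N t \<beta> (path \<omega>) * (1 / 2))) \<partial>\<mu>)"
proof -
  let ?tf = "trunc_factor N t \<beta>" and ?R = "boundary_hits N t \<beta>"
  have Tst: "stopping_time NF T" unfolding T_def by (rule stopping_time_first_at) auto
  have int_tf: "integrable \<mu> (\<lambda>\<omega>. of_bool (T \<omega> \<le> ennreal t) * (G (path \<omega>) * ?tf (path \<omega>)))"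
    using t by (intro integrable_stopped[OF Tst] path_functional_times G path_functional_trunc_factor)
  have int_R: "integrable \<mu> (\<lambda>\<omega>. of_bool (T \<omega> \<le> ennreal t) * (G (path \<omega>) * (of_int m1 * ?R (path \<omega>))))"
    using t by (intro integrable_stopped[OF Tst] path_functional_times G path_functional_const path_functional_boundary_hits)
  have reflected: "G (reflect_from T (reflect_at \<beta> (of_int m1)) \<omega>) * ?tf (reflect_from T (reflect_at \<beta> (of_int m1)) \<omega>) =
      G (path \<omega>) * (of_int m1 * ?R (path \<omega>)) - G (path \<omega>) * ?tf (path \<omega>)"
    if \<omega>: "good \<omega>" and le: "T \<omega> \<le> ennreal t" for \<omega>
  proof -
    let ?Y = "reflect_from T (reflect_at \<beta> (of_int m1)) \<omega>"
    note h = strip_reflected_hits[OF \<omega> \<beta> m1 t le[unfolded T_def], folded T_def]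
    have "?Y u \<bullet> \<gamma> = path \<omega> u \<bullet> \<gamma>" if "\<gamma> \<bullet> \<beta> = 0" for u \<gamma>
      using reflect_at_orthogonal[OF that] by (auto simp: reflect_from_def path_def)
    then have "G ?Y = G (path \<omega>)" using G(2) unfolding orthogonal_invariant_def by blast
    moreover have "?tf ?Y = of_int m1 * ?R (path \<omega>) - ?tf (path \<omega>)"
    proof -
      have "?tf ?Y = (\<Sum>m\<in>{- int N..int N}. half_sign m * of_bool (\<not> hits t \<beta> (of_int (2 * m1 - m)) (path \<omega>)))"
        unfolding trunc_factor_def using h(1) by (intro sum.cong) auto
      moreover have "m1 = 0 \<or> m1 = 1" using m1 by auto
      ultimately show ?thesis
        using sum_half_sign_reflect_0[of "\<lambda>m. of_bool (\<not> hits t \<beta> (of_int m) (path \<omega>))" N] h(2) N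
          sum_half_sign_reflect_1[of "\<lambda>m. of_bool (\<not> hits t \<beta> (of_int m) (path \<omega>))" N]
        by (elim disjE) (simp_all add: trunc_factor_def boundary_hits_def del: of_bool_not_iff)
    qed
    ultimately show ?thesis by (simp only: right_diff_distrib)
  qed
  have "(\<integral>\<omega>. of_bool (T \<omega> \<le> ennreal t) * (G (path \<omega>) * ?tf (path \<omega>)) \<partial>\<mu>) =
      (\<integral>\<omega>. of_bool (T \<omega> \<le> ennreal t) * (G (reflect_from T (reflect_at \<beta> (of_int m1)) \<omega>) *
         ?tf (reflect_from T (reflect_at \<beta> (of_int m1)) \<omega>)) \<partial>\<mu>)"
    unfolding T_def by (rule wall_reflection) (use \<beta> G t in auto)
  also have "\<dots> = (\<integral>\<omega>. of_bool (T \<omega> \<le> ennreal t) * (G (path \<omega>) * (of_int m1 * ?R (path \<omega>))) -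
      of_bool (T \<omega> \<le> ennreal t) * (G (path \<omega>) * ?tf (path \<omega>)) \<partial>\<mu>)"
    by (rule integral_cong_good)
      (use int_tf int_R reflected in \<open>auto simp: of_bool_def intro: borel_measurable_integrable\<close>)
  finally show ?thesis
    using int_tf int_R by simp
qed

text \<open>The cases are those of \<open>strip_trichotomy\<close>. Without an exit no integer level
  is hit and \<open>trunc_factor\<close> is the full sum of half signs, which is 1; the two kinds of
  exit are evaluated by \<open>strip_exit_trunc_factor\<close>.\<close>

lemma fold_trunc_factor:
  assumes \<beta>: "\<beta> \<in> roots" "0 < x \<bullet> \<beta>" "x \<bullet> \<beta> < 1" and t: "0 \<le> t" and N: "1 \<le> N"
    and G: "path_functional G" "orthogonal_invariant \<beta> G"
  shows "(\<integral>\<omega>. G (path \<omega>) * trunc_factor N t \<beta> (path \<omega>) \<partial>\<mu>) =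
    (\<integral>\<omega>. G (path \<omega>) * folded_factor N t \<beta> (path \<omega>) \<partial>\<mu>)"
proof -
  let ?tf = "trunc_factor N t \<beta>" and ?R = "\<lambda>p. boundary_hits N t \<beta> p * (1 / 2)"
  let ?none = "\<lambda>p. of_bool (\<not> hits t \<beta> 0 p) * of_bool (\<not> hits t \<beta> 1 p) :: real"
  define T where "T m = first_at (\<beta>, of_int m) {(\<beta>, of_int (1 - m))} {}" for m
  have T_le: "T 0 \<omega> \<le> ennreal t \<longleftrightarrow> exits t \<beta> 0 1 (path \<omega>)" "T 1 \<omega> \<le> ennreal t \<longleftrightarrow> exits t \<beta> 1 0 (path \<omega>)"
    if "good \<omega>" for \<omega>
    using first_at_strip_le_iff[OF that t, of \<beta>] by (simp_all add: T_def)
  have Tst: "stopping_time NF (T m)" for m unfolding T_def by (rule stopping_time_first_at) auto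
  have int_tf: "integrable \<mu> (\<lambda>\<omega>. of_bool (T m \<omega> \<le> ennreal t) * (G (path \<omega>) * ?tf (path \<omega>)))" for m
    using t by (intro integrable_stopped[OF Tst] path_functional_times G path_functional_trunc_factor)
  have int_R: "integrable \<mu> (\<lambda>\<omega>. of_bool (T 1 \<omega> \<le> ennreal t) * (G (path \<omega>) * ?R (path \<omega>)))"
    using t by (intro integrable_stopped[OF Tst] path_functional_times G path_functional_const path_functional_boundary_hits)
  have int_none: "integrable \<mu> (\<lambda>\<omega>. G (path \<omega>) * ?none (path \<omega>))"
    using t by (intro path_functional_integrable path_functional_times G path_functional_not_hits)
  have "(\<integral>\<omega>. G (path \<omega>) * ?tf (path \<omega>) \<partial>\<mu>) = (\<integral>\<omega>. G (path \<omega>) * ?none (path \<omega>) +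
      (of_bool (T 0 \<omega> \<le> ennreal t) * (G (path \<omega>) * ?tf (path \<omega>)) +
       of_bool (T 1 \<omega> \<le> ennreal t) * (G (path \<omega>) * ?tf (path \<omega>))) \<partial>\<mu>)"
  proof (rule integral_cong_good)
    fix \<omega> assume \<omega>: "good \<omega>"
    have "?none (path \<omega>) * ?tf (path \<omega>) = ?none (path \<omega>)"
    proof (cases "hits t \<beta> 0 (path \<omega>) \<or> hits t \<beta> 1 (path \<omega>)")
      case False
      then have "?tf (path \<omega>) = 1"
        using no_exit_no_hits[OF \<omega> \<beta>(2,3)] by (simp add: trunc_factor_def sum_half_sign)
      then show ?thesis by simp
    qed auto
    moreover have "?none (path \<omega>) + of_bool (T 0 \<omega> \<le> ennreal t) + of_bool (T 1 \<omega> \<le> ennreal t) = 1"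
      unfolding T_le[OF \<omega>] by (rule strip_trichotomy[OF _ t]) (use \<omega> in \<open>simp add: good_def\<close>)
    ultimately have "?tf (path \<omega>) = ?none (path \<omega>) +
        (of_bool (T 0 \<omega> \<le> ennreal t) * ?tf (path \<omega>) + of_bool (T 1 \<omega> \<le> ennreal t) * ?tf (path \<omega>))"
      by (metis (no_types, lifting) add.assoc distrib_right mult_1)
    moreover have "f = n + (a * f + b * f) \<Longrightarrow> g * f = g * n + (a * (g * f) + b * (g * f))" for f n a b g :: real
      by algebra
    ultimately show "G (path \<omega>) * ?tf (path \<omega>) = G (path \<omega>) * ?none (path \<omega>) +
      (of_bool (T 0 \<omega> \<le> ennreal t) * (G (path \<omega>) * ?tf (path \<omega>)) +
       of_bool (T 1 \<omega> \<le> ennreal t) * (G (path \<omega>) * ?tf (path \<omega>)))"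
      by blast
  qed (intro borel_measurable_integrable Bochner_Integration.integrable_add int_none int_tf)
  also have "\<dots> = (\<integral>\<omega>. G (path \<omega>) * ?none (path \<omega>) \<partial>\<mu>) +
      ((\<integral>\<omega>. of_bool (T 0 \<omega> \<le> ennreal t) * (G (path \<omega>) * ?tf (path \<omega>)) \<partial>\<mu>) +
       (\<integral>\<omega>. of_bool (T 1 \<omega> \<le> ennreal t) * (G (path \<omega>) * ?tf (path \<omega>)) \<partial>\<mu>))"
    by (simp only: Bochner_Integration.integral_add Bochner_Integration.integrable_add int_none int_tf)
  also have "(\<integral>\<omega>. of_bool (T 0 \<omega> \<le> ennreal t) * (G (path \<omega>) * ?tf (path \<omega>)) \<partial>\<mu>) = 0"
    unfolding T_def by (subst strip_exit_trunc_factor[OF \<beta> _ t N G]) auto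
  also have "(\<integral>\<omega>. of_bool (T 1 \<omega> \<le> ennreal t) * (G (path \<omega>) * ?tf (path \<omega>)) \<partial>\<mu>) =
      (\<integral>\<omega>. of_bool (T 1 \<omega> \<le> ennreal t) * (G (path \<omega>) * ?R (path \<omega>)) \<partial>\<mu>)"
    unfolding T_def by (subst strip_exit_trunc_factor[OF \<beta> _ t N G]) auto
  also have "(\<integral>\<omega>. G (path \<omega>) * ?none (path \<omega>) \<partial>\<mu>) +
      (0 + (\<integral>\<omega>. of_bool (T 1 \<omega> \<le> ennreal t) * (G (path \<omega>) * ?R (path \<omega>)) \<partial>\<mu>)) =
    (\<integral>\<omega>. G (path \<omega>) * ?none (path \<omega>) + of_bool (T 1 \<omega> \<le> ennreal t) * (G (path \<omega>) * ?R (path \<omega>)) \<partial>\<mu>)"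
    using int_none int_R by simp
  also have "\<dots> = (\<integral>\<omega>. G (path \<omega>) * folded_factor N t \<beta> (path \<omega>) \<partial>\<mu>)"
  proof (rule integral_cong_good[symmetric])
    fix \<omega> assume \<omega>: "good \<omega>"
    show "G (path \<omega>) * folded_factor N t \<beta> (path \<omega>) =
      G (path \<omega>) * ?none (path \<omega>) + of_bool (T 1 \<omega> \<le> ennreal t) * (G (path \<omega>) * ?R (path \<omega>))"
      unfolding folded_factor_def T_le[OF \<omega>] distrib_left by (simp only: mult.left_commute)
  qed (intro borel_measurable_integrable Bochner_Integration.integrable_add int_none int_R)
  finally show ?thesis .
qed

text \<open>The factors are folded one at a time. The others, folded or not, depend only on
  components orthogonal to the root in question and form the invariant weight
  \<open>G\<close>.\<close>

lemma fold_trunc_factors: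
  assumes A: "finite A" "A \<subseteq> roots" "\<And>\<beta> \<gamma>. \<beta> \<in> A \<Longrightarrow> \<gamma> \<in> A \<Longrightarrow> \<beta> \<noteq> \<gamma> \<Longrightarrow> \<beta> \<bullet> \<gamma> = 0"
    and x: "\<And>\<beta>. \<beta> \<in> A \<Longrightarrow> 0 < x \<bullet> \<beta> \<and> x \<bullet> \<beta> < 1" and t: "0 \<le> t" and N: "1 \<le> N"
  shows "(\<integral>\<omega>. (\<Prod>\<beta>\<in>A. trunc_factor N t \<beta> (path \<omega>)) \<partial>\<mu>) = (\<integral>\<omega>. (\<Prod>\<beta>\<in>A. folded_factor N t \<beta> (path \<omega>)) \<partial>\<mu>)"
proof -
  have "(\<integral>\<omega>. (\<Prod>\<beta>\<in>A. trunc_factor N t \<beta> (path \<omega>)) \<partial>\<mu>) =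
      (\<integral>\<omega>. (\<Prod>\<beta>\<in>B. folded_factor N t \<beta> (path \<omega>)) * (\<Prod>\<beta>\<in>A - B. trunc_factor N t \<beta> (path \<omega>)) \<partial>\<mu>)"
    if "B \<subseteq> A" for B
    using finite_subset[OF that A(1)] that
  proof (induction B rule: finite_induct)
    case (insert \<beta> B)
    then have \<beta>: "\<beta> \<in> A" "\<beta> \<notin> B" and B: "B \<subseteq> A" by auto
    define G where "G p = (\<Prod>\<gamma>\<in>B. folded_factor N t \<gamma> p) * (\<Prod>\<gamma>\<in>A - insert \<beta> B. trunc_factor N t \<gamma> p)" for p
    have "path_functional G"
      unfolding G_def[abs_def] using t by (intro path_functional_times path_functional_prod path_functional_folded_factor path_functional_trunc_factor)
    moreover have "orthogonal_invariant \<beta> G"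
      unfolding orthogonal_invariant_def
    proof (intro allI impI)
      fix p q :: "real \<Rightarrow> (real, 'n) vec" assume pq: "\<forall>u\<ge>0. \<forall>\<gamma>. \<gamma> \<bullet> \<beta> = 0 \<longrightarrow> p u \<bullet> \<gamma> = q u \<bullet> \<gamma>"
      have "p u \<bullet> \<gamma> = q u \<bullet> \<gamma>" if "\<gamma> \<in> A" "\<gamma> \<noteq> \<beta>" "0 \<le> u" for u \<gamma> using pq A(3)[of \<gamma> \<beta>] \<beta> that by auto
      then show "G p = G q" unfolding G_def using B \<beta>
        by (intro arg_cong2[of _ _ _ _ "(*)"] prod.cong refl folded_factor_cong trunc_factor_cong) auto
    qed
    ultimately have "(\<integral>\<omega>. G (path \<omega>) * trunc_factor N t \<beta> (path \<omega>) \<partial>\<mu>) = (\<integral>\<omega>. G (path \<omega>) * folded_factor N t \<beta> (path \<omega>) \<partial>\<mu>)"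
      using \<beta> A(2) x by (intro fold_trunc_factor t N) auto
    moreover have "(\<Prod>\<gamma>\<in>B. folded_factor N t \<gamma> p) * (\<Prod>\<gamma>\<in>A - B. trunc_factor N t \<gamma> p) = G p * trunc_factor N t \<beta> p" for p
    proof -
      have diff: "A - insert \<beta> B = A - B - {\<beta>}" by auto
      have "(\<Prod>\<gamma>\<in>A - B. trunc_factor N t \<gamma> p) = trunc_factor N t \<beta> p * (\<Prod>\<gamma>\<in>A - insert \<beta> B. trunc_factor N t \<gamma> p)"
        unfolding diff by (rule prod.remove) (use A(1) \<beta> in auto)
      then show ?thesis by (simp add: G_def)
    qed
    moreover have "(\<Prod>\<gamma>\<in>insert \<beta> B. folded_factor N t \<gamma> p) * (\<Prod>\<gamma>\<in>A - insert \<beta> B. trunc_factor N t \<gamma> p) = G p * folded_factor N t \<beta> p" for p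
      using insert(1) \<beta>(2) by (simp add: G_def)
    ultimately show ?case using insert.IH[OF B] by simp
  qed simp
  from this[of A] show ?thesis by simp
qed

lemma folded_factor_limit:
  assumes \<omega>: "good \<omega>" and t: "0 \<le> t"
  shows "(\<lambda>N. folded_factor N t \<beta> (path \<omega>)) \<longlonglongrightarrow> 1 + exit_sign t \<beta> (path \<omega>)"
proof -
  have p: "continuous_on {0..} (path \<omega>)" using \<omega> by (simp add: good_def)
  have "compact ((\<lambda>u. path \<omega> u \<bullet> \<beta>) ` {0..t})"
    by (intro compact_continuous_image continuous_intros continuous_on_subset[OF p]) auto
  then obtain b where b: "\<And>u. u \<in> {0..t} \<Longrightarrow> \<bar>path \<omega> u \<bullet> \<beta>\<bar> \<le> b"
    using compact_imp_bounded bounded_iff by (metis imageI real_norm_def)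
  \<comment> \<open>The boundary level closest to 0 is \<open>1 - int N\<close>, so
    \<open>N - 1\<close> has to exceed the bound \<open>b\<close> of the path. All four boundary
    levels are then missed, and half their number is 2.\<close>
  have "folded_factor N t \<beta> (path \<omega>) = 1 + exit_sign t \<beta> (path \<omega>)" if N: "nat \<lceil>b\<rceil> + 2 \<le> N" for N
  proof -
    have "b < real N - 1" using N by linarith
    then have "\<not> hits t \<beta> (of_int m) (path \<omega>)" if "m \<in> {- int N, 1 - int N, int N + 1, int N + 2}" for m
      using that b by (fastforce simp: hits_def)
    then have "(\<Sum>m\<in>{- int N, 1 - int N, int N + 1, int N + 2}. of_bool (\<not> hits t \<beta> (of_int m) (path \<omega>)) :: real) =
        (\<Sum>m\<in>{- int N, 1 - int N, int N + 1, int N + 2}. 1)" by (intro sum.cong) auto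
    also have "\<dots> = 4" using N by (simp add: card_insert_if)
    finally show ?thesis
      using strip_trichotomy[OF p t, of \<beta>] by (simp add: folded_factor_def boundary_hits_def exit_sign_def)
  qed
  then have "\<forall>\<^sub>F N in sequentially. folded_factor N t \<beta> (path \<omega>) = 1 + exit_sign t \<beta> (path \<omega>)"
    by (auto simp: eventually_sequentially)
  then show ?thesis by (rule tendsto_eventually)
qed

text \<open>Folding precedes the limit because the folded factors, unlike the original ones, are
  bounded independently of \<open>N\<close> and of the path.\<close>

lemma trunc_factors_limit:
  assumes A: "finite A" "A \<subseteq> roots" "\<And>\<beta> \<gamma>. \<beta> \<in> A \<Longrightarrow> \<gamma> \<in> A \<Longrightarrow> \<beta> \<noteq> \<gamma> \<Longrightarrow> \<beta> \<bullet> \<gamma> = 0"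
    and x: "\<And>\<beta>. \<beta> \<in> A \<Longrightarrow> 0 < x \<bullet> \<beta> \<and> x \<bullet> \<beta> < 1" and t: "0 \<le> t"
  shows "(\<lambda>N. \<integral>\<omega>. (\<Prod>\<beta>\<in>A. trunc_factor N t \<beta> (path \<omega>)) \<partial>\<mu>) \<longlonglongrightarrow>
    (\<integral>\<omega>. (\<Prod>\<beta>\<in>A. 1 + exit_sign t \<beta> (path \<omega>)) \<partial>\<mu>)"
proof -
  have "(\<lambda>N. \<integral>\<omega>. (\<Prod>\<beta>\<in>A. folded_factor N t \<beta> (path \<omega>)) \<partial>\<mu>) \<longlonglongrightarrow>
    (\<integral>\<omega>. (\<Prod>\<beta>\<in>A. 1 + exit_sign t \<beta> (path \<omega>)) \<partial>\<mu>)"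
  proof (rule integral_dominated_convergence[where w="\<lambda>_. 3 ^ card A"])
    show "(\<lambda>\<omega>. \<Prod>\<beta>\<in>A. 1 + exit_sign t \<beta> (path \<omega>)) \<in> borel_measurable \<mu>"
      using t by (intro path_functional_measurable path_functional_prod path_functional_add path_functional_const path_functional_exit_sign)
    show "(\<lambda>\<omega>. \<Prod>\<beta>\<in>A. folded_factor N t \<beta> (path \<omega>)) \<in> borel_measurable \<mu>" for N
      using t by (intro path_functional_measurable path_functional_prod path_functional_folded_factor)
    show "AE \<omega> in \<mu>. (\<lambda>N. \<Prod>\<beta>\<in>A. folded_factor N t \<beta> (path \<omega>)) \<longlonglongrightarrow> (\<Prod>\<beta>\<in>A. 1 + exit_sign t \<beta> (path \<omega>))"
      using AE_good by eventually_elim (intro tendsto_prod folded_factor_limit t)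
    show "AE \<omega> in \<mu>. norm (\<Prod>\<beta>\<in>A. folded_factor N t \<beta> (path \<omega>)) \<le> 3 ^ card A" for N
    proof (rule AE_I2)
      fix \<omega>
      have "(\<Prod>\<beta>\<in>A. \<bar>folded_factor N t \<beta> (path \<omega>)\<bar>) \<le> (\<Prod>\<beta>\<in>A. 3)"
        by (rule prod_mono) (simp add: abs_folded_factor_le)
      then show "norm (\<Prod>\<beta>\<in>A. folded_factor N t \<beta> (path \<omega>)) \<le> 3 ^ card A" by (simp add: abs_prod)
    qed
  qed simp
  moreover have "\<forall>\<^sub>F N in sequentially. (\<integral>\<omega>. (\<Prod>\<beta>\<in>A. folded_factor N t \<beta> (path \<omega>)) \<partial>\<mu>) =
      (\<integral>\<omega>. (\<Prod>\<beta>\<in>A. trunc_factor N t \<beta> (path \<omega>)) \<partial>\<mu>)"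
    using eventually_ge_at_top[of 1] by eventually_elim (rule fold_trunc_factors[OF A x t, symmetric], auto)
  ultimately show ?thesis by (rule Lim_transform_eventually)
qed

end

section \<open>Pfaffian sums of odd order\<close>

definition perms :: "('n::finite \<Rightarrow> 'n) set" where "perms = {\<pi>. \<pi> permutes UNIV}"

abbreviation swap :: "'a \<Rightarrow> 'a \<Rightarrow> 'a \<Rightarrow> 'a" where "swap \<equiv> Transposition.transpose"

lemma finite_perms [simp]: "finite (perms :: ('n::finite \<Rightarrow> 'n) set)"
  unfolding perms_def by (rule finite_permutations) simp

lemma perms_compose: "\<pi> \<in> perms \<Longrightarrow> \<rho> \<in> perms \<Longrightarrow> \<pi> \<circ> \<rho> \<in> perms"
  unfolding perms_def by (auto intro: permutes_compose)

lemma perms_inv: "\<pi> \<in> perms \<Longrightarrow> inv \<pi> \<in> perms"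
  unfolding perms_def by (auto intro: permutes_inv)

lemma perms_transpose: "swap i j \<in> perms"
  unfolding perms_def by (auto intro: permutes_swap_id)

lemma perms_inj: "\<pi> \<in> perms \<Longrightarrow> inj \<pi>"
  unfolding perms_def by (auto intro: permutes_inj)

lemma sign_perms_compose: "\<pi> \<in> perms \<Longrightarrow> \<rho> \<in> perms \<Longrightarrow> sign (\<pi> \<circ> \<rho>) = sign \<pi> * sign \<rho>"
  unfolding perms_def by (auto intro!: sign_compose simp: permutation_permutes intro: finite)

text \<open>A near-perfect matching of neighbours: slot \<open>i\<close> is matched with
  \<open>nx i\<close>, and \<open>z\<close> stays single. \<open>adjacent\<close> says that no other
  index lies between the two ends of a slot. A permutation fills the positions.\<close>

locale slot_structure =
  fixes I :: "'n::{finite,linorder} set" and nx :: "'n \<Rightarrow> 'n" and z :: 'n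
  assumes inj_nx: "inj_on nx I" and disjoint_nx: "I \<inter> nx ` I = {}" and free: "z \<notin> I" "z \<notin> nx ` I"
    and cover: "insert z (I \<union> nx ` I) = UNIV"
    and less_nx: "i \<in> I \<Longrightarrow> i < nx i" and adjacent: "i \<in> I \<Longrightarrow> l \<noteq> i \<Longrightarrow> l \<noteq> nx i \<Longrightarrow> l < i \<longleftrightarrow> l < nx i"
begin

lemma nx_simps [simp]:
  assumes "i \<in> I"
  shows "nx i \<noteq> i" "i \<noteq> nx i" "nx i \<notin> I" "z \<noteq> i" "z \<noteq> nx i" "i \<noteq> z" "nx i \<noteq> z"
proof -
  have "nx i \<in> nx ` I" using assms by simp
  then have n: "nx i \<notin> I" using disjoint_nx by blast
  then show "nx i \<notin> I" "nx i \<noteq> i" "i \<noteq> nx i" using assms by metis+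
  show "z \<noteq> i" "z \<noteq> nx i" "i \<noteq> z" "nx i \<noteq> z" using assms \<open>nx i \<in> nx ` I\<close> free by metis+
qed

lemma nx_eq [simp]: "i \<in> I \<Longrightarrow> j \<in> I \<Longrightarrow> nx i = nx j \<longleftrightarrow> i = j"
  using inj_nx by (auto dest: inj_onD)

lemma nx_neq [simp]: "i \<in> I \<Longrightarrow> j \<in> I \<Longrightarrow> nx i \<noteq> j" "i \<in> I \<Longrightarrow> j \<in> I \<Longrightarrow> j \<noteq> nx i"
  using nx_simps(3) by metis+

text \<open>Each slot has its own function so that slots can be altered one by one; the sum is
  linear in each of them.\<close>

definition slot_sum :: "('n \<Rightarrow> 'n \<Rightarrow> 'n \<Rightarrow> real) \<Rightarrow> real" where
  "slot_sum b = (\<Sum>\<pi>\<in>perms. of_int (sign \<pi>) * (\<Prod>i\<in>I. b i (\<pi> i) (\<pi> (nx i))))"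

definition pf_term :: "('n \<Rightarrow> 'n \<Rightarrow> real) \<Rightarrow> ('n \<Rightarrow> 'n) \<Rightarrow> real" where
  "pf_term a \<pi> = of_int (sign \<pi>) * (\<Prod>i\<in>I. a (\<pi> i) (\<pi> (nx i)))"

text \<open>For antisymmetric \<open>a\<close> every pairing is counted \<open>fiber_card\<close>
  times, so this is a fixed multiple of the bordered Pfaffian. Summing over all permutations makes
  transpositions act without any choice of representatives.\<close>

definition pf_sum :: "('n \<Rightarrow> 'n \<Rightarrow> real) \<Rightarrow> real" where "pf_sum a = (\<Sum>\<pi>\<in>perms. pf_term a \<pi>)"

lemma sum_perms_right_transpose:
  fixes f :: "('n \<Rightarrow> 'n) \<Rightarrow> real"
  assumes "i \<noteq> j"
  shows "(\<Sum>\<pi>\<in>perms. of_int (sign \<pi>) * f \<pi>) = - (\<Sum>\<pi>\<in>perms. of_int (sign \<pi>) * f (\<pi> \<circ> swap i j) :: real)"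
proof -
  let ?\<tau> = "swap i j :: 'n \<Rightarrow> 'n"
  have "(\<Sum>\<pi>\<in>perms. of_int (sign \<pi>) * f \<pi>) = (\<Sum>\<pi>\<in>perms. of_int (sign (\<pi> \<circ> ?\<tau>)) * f (\<pi> \<circ> ?\<tau>))"
    by (rule sum.reindex_bij_witness[of _ "\<lambda>\<pi>. \<pi> \<circ> ?\<tau>" "\<lambda>\<pi>. \<pi> \<circ> ?\<tau>"])
      (auto simp: comp_assoc intro!: perms_compose perms_transpose)
  also have "\<dots> = (\<Sum>\<pi>\<in>perms. - (of_int (sign \<pi>) * f (\<pi> \<circ> ?\<tau>)))"
    using assms by (intro sum.cong) (auto simp: sign_perms_compose perms_transpose sign_swap_id)
  finally show ?thesis by (simp add: sum_negf)
qed

text \<open>The position \<open>z\<close> occurs in no factor and, by the assumption on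
  \<open>b i0\<close>, the position \<open>nx i0\<close> has no influence either. Transposing the
  two keeps every product and reverses every sign.\<close>

lemma slot_sum_vanish_fst:
  assumes i0: "i0 \<in> I" and b: "\<And>x y. b i0 x y = f x"
  shows "slot_sum b = 0"
proof -
  let ?\<tau> = "swap (nx i0) z"
  have "(\<Prod>i\<in>I. b i ((\<pi> \<circ> ?\<tau>) i) ((\<pi> \<circ> ?\<tau>) (nx i))) = (\<Prod>i\<in>I. b i (\<pi> i) (\<pi> (nx i)))" for \<pi>
  proof (rule prod.cong)
    fix i assume "i \<in> I"
    then show "b i ((\<pi> \<circ> ?\<tau>) i) ((\<pi> \<circ> ?\<tau>) (nx i)) = b i (\<pi> i) (\<pi> (nx i))"
      using i0 b by (cases "i = i0") (simp_all add: Transposition.transpose_def)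
  qed simp
  then have "slot_sum b = - slot_sum b"
    using sum_perms_right_transpose[of "nx i0" z "\<lambda>\<pi>. \<Prod>i\<in>I. b i (\<pi> i) (\<pi> (nx i))"] i0
    unfolding slot_sum_def by simp
  then show ?thesis by simp
qed

lemma slot_sum_vanish_snd:
  assumes i0: "i0 \<in> I" and b: "\<And>x y. b i0 x y = f y"
  shows "slot_sum b = 0"
proof -
  let ?\<tau> = "swap i0 z"
  have "(\<Prod>i\<in>I. b i ((\<pi> \<circ> ?\<tau>) i) ((\<pi> \<circ> ?\<tau>) (nx i))) = (\<Prod>i\<in>I. b i (\<pi> i) (\<pi> (nx i)))" for \<pi>
  proof (rule prod.cong)
    fix i assume "i \<in> I"
    then show "b i ((\<pi> \<circ> ?\<tau>) i) ((\<pi> \<circ> ?\<tau>) (nx i)) = b i (\<pi> i) (\<pi> (nx i))"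
      using i0 b by (cases "i = i0") (simp_all add: Transposition.transpose_def)
  qed simp
  then have "slot_sum b = - slot_sum b"
    using sum_perms_right_transpose[of i0 z "\<lambda>\<pi>. \<Prod>i\<in>I. b i (\<pi> i) (\<pi> (nx i))"] i0
    unfolding slot_sum_def by simp
  then show ?thesis by simp
qed

lemma slot_sum_add:
  assumes i0: "i0 \<in> I"
  shows "slot_sum (b(i0 := \<lambda>x y. f x y + g x y)) = slot_sum (b(i0 := f)) + slot_sum (b(i0 := g))"
proof -
  have "(\<Prod>i\<in>I. (b(i0 := h)) i (\<pi> i) (\<pi> (nx i))) = h (\<pi> i0) (\<pi> (nx i0)) * (\<Prod>i\<in>I - {i0}. b i (\<pi> i) (\<pi> (nx i)))" for h \<pi>
  proof -
    have "(\<Prod>i\<in>I - {i0}. (b(i0 := h)) i (\<pi> i) (\<pi> (nx i))) = (\<Prod>i\<in>I - {i0}. b i (\<pi> i) (\<pi> (nx i)))"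
      by (rule prod.cong) auto
    then show ?thesis using prod.remove[OF finite i0, of "\<lambda>i. (b(i0 := h)) i (\<pi> i) (\<pi> (nx i))"] by simp
  qed
  then show ?thesis unfolding slot_sum_def by (simp add: sum.distrib[symmetric] algebra_simps)
qed

text \<open>
  Adding \<open>c x - c y\<close> to one slot changes the sum by terms that are independent of one of the two
  indices in this slot; these cancel against the transposition of that index with the free one.
\<close>

lemma pf_sum_shift: "pf_sum (\<lambda>x y. a x y + c x - c y) = pf_sum a"
proof -
  have "slot_sum (\<lambda>i. if i \<in> J then (\<lambda>x y. a x y + c x - c y) else a) = slot_sum (\<lambda>_. a)" if "J \<subseteq> I" for J
    using finite[of J] that
  proof (induction J rule: finite_induct)
    case (insert i0 J)
    let ?b = "\<lambda>i. if i \<in> J then (\<lambda>x y. a x y + c x - c y) else a"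
    have b: "(\<lambda>i. if i \<in> insert i0 J then (\<lambda>x y. a x y + c x - c y) else a) = ?b(i0 := \<lambda>x y. a x y + (c x + - c y))"
      by (auto simp: fun_eq_iff)
    have i0: "i0 \<in> I" using insert by auto
    have "slot_sum (?b(i0 := \<lambda>x y. c x)) = 0" by (rule slot_sum_vanish_fst[OF i0]) simp
    moreover have "slot_sum (?b(i0 := \<lambda>x y. - c y)) = 0" by (rule slot_sum_vanish_snd[OF i0]) simp
    moreover have "?b(i0 := a) = ?b" using insert by (auto simp: fun_eq_iff)
    ultimately show ?case unfolding b slot_sum_add[OF i0] using insert by simp
  qed (simp add: if_False)
  from this[of I] show ?thesis
    unfolding pf_sum_def pf_term_def slot_sum_def by (simp cong: prod.cong)
qed

lemma pf_sum_transpose: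
  assumes "i \<noteq> j"
  shows "pf_sum (\<lambda>x y. a (swap i j x) (swap i j y)) = - pf_sum a"
proof -
  let ?\<tau> = "swap i j :: 'n \<Rightarrow> 'n"
  have "pf_sum a = (\<Sum>\<pi>\<in>perms. pf_term a (?\<tau> \<circ> \<pi>))"
    unfolding pf_sum_def
    by (rule sum.reindex_bij_witness[of _ "\<lambda>\<pi>. ?\<tau> \<circ> \<pi>" "\<lambda>\<pi>. ?\<tau> \<circ> \<pi>"])
      (auto simp: comp_assoc[symmetric] intro!: perms_compose perms_transpose)
  also have "\<dots> = (\<Sum>\<pi>\<in>perms. - pf_term (\<lambda>x y. a (?\<tau> x) (?\<tau> y)) \<pi>)"
    using assms by (intro sum.cong) (auto simp: pf_term_def sign_perms_compose perms_transpose sign_swap_id)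
  finally show ?thesis by (simp add: pf_sum_def sum_negf)
qed

section \<open>Signed terms as functions of the unordered pairs\<close>

definition pairing :: "('n \<Rightarrow> 'n) \<Rightarrow> 'n set set" where "pairing \<pi> = (\<lambda>i. {\<pi> i, \<pi> (nx i)}) ` I"

lemma pairing_compose: "pairing (\<pi> \<circ> \<rho>) = (`) \<pi> ` pairing \<rho>"
  unfolding pairing_def by (auto simp: image_image)

lemma pairing_flip: "i \<in> I \<Longrightarrow> pairing (\<pi> \<circ> swap i (nx i)) = pairing \<pi>"
  unfolding pairing_def by (intro image_cong refl) (auto simp: Transposition.transpose_def)

text \<open>Two sign changes cancel: that of the transposition and that of the single entry whose
  arguments are exchanged.\<close>

lemma pf_term_flip:
  assumes a: "\<And>x y. a y x = - a x y" and \<pi>: "\<pi> \<in> perms" and i: "i \<in> I"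
  shows "pf_term a (\<pi> \<circ> swap i (nx i)) = pf_term a \<pi>"
proof -
  let ?\<tau> = "swap i (nx i)"
  have "(\<Prod>j\<in>I - {i}. a ((\<pi> \<circ> ?\<tau>) j) ((\<pi> \<circ> ?\<tau>) (nx j))) = (\<Prod>j\<in>I - {i}. a (\<pi> j) (\<pi> (nx j)))"
    using i by (intro prod.cong refl) (auto simp: Transposition.transpose_def)
  then have "(\<Prod>j\<in>I. a ((\<pi> \<circ> ?\<tau>) j) ((\<pi> \<circ> ?\<tau>) (nx j))) = - (\<Prod>j\<in>I. a (\<pi> j) (\<pi> (nx j)))"
    using prod.remove[OF finite i, of "\<lambda>j. a (\<pi> j) (\<pi> (nx j))"] a[of "\<pi> i" "\<pi> (nx i)"]
      prod.remove[OF finite i, of "\<lambda>j. a ((\<pi> \<circ> ?\<tau>) j) ((\<pi> \<circ> ?\<tau>) (nx j))"] i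
    by simp
  then show ?thesis using i \<pi> by (simp add: pf_term_def sign_perms_compose perms_transpose sign_swap_id)
qed

text \<open>Wrongly oriented slots are flipped one at a time, which lowers their number and changes
  neither the pairing nor the term. \<open>Q\<close> is later the order on indices, which makes all
  roots positive, or the relation of a slot to its partner.\<close>

lemma oriented_representative:
  assumes \<pi>: "\<pi> \<in> perms" and Q: "\<And>i. i \<in> I \<Longrightarrow> Q (\<pi> i) (\<pi> (nx i)) \<or> Q (\<pi> (nx i)) (\<pi> i)"
  obtains \<rho> where "\<rho> \<in> perms" "pairing \<rho> = pairing \<pi>" "\<And>i. i \<in> I \<Longrightarrow> Q (\<rho> i) (\<rho> (nx i))"
    "\<And>a :: 'n \<Rightarrow> 'n \<Rightarrow> real. (\<And>x y. a y x = - a x y) \<Longrightarrow> pf_term a \<rho> = pf_term a \<pi>"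
proof -
  have "\<exists>\<rho>\<in>perms. pairing \<rho> = pairing \<pi> \<and> (\<forall>i\<in>I. Q (\<rho> i) (\<rho> (nx i))) \<and>
      (\<forall>a :: 'n \<Rightarrow> 'n \<Rightarrow> real. (\<forall>x y. a y x = - a x y) \<longrightarrow> pf_term a \<rho> = pf_term a \<pi>)"
    using assms
  proof (induction "card {i\<in>I. \<not> Q (\<pi> i) (\<pi> (nx i))}" arbitrary: \<pi> rule: less_induct)
    case less
    show ?case
    proof (cases "\<exists>i\<in>I. \<not> Q (\<pi> i) (\<pi> (nx i))")
      case True
      then obtain i where i: "i \<in> I" "\<not> Q (\<pi> i) (\<pi> (nx i))" by auto
      define \<pi>' where "\<pi>' = \<pi> \<circ> swap i (nx i)"
      have p': "\<pi>' i = \<pi> (nx i)" "\<pi>' (nx i) = \<pi> i" by (simp_all add: \<pi>'_def)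
      have other: "\<pi>' j = \<pi> j" "\<pi>' (nx j) = \<pi> (nx j)" if "j \<in> I" "j \<noteq> i" for j
        using that i by (simp_all add: \<pi>'_def Transposition.transpose_def)
      have "Q (\<pi>' i) (\<pi>' (nx i))" using less(3)[OF i(1)] i(2) p' by simp
      then have "{j\<in>I. \<not> Q (\<pi>' j) (\<pi>' (nx j))} \<subset> {j\<in>I. \<not> Q (\<pi> j) (\<pi> (nx j))}" using i other by force
      then have "card {j\<in>I. \<not> Q (\<pi>' j) (\<pi>' (nx j))} < card {j\<in>I. \<not> Q (\<pi> j) (\<pi> (nx j))}"
        by (rule psubset_card_mono[OF finite])
      moreover have "\<pi>' \<in> perms" unfolding \<pi>'_def by (intro perms_compose less(2) perms_transpose)
      moreover have "Q (\<pi>' j) (\<pi>' (nx j)) \<or> Q (\<pi>' (nx j)) (\<pi>' j)" if "j \<in> I" for j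
        using less(3)[OF that] other[OF that] p' by (cases "j = i") auto
      ultimately obtain \<rho> where \<rho>: "\<rho>\<in>perms" "pairing \<rho> = pairing \<pi>'" "\<forall>i\<in>I. Q (\<rho> i) (\<rho> (nx i))"
        "\<forall>a :: 'n \<Rightarrow> 'n \<Rightarrow> real. (\<forall>x y. a y x = - a x y) \<longrightarrow> pf_term a \<rho> = pf_term a \<pi>'"
        using less(1)[of \<pi>'] by blast
      have "pf_term a \<rho> = pf_term a \<pi>" if as: "\<forall>x y. a y x = - a x y" for a :: "'n \<Rightarrow> 'n \<Rightarrow> real"
      proof -
        have "pf_term a \<rho> = pf_term a \<pi>'" using \<rho>(4) as by blast
        also have "\<dots> = pf_term a \<pi>" unfolding \<pi>'_def by (rule pf_term_flip[OF as[rule_format] less(2) i(1)])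
        finally show ?thesis .
      qed
      moreover have "pairing \<rho> = pairing \<pi>" using \<rho>(2) pairing_flip[OF i(1), of \<pi>] unfolding \<pi>'_def by (rule trans)
      ultimately show ?thesis using \<rho>(1,3) by blast
    next
      case False
      then show ?thesis using less(2) by blast
    qed
  qed
  then show ?thesis using that by blast
qed

text \<open>Such a permutation acts on the partners as it does on the slots. With \<kappa> its
  action on the slots and \<tau> the exchange of slots with partners, it is \<kappa> times the
  conjugate of \<kappa> by \<tau>, so every sign occurs squared.\<close>

lemma sign_slot_preserving:
  assumes \<rho>: "\<rho> \<in> perms" and I: "\<And>i. i \<in> I \<Longrightarrow> \<rho> i \<in> I" and nx: "\<And>i. i \<in> I \<Longrightarrow> \<rho> (nx i) = nx (\<rho> i)"
  shows "sign \<rho> = 1"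
proof -
  have inj: "inj \<rho>" by (rule perms_inj[OF \<rho>])
  have "\<rho> ` I = I" by (rule endo_inj_surj) (use I inj in \<open>auto intro: inj_on_subset\<close>)
  then have bij: "bij_betw \<rho> I I" using inj by (auto simp: bij_betw_def intro: inj_on_subset)
  have z: "\<rho> z = z"
  proof (rule ccontr)
    assume "\<rho> z \<noteq> z"
    then have "\<rho> z \<in> I \<union> nx ` I" using cover by auto
    then obtain i where "i \<in> I" "\<rho> z = i \<or> \<rho> z = nx i" by auto
    moreover from this obtain j where "j \<in> I" "i = \<rho> j" using \<open>\<rho> ` I = I\<close> by auto
    ultimately have "\<rho> z = \<rho> j \<or> \<rho> z = \<rho> (nx j)" using nx by auto
    then have "z = j \<or> z = nx j" using inj by (auto dest: injD)
    with \<open>j \<in> I\<close> show False by auto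
  qed
  define \<kappa> where "\<kappa> i = (if i \<in> I then \<rho> i else i)" for i
  define \<tau> where "\<tau> i = (if i \<in> I then nx i else if i \<in> nx ` I then the_inv_into I nx i else i)" for i
  have \<tau>_simps: "\<tau> i = nx i" "\<tau> (nx i) = i" "\<tau> z = z" if "i \<in> I" for i
    using that by (auto simp: \<tau>_def the_inv_into_f_f[OF inj_nx] free)
  have \<tau>z: "\<tau> z = z" using free by (simp add: \<tau>_def)
  have cases: "P i" if "P z" "\<And>j. j \<in> I \<Longrightarrow> P j" "\<And>j. j \<in> I \<Longrightarrow> P (nx j)" for P i
  proof -
    have "i = z \<or> i \<in> I \<or> i \<in> nx ` I" using cover by blast
    then show ?thesis using that by blast
  qed
  have "\<tau> (\<tau> i) = i" for i by (rule cases[of "\<lambda>i. \<tau> (\<tau> i) = i"]) (auto simp: \<tau>_simps \<tau>z)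
  then have "bij \<tau>" by (rule involuntory_imp_bij)
  then have \<tau>: "\<tau> \<in> perms" unfolding perms_def by (auto intro: bij_imp_permutes)
  have "bij_betw \<kappa> I I" using bij by (rule bij_betw_cong[THEN iffD1, rotated]) (simp add: \<kappa>_def)
  then have "\<kappa> permutes I" by (rule bij_imp_permutes) (simp add: \<kappa>_def)
  then have \<kappa>: "\<kappa> \<in> perms" unfolding perms_def by (auto intro: permutes_subset)
  have "\<rho> i = (\<kappa> \<circ> (\<tau> \<circ> (\<kappa> \<circ> \<tau>))) i" for i
    by (rule cases) (auto simp: \<kappa>_def \<tau>_simps \<tau>z free z nx I)
  then have "\<rho> = \<kappa> \<circ> (\<tau> \<circ> (\<kappa> \<circ> \<tau>))" by (rule ext)
  then have "sign \<rho> = sign \<kappa> * (sign \<tau> * (sign \<kappa> * sign \<tau>))"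
    using \<kappa> \<tau> by (simp only: sign_perms_compose perms_compose)
  then show ?thesis by (cases \<kappa> rule: sign_cases; cases \<tau> rule: sign_cases) simp_all
qed

text \<open>The quotient \<rho> of the two permutations preserves the base pairing. Once oriented
  along the slots it is even and merely reindexes the product.\<close>

lemma pf_term_pairing:
  assumes a: "\<And>x y. a y x = - a x y" and \<pi>: "\<pi> \<in> perms" and \<pi>': "\<pi>' \<in> perms" and eq: "pairing \<pi>' = pairing \<pi>"
  shows "pf_term a \<pi>' = pf_term a \<pi>"
proof -
  define \<rho> where "\<rho> = inv \<pi> \<circ> \<pi>'"
  have \<rho>: "\<rho> \<in> perms" unfolding \<rho>_def by (intro perms_compose perms_inv \<pi> \<pi>')
  have inv: "inv \<pi> \<circ> \<pi> = id" "\<pi> \<circ> inv \<pi> = id"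
    using \<pi> unfolding perms_def by (auto simp: permutes_inv_o)
  have "pairing \<rho> = pairing id" unfolding \<rho>_def pairing_compose eq unfolding pairing_compose[symmetric] inv ..
  then have Q: "(\<rho> i \<in> I \<and> \<rho> (nx i) = nx (\<rho> i)) \<or> (\<rho> (nx i) \<in> I \<and> \<rho> i = nx (\<rho> (nx i)))" if "i \<in> I" for i
  proof -
    have "{\<rho> i, \<rho> (nx i)} \<in> pairing id" using that \<open>pairing \<rho> = pairing id\<close> unfolding pairing_def by blast
    then show ?thesis unfolding pairing_def by (auto simp: doubleton_eq_iff)
  qed
  define b where "b x y = a (\<pi> x) (\<pi> y)" for x y
  have b: "b y x = - b x y" for x y unfolding b_def by (rule a)
  obtain \<sigma> where \<sigma>: "\<sigma> \<in> perms" "\<And>i. i \<in> I \<Longrightarrow> \<sigma> i \<in> I \<and> \<sigma> (nx i) = nx (\<sigma> i)"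
    "\<And>c :: 'n \<Rightarrow> 'n \<Rightarrow> real. (\<And>x y. c y x = - c x y) \<Longrightarrow> pf_term c \<sigma> = pf_term c \<rho>"
    using oriented_representative[OF \<rho>, of "\<lambda>x y. x \<in> I \<and> y = nx x"] Q by metis
  have "inj \<sigma>" by (rule perms_inj[OF \<sigma>(1)])
  then have inj: "inj_on \<sigma> I" by (rule inj_on_subset) simp
  have surj: "\<sigma> ` I = I" by (rule endo_inj_surj[OF _ _ inj]) (use \<sigma>(2) in auto)
  have "pf_term b \<rho> = pf_term b \<sigma>" using \<sigma>(3)[OF b] by simp
  also have "\<dots> = (\<Prod>i\<in>I. b (\<sigma> i) (nx (\<sigma> i)))"
    using sign_slot_preserving[OF \<sigma>(1)] \<sigma>(2) by (simp add: pf_term_def)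
  also have "\<dots> = (\<Prod>j\<in>\<sigma> ` I. b j (nx j))" by (simp add: prod.reindex[OF inj])
  finally have 1: "pf_term b \<rho> = (\<Prod>j\<in>I. b j (nx j))" by (simp only: surj)
  have \<pi>'_eq: "\<pi>' = \<pi> \<circ> \<rho>" unfolding \<rho>_def comp_assoc[symmetric] inv by simp
  have "pf_term a \<pi>' = of_int (sign \<pi>) * pf_term b \<rho>"
    unfolding \<pi>'_eq pf_term_def using \<pi> \<rho> by (simp add: sign_perms_compose b_def)
  then show ?thesis unfolding 1 by (simp add: pf_term_def b_def)
qed

definition fiber_card :: real where "fiber_card = real (card {\<pi>\<in>perms. pairing \<pi> = pairing id})"

lemma fiber_card_pos: "0 < fiber_card"
proof -
  have "id \<in> {\<pi>\<in>perms. pairing \<pi> = pairing id}" by (simp add: perms_def permutes_id)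
  then have "0 < card {\<pi>\<in>perms. pairing \<pi> = pairing id}" by (subst card_gt_0_iff) auto
  then show ?thesis by (simp add: fiber_card_def)
qed

lemma card_fiber:
  assumes \<pi>: "\<pi> \<in> perms"
  shows "real (card {\<pi>'\<in>perms. pairing \<pi>' = pairing \<pi>}) = fiber_card"
proof -
  have inv: "inv \<pi> \<circ> \<pi> = id" "\<pi> \<circ> inv \<pi> = id" using \<pi> unfolding perms_def by (auto simp: permutes_inv_o)
  have "bij_betw ((\<circ>) \<pi>) {\<rho>\<in>perms. pairing \<rho> = pairing id} {\<pi>'\<in>perms. pairing \<pi>' = pairing \<pi>}"
  proof (rule bij_betwI[of _ _ _ "(\<circ>) (inv \<pi>)"])
    show "(\<circ>) \<pi> \<in> {\<rho>\<in>perms. pairing \<rho> = pairing id} \<rightarrow> {\<pi>'\<in>perms. pairing \<pi>' = pairing \<pi>}"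
      using \<pi> pairing_compose[of \<pi> id] by (auto simp: pairing_compose intro: perms_compose)
    show "(\<circ>) (inv \<pi>) \<in> {\<pi>'\<in>perms. pairing \<pi>' = pairing \<pi>} \<rightarrow> {\<rho>\<in>perms. pairing \<rho> = pairing id}"
      using \<pi> pairing_compose[of "inv \<pi>" \<pi>] inv by (auto simp: pairing_compose intro: perms_compose perms_inv)
  qed (simp_all add: comp_assoc[symmetric] inv)
  from bij_betw_same_card[OF this] show ?thesis by (simp add: fiber_card_def)
qed

lemma pf_sum_by_pairing:
  assumes h: "\<And>\<pi>. \<pi> \<in> perms \<Longrightarrow> pf_term a \<pi> = h (pairing \<pi>)"
  shows "pf_sum a = fiber_card * (\<Sum>m\<in>pairing ` perms. h m)"
proof -
  have "pf_sum a = (\<Sum>m\<in>pairing ` perms. \<Sum>\<pi>\<in>{\<pi>\<in>perms. pairing \<pi> = m}. pf_term a \<pi>)"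
    unfolding pf_sum_def by (rule sum.image_gen) simp
  also have "\<dots> = (\<Sum>m\<in>pairing ` perms. fiber_card * h m)"
  proof (rule sum.cong)
    fix m assume "m \<in> pairing ` perms"
    then obtain \<pi> where \<pi>: "\<pi> \<in> perms" "m = pairing \<pi>" by auto
    have "(\<Sum>\<pi>'\<in>{\<pi>'\<in>perms. pairing \<pi>' = m}. pf_term a \<pi>') = (\<Sum>\<pi>'\<in>{\<pi>'\<in>perms. pairing \<pi>' = m}. h m)"
      using h by (intro sum.cong) auto
    then show "(\<Sum>\<pi>'\<in>{\<pi>'\<in>perms. pairing \<pi>' = m}. pf_term a \<pi>') = fiber_card * h m"
      using card_fiber[OF \<pi>(1)] \<pi>(2) by simp
  qed simp
  finally show ?thesis by (simp add: sum_distrib_left)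
qed

text \<open>The exit matrix of a path that stays in the alcove, where every \<eta> is 0.\<close>

definition order_sign :: "'n \<Rightarrow> 'n \<Rightarrow> real" where
  "order_sign x y = (if x < y then 1 else if y < x then -1 else 0)"

text \<open>Exchanging two neighbours in the order alters only the comparison between these
  two.\<close>

lemma order_sign_transpose:
  assumes "i \<in> I" "x \<noteq> y" "{x, y} \<noteq> {i, nx i}"
  shows "order_sign (swap i (nx i) x) (swap i (nx i) y) = order_sign x y"
proof -
  have adj: "l < i \<longleftrightarrow> l < nx i" "i < l \<longleftrightarrow> nx i < l" if "l \<noteq> i" "l \<noteq> nx i" for l
    using adjacent[OF assms(1) that] that by (auto simp: not_less_iff_gr_or_eq)
  show ?thesis
    using assms adj[of x] adj[of y]
    by (cases "x = i"; cases "x = nx i"; cases "y = i"; cases "y = nx i")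
      (auto simp: order_sign_def Transposition.transpose_def insert_commute)
qed

text \<open>
  Pairings without the edge \<open>{i, nx i}\<close> cancel under the transposition of these adjacent
  indices, so only the pairing with all such edges survives.
\<close>

lemma pf_sum_order_sign: "pf_sum order_sign = fiber_card"
proof -
  have "pf_sum order_sign = (\<Sum>\<pi>\<in>{\<pi>\<in>perms. \<forall>i\<in>J. {i, nx i} \<in> pairing \<pi>}. pf_term order_sign \<pi>)" if "J \<subseteq> I" for J
    using finite[of J] that
  proof (induction J rule: finite_induct)
    case (insert i J)
    then have i: "i \<in> I" "i \<notin> J" "J \<subseteq> I" by auto
    let ?\<tau> = "swap i (nx i)"
    let ?S = "{\<pi>\<in>perms. \<forall>j\<in>J. {j, nx j} \<in> pairing \<pi>}"
    let ?B = "{\<pi>\<in>?S. {i, nx i} \<notin> pairing \<pi>}"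
    have image: "?\<tau> ` {j, nx j} = {j, nx j}" if "j \<in> I" for j
      using that i(1) by (cases "j = i") (auto simp: Transposition.transpose_def)
    have mem: "{j, nx j} \<in> pairing (?\<tau> \<circ> \<pi>) \<longleftrightarrow> {j, nx j} \<in> pairing \<pi>" if "j \<in> I" for j \<pi>
    proof -
      have "inj ((`) ?\<tau>)" by (rule injI) (simp only: inj_image_eq_iff[OF perms_inj[OF perms_transpose]])
      then have "?\<tau> ` {j, nx j} \<in> (`) ?\<tau> ` pairing \<pi> \<longleftrightarrow> {j, nx j} \<in> pairing \<pi>" by (rule inj_image_mem_iff)
      then show ?thesis unfolding pairing_compose image[OF that] .
    qed
    have "(\<Sum>\<pi>\<in>?B. pf_term order_sign \<pi>) = (\<Sum>\<pi>\<in>?B. pf_term order_sign (?\<tau> \<circ> \<pi>))"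
      by (rule sum.reindex_bij_witness[of _ "(\<circ>) ?\<tau>" "(\<circ>) ?\<tau>"])
        (use i mem in \<open>auto simp: comp_assoc[symmetric] intro: perms_compose perms_transpose\<close>)
    also have "\<dots> = (\<Sum>\<pi>\<in>?B. - pf_term order_sign \<pi>)"
    proof (rule sum.cong)
      fix \<pi> assume \<pi>: "\<pi> \<in> ?B"
      then have inj: "inj \<pi>" by (intro perms_inj) auto
      have "(\<Prod>j\<in>I. order_sign (?\<tau> (\<pi> j)) (?\<tau> (\<pi> (nx j)))) = (\<Prod>j\<in>I. order_sign (\<pi> j) (\<pi> (nx j)))"
      proof (rule prod.cong)
        fix j assume j: "j \<in> I"
        have "\<pi> j \<noteq> \<pi> (nx j)" using inj_eq[OF inj] j by simp
        moreover have "{\<pi> j, \<pi> (nx j)} \<in> pairing \<pi>" using j unfolding pairing_def by (rule imageI)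
        then have "{\<pi> j, \<pi> (nx j)} \<noteq> {i, nx i}" using \<pi> by auto
        ultimately show "order_sign (?\<tau> (\<pi> j)) (?\<tau> (\<pi> (nx j))) = order_sign (\<pi> j) (\<pi> (nx j))"
          by (rule order_sign_transpose[OF i(1)])
      qed simp
      then show "pf_term order_sign (?\<tau> \<circ> \<pi>) = - pf_term order_sign \<pi>"
        using \<pi> i(1) by (simp add: pf_term_def sign_perms_compose perms_transpose sign_swap_id)
    qed simp
    finally have "(\<Sum>\<pi>\<in>?B. pf_term order_sign \<pi>) = 0" by (simp add: sum_negf)
    moreover have "?S = {\<pi>\<in>perms. \<forall>j\<in>insert i J. {j, nx j} \<in> pairing \<pi>} \<union> ?B" by auto
    then have "(\<Sum>\<pi>\<in>?S. pf_term order_sign \<pi>) =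
        (\<Sum>\<pi>\<in>{\<pi>\<in>perms. \<forall>j\<in>insert i J. {j, nx j} \<in> pairing \<pi>} \<union> ?B. pf_term order_sign \<pi>)" by (rule arg_cong)
    then have "(\<Sum>\<pi>\<in>?S. pf_term order_sign \<pi>) =
        (\<Sum>\<pi>\<in>{\<pi>\<in>perms. \<forall>j\<in>insert i J. {j, nx j} \<in> pairing \<pi>}. pf_term order_sign \<pi>) + (\<Sum>\<pi>\<in>?B. pf_term order_sign \<pi>)"
      by (subst (asm) sum.union_disjoint) auto
    ultimately show ?case using insert.IH[OF i(3)] by (simp only: add_0_right)
  qed (simp add: pf_sum_def)
  from this[OF order_refl]
  have "pf_sum order_sign = (\<Sum>\<pi>\<in>{\<pi>\<in>perms. \<forall>i\<in>I. {i, nx i} \<in> pairing \<pi>}. pf_term order_sign \<pi>)" .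
  also have "{\<pi>\<in>perms. \<forall>i\<in>I. {i, nx i} \<in> pairing \<pi>} = {\<pi>\<in>perms. pairing \<pi> = pairing id}"
  proof -
    \<comment> \<open>\<open>pairing \<pi>\<close> has at most \<open>card I\<close> elements, so
      once it contains all base edges it consists of them.\<close>
    have "pairing \<pi> = pairing id" if "\<forall>i\<in>I. {i, nx i} \<in> pairing \<pi>" for \<pi>
    proof (rule card_seteq[symmetric])
      show "finite (pairing \<pi>)" by (simp add: pairing_def)
      show "pairing id \<subseteq> pairing \<pi>" using that by (auto simp: pairing_def)
      have "inj_on (\<lambda>i. {i, nx i}) I" by (rule inj_onI) (auto simp: doubleton_eq_iff)
      then have "card (pairing id) = card I" by (simp add: pairing_def card_image)
      then show "card (pairing \<pi>) \<le> card (pairing id)" by (simp add: pairing_def card_image_le)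
    qed
    moreover have "\<forall>i\<in>I. {i, nx i} \<in> pairing \<pi>" if "pairing \<pi> = pairing id" for \<pi>
      unfolding that by (auto simp: pairing_def)
    ultimately have "(\<forall>i\<in>I. {i, nx i} \<in> pairing \<pi>) \<longleftrightarrow> pairing \<pi> = pairing id" for \<pi> by blast
    then show ?thesis by simp
  qed
  also have "(\<Sum>\<pi>\<in>{\<pi>\<in>perms. pairing \<pi> = pairing id}. pf_term order_sign \<pi>) = (\<Sum>\<pi>\<in>{\<pi>\<in>perms. pairing \<pi> = pairing id}. 1)"
  proof (rule sum.cong)
    fix \<pi> assume "\<pi> \<in> {\<pi>\<in>perms. pairing \<pi> = pairing id}"
    then have "pf_term order_sign \<pi> = pf_term order_sign id"
      by (intro pf_term_pairing) (auto simp: order_sign_def perms_def permutes_id)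
    also have "\<dots> = 1" using less_nx by (simp add: pf_term_def order_sign_def)
    finally show "pf_term order_sign \<pi> = 1" .
  qed simp
  finally show ?thesis by (simp add: fiber_card_def)
qed

end

section \<open>The collection of orthogonal sets\<close>

lemma pos_less_iff: "pos i < pos j \<longleftrightarrow> i < (j :: 'n::{finite,linorder})"
proof
  have mono: "pos i < pos j" if "i < j" for i j :: 'n
    unfolding pos_def using that by (intro psubset_card_mono) auto
  show "i < j \<Longrightarrow> pos i < pos j" by (rule mono)
  show "pos i < pos j \<Longrightarrow> i < j" using mono[of j i] by (cases i j rule: linorder_cases) auto
qed

lemma pos_eq_iff: "pos i = pos j \<longleftrightarrow> i = (j :: 'n::{finite,linorder})"
  using pos_less_iff[of i j] pos_less_iff[of j i] by (metis less_irrefl linorder_less_linear)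

lemma range_pos: "range (pos :: 'n \<Rightarrow> nat) = {1..CARD('n::{finite,linorder})}"
proof (rule card_seteq)
  show "range (pos :: 'n \<Rightarrow> nat) \<subseteq> {1..CARD('n)}"
    unfolding pos_def by (auto simp: Suc_le_eq card_gt_0_iff intro: card_mono[OF finite subset_UNIV])
  have "inj (pos :: 'n \<Rightarrow> nat)" by (rule injI) (simp add: pos_eq_iff)
  then show "card {1..CARD('n)} \<le> card (range (pos :: 'n \<Rightarrow> nat))" by (simp add: card_image)
qed simp

lemma pos_Max: "pos (Max UNIV :: 'n::{finite,linorder}) = CARD('n)"
proof -
  have "{..Max UNIV :: 'n} = UNIV" by auto
  then show ?thesis by (simp add: pos_def)
qed

lemma pos_less_CARD: "pos (i :: 'n::{finite,linorder}) < CARD('n) \<longleftrightarrow> i \<noteq> Max UNIV"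
  unfolding pos_Max[symmetric] pos_less_iff by (auto simp: less_le)

text \<open>Unspecified at the last index, whence the premise \<open>i \<noteq> Max UNIV\<close> in
  the lemmas that follow.\<close>

definition next_index :: "'n::{finite,linorder} \<Rightarrow> 'n" where "next_index i = (THE j. pos j = pos i + 1)"

lemma pos_next_index:
  assumes "i \<noteq> Max UNIV"
  shows "pos (next_index i) = pos (i :: 'n::{finite,linorder}) + 1"
proof -
  have "pos i + 1 \<in> {1..CARD('n)}" using assms pos_less_CARD[of i] by auto
  then obtain j :: 'n where "pos j = pos i + 1" unfolding range_pos[symmetric] by auto
  then show ?thesis unfolding next_index_def by (rule theI) (simp add: pos_eq_iff[symmetric] \<open>pos j = pos i + 1\<close>)
qed

lemma next_index_adjacent:
  assumes "i \<noteq> Max UNIV"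
  shows "i < next_index i" "l \<noteq> i \<Longrightarrow> l \<noteq> next_index i \<Longrightarrow> l < i \<longleftrightarrow> l < (next_index i :: 'n::{finite,linorder})"
proof -
  show "i < next_index i" unfolding pos_less_iff[symmetric] pos_next_index[OF assms] by simp
  assume "l \<noteq> i" "l \<noteq> next_index i"
  then show "l < i \<longleftrightarrow> l < next_index i"
    using pos_less_iff[of l i] pos_less_iff[of l "next_index i"] pos_eq_iff[of l i] pos_eq_iff[of l "next_index i"]
      pos_next_index[OF assms] by auto
qed

definition slots :: "'n::{finite,linorder} set" where "slots = {i. odd (pos i) \<and> i \<noteq> Max UNIV}"

text \<open>Oddness enters here: the last index has the odd position k, so it is not the successor
  of a slot and can serve as the single index.\<close>

lemma slot_structure_slots:
  assumes odd: "odd CARD('n)"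
  shows "slot_structure (slots :: 'n::{finite,linorder} set) next_index (Max UNIV)"
proof
  have nx: "pos (next_index i) = pos i + 1" if "i \<in> slots" for i :: 'n
    using that pos_next_index[of i] by (simp add: slots_def)
  show "inj_on next_index (slots :: 'n set)"
    by (rule inj_onI) (use nx in \<open>metis add_right_imp_eq pos_eq_iff\<close>)
  show "slots \<inter> next_index ` slots = ({} :: 'n set)" using nx by (auto simp: slots_def)
  show "(Max UNIV :: 'n) \<notin> slots" by (simp add: slots_def)
  show "(Max UNIV :: 'n) \<notin> next_index ` slots"
  proof
    assume "(Max UNIV :: 'n) \<in> next_index ` slots"
    then obtain i :: 'n where i: "i \<in> slots" "Max UNIV = next_index i" by auto
    then have "CARD('n) = pos i + 1" using nx[OF i(1)] pos_Max[where ?'n='n] by simp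
    then show False using odd i(1) by (simp add: slots_def)
  qed
  show "insert (Max UNIV) (slots \<union> next_index ` slots) = (UNIV :: 'n set)"
  proof -
    have "i \<in> next_index ` slots" if i: "i \<noteq> Max UNIV" "even (pos i)" for i :: 'n
    proof -
      have "pos i \<in> {1..CARD('n)}" unfolding range_pos[symmetric] by simp
      moreover have "pos i \<noteq> 1" using i(2) by auto
      ultimately have "pos i - 1 \<in> {1..CARD('n)}" by auto
      then obtain j :: 'n where "pos i - 1 = pos j" unfolding range_pos[symmetric] by auto
      then have j: "pos i = pos j + 1" using \<open>pos i \<in> {1..CARD('n)}\<close> by auto
      with i(2) have "odd (pos j)" by simp
      moreover have "pos j < CARD('n)" using j \<open>pos i \<in> {1..CARD('n)}\<close> by auto
      ultimately have "j \<in> slots" by (simp add: slots_def pos_less_CARD)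
      moreover from nx[OF this] j have "i = next_index j" using pos_eq_iff[of i "next_index j"] by simp
      ultimately show ?thesis by blast
    qed
    then show ?thesis by (auto simp: slots_def)
  qed
  show "i < next_index i" if "i \<in> slots" for i :: 'n using that next_index_adjacent[of i] by (simp add: slots_def)
  show "l < i \<longleftrightarrow> l < next_index i" if "i \<in> slots" "l \<noteq> i" "l \<noteq> next_index i" for i l :: 'n
    using that next_index_adjacent(2)[of i l] by (simp add: slots_def)
qed

lemma base_orth_eq: "base_orth = (\<lambda>i :: 'n::{finite,linorder}. basis_vec i - basis_vec (next_index i)) ` slots"
proof -
  have "pos j = pos i + 1 \<longleftrightarrow> i \<noteq> Max UNIV \<and> j = next_index i" for i j :: 'n
  proof
    assume "pos j = pos i + 1"
    moreover have "pos j \<in> {1..CARD('n)}" unfolding range_pos[symmetric] by simp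
    ultimately have "i \<noteq> Max UNIV" unfolding pos_less_CARD[symmetric] by auto
    with pos_next_index[OF this] \<open>pos j = pos i + 1\<close> show "i \<noteq> Max UNIV \<and> j = next_index i"
      using pos_eq_iff[of j "next_index i"] by simp
  qed (auto simp: pos_next_index)
  then show ?thesis unfolding base_orth_def slots_def by auto
qed

lemma basis_vec_diff_eq_iff:
  assumes "i \<noteq> (j :: 'n::finite)"
  shows "basis_vec i - basis_vec j = basis_vec k - basis_vec l \<longleftrightarrow> i = k \<and> j = l"
proof
  assume eq: "basis_vec i - basis_vec j = (basis_vec k - basis_vec l :: (real, 'n) vec)"
  have "(basis_vec k - basis_vec l :: (real, 'n) vec) $ i = 1" "(basis_vec k - basis_vec l :: (real, 'n) vec) $ j = - 1"
    using assms unfolding eq[symmetric] by (simp_all add: axis_def)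
  then show "i = k \<and> j = l" by (auto simp: axis_def split: if_splits)
qed simp

definition pair_roots :: "'n::{finite,linorder} set set \<Rightarrow> (real ^ 'n::{finite,linorder}) set" where
  "pair_roots m = {basis_vec i - basis_vec j | i j. {i, j} \<in> m \<and> i < j}"

lemma pair_roots_mem:
  "i < j \<Longrightarrow> basis_vec i - basis_vec j \<in> pair_roots m \<longleftrightarrow> {i, j :: 'n::{finite,linorder}} \<in> m"
  unfolding pair_roots_def using basis_vec_diff_eq_iff[of i j] by (auto simp: less_imp_neq)

lemma weyl_group_perm:
  assumes "w \<in> weyl_group"
  obtains p where "p \<in> perms" "\<And>i. w (basis_vec i) = basis_vec (p i :: 'n::{finite,linorder})"
    "w ` base_orth = (\<lambda>i. basis_vec (p i) - basis_vec (p (next_index i))) ` slots" "weyl_sign w = of_int (sign p)"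
proof -
  obtain p where w: "linear w" and p: "p permutes UNIV" "\<And>i. w (basis_vec i) = basis_vec (p i)"
    using assms unfolding weyl_group_def by auto
  have "matrix w $ i $ j = mat 1 $ i $ p j" for i j
  proof -
    have "matrix w $ i $ j = basis_vec (p j) $ i" by (simp add: matrix_def p(2))
    then show ?thesis by (simp add: mat_def axis_def)
  qed
  then have "matrix w = (\<chi> i j. mat 1 $ i $ p j)" by (simp add: vec_eq_iff)
  then have "weyl_sign w = of_int (sign p) * det (mat 1 :: ((real, 'n) vec, 'n) vec)"
    unfolding weyl_sign_def using det_permute_columns[OF p(1), of "mat 1 :: ((real, 'n) vec, 'n) vec"] by simp
  moreover have "w ` base_orth = (\<lambda>i. basis_vec (p i) - basis_vec (p (next_index i))) ` slots"
    unfolding base_orth_eq image_image by (simp add: linear_diff[OF w] p(2))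
  ultimately show ?thesis using that[of p] p by (simp add: perms_def)
qed

lemma perm_weyl_group:
  assumes "p \<in> perms"
  obtains w where "w \<in> weyl_group" "\<And>i. w (basis_vec i) = basis_vec (p i :: 'n::{finite,linorder})"
    "w ` base_orth = (\<lambda>i. basis_vec (p i) - basis_vec (p (next_index i))) ` slots"
proof -
  have p: "p permutes UNIV" using assms by (simp add: perms_def)
  define w :: "(real, 'n) vec \<Rightarrow> (real, 'n) vec" where "w y = (\<chi> i. y $ inv p i)" for y
  have lin: "linear w" by (rule linearI) (simp_all add: w_def vec_eq_iff)
  have basis: "w (basis_vec i) = basis_vec (p i)" for i
    using permutes_inv_eq[OF p] by (auto simp: w_def vec_eq_iff axis_def)
  have "w ` base_orth = (\<lambda>i. basis_vec (p i) - basis_vec (p (next_index i))) ` slots"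
    unfolding base_orth_eq image_image by (simp add: linear_diff[OF lin] basis)
  with lin basis p show ?thesis using that[of w] unfolding weyl_group_def by blast
qed

definition root_matrix :: "((real, 'n::{finite,linorder}) vec \<Rightarrow> real) \<Rightarrow> 'n \<Rightarrow> 'n \<Rightarrow> real" where
  "root_matrix d x y = (if x < y then d (basis_vec x - basis_vec y) else if y < x then - d (basis_vec y - basis_vec x) else 0)"

lemma root_matrix_antisym: "root_matrix d y x = - root_matrix d x y"
  by (auto simp: root_matrix_def)

context
  assumes odd_card: "odd CARD('n::{finite,linorder})"
begin

interpretation slot_structure "slots :: 'n set" next_index "Max UNIV" by (rule slot_structure_slots[OF odd_card])

lemma perm_slot_neq: "p \<in> perms \<Longrightarrow> i \<in> slots \<Longrightarrow> p i \<noteq> p (next_index i :: 'n)"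
  using inj_eq[OF perms_inj[of p]] by simp

lemma pair_roots_pairing_oriented:
  assumes p: "\<And>i. i \<in> slots \<Longrightarrow> p i < p (next_index i :: 'n)"
  shows "pair_roots (pairing p) = (\<lambda>i. basis_vec (p i) - basis_vec (p (next_index i))) ` slots"
  unfolding pair_roots_def pairing_def using p by (fastforce simp: doubleton_eq_iff dest: less_asym)

lemma inj_on_pair_roots: "inj_on pair_roots (pairing ` (perms :: ('n \<Rightarrow> 'n) set))"
proof -
  have "m \<subseteq> m'" if m: "m \<in> pairing ` (perms :: ('n \<Rightarrow> 'n) set)" and eq: "pair_roots m = pair_roots m'" for m m'
  proof
    fix e assume "e \<in> m"
    with m obtain \<pi> i where "\<pi> \<in> perms" "i \<in> slots" "e = {\<pi> i, \<pi> (next_index i)}" by (auto simp: pairing_def)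
    moreover from this have "\<pi> i \<noteq> \<pi> (next_index i)" by (intro perm_slot_neq)
    ultimately obtain a b where ab: "e = {a, b}" "a < b" by (metis insert_commute neqE)
    then have "basis_vec a - basis_vec b \<in> pair_roots m" using pair_roots_mem[OF ab(2)] \<open>e \<in> m\<close> by blast
    then show "e \<in> m'" unfolding eq pair_roots_mem[OF ab(2)] ab(1) .
  qed
  then show ?thesis by (intro inj_onI equalityI) metis+
qed

text \<open>Every pairing has exactly one orientation in which all its roots are positive, and an
  oriented pairing is the image of the base set under a permutation.\<close>

lemma orth_collection_eq: "orth_collection = pair_roots ` pairing ` (perms :: ('n \<Rightarrow> 'n) set)"
proof (intro equalityI subsetI)
  fix A :: "((real, 'n) vec) set" assume "A \<in> orth_collection"
  then obtain w where w: "w \<in> weyl_group" "A = w ` base_orth" "w ` base_orth \<subseteq> pos_roots"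
    unfolding orth_collection_def by auto
  obtain p where "p \<in> perms" "\<And>i. w (basis_vec i) = basis_vec (p i)"
    "w ` base_orth = (\<lambda>i. basis_vec (p i) - basis_vec (p (next_index i))) ` slots" "weyl_sign w = of_int (sign p)"
    by (rule weyl_group_perm[OF w(1)]) (rule that)
  note p = this(1,3)
  have "p i < p (next_index i)" if "i \<in> slots" for i
  proof -
    have "basis_vec (p i) - basis_vec (p (next_index i)) \<in> pos_roots" using w(3) p(2) that by blast
    then obtain a b where ab: "basis_vec (p i) - basis_vec (p (next_index i)) = basis_vec a - basis_vec b" "a < b"
      unfolding pos_roots_def by blast
    then show ?thesis unfolding basis_vec_diff_eq_iff[OF perm_slot_neq[OF p(1) that]] by simp
  qed
  from pair_roots_pairing_oriented[of p, OF this] have "A = pair_roots (pairing p)" using w(2) p(2) by simp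
  then show "A \<in> pair_roots ` pairing ` perms" using p(1) by blast
next
  fix A :: "((real, 'n) vec) set" assume "A \<in> pair_roots ` pairing ` perms"
  then obtain \<pi> where \<pi>: "\<pi> \<in> perms" "A = pair_roots (pairing \<pi>)" by blast
  obtain p where p: "p \<in> perms" "pairing p = pairing \<pi>" "\<And>i. i \<in> slots \<Longrightarrow> p i < p (next_index i)"
    using oriented_representative[OF \<pi>(1), of "(<)"] perm_slot_neq[OF \<pi>(1)] by (metis neqE)
  obtain w where "w \<in> weyl_group" "\<And>i. w (basis_vec i) = basis_vec (p i)"
    "w ` base_orth = (\<lambda>i. basis_vec (p i) - basis_vec (p (next_index i))) ` slots"
    by (rule perm_weyl_group[OF p(1)]) (rule that)
  note w = this(1,3)
  have "A = w ` base_orth" unfolding \<pi>(2) p(2)[symmetric] w(2) by (rule pair_roots_pairing_oriented) (rule p(3))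
  moreover have "w ` base_orth \<subseteq> pos_roots" unfolding w(2) pos_roots_def using p(3) by blast
  ultimately show "A \<in> orth_collection" unfolding orth_collection_def using w(1) by blast
qed

text \<open>The element chosen in \<open>orth_sign\<close> yields a permutation with the given
  pairing and increasing pairs, whose \<open>pf_term\<close> is its sign times the product over the
  roots. By \<open>pf_term_pairing\<close> every permutation with that pairing has the same
  term.\<close>

lemma orth_collection_sum:
  "fiber_card * (\<Sum>A\<in>orth_collection. orth_sign A * (\<Prod>\<beta>\<in>A. d \<beta>)) = pf_sum (root_matrix d)"
proof -
  let ?h = "\<lambda>m. orth_sign (pair_roots m) * (\<Prod>\<beta>\<in>pair_roots m. d \<beta>)"
  have "pf_term (root_matrix d) \<pi> = ?h (pairing \<pi>)" if \<pi>: "\<pi> \<in> perms" for \<pi>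
  proof -
    let ?A = "pair_roots (pairing \<pi>)"
    have A: "?A \<in> orth_collection" unfolding orth_collection_eq using \<pi> by blast
    define w where "w = (SOME w. w \<in> weyl_group \<and> w ` base_orth = ?A)"
    have "\<exists>w. w \<in> weyl_group \<and> w ` base_orth = ?A"
      using A unfolding orth_collection_def mem_Collect_eq
      by (elim exE conjE) (intro exI conjI, assumption, rule sym)
    from someI_ex[OF this] have w: "w \<in> weyl_group" "w ` base_orth = ?A" unfolding w_def[symmetric] by (rule conjunct1, rule conjunct2)
    obtain p where "p \<in> perms" "\<And>i. w (basis_vec i) = basis_vec (p i)"
      "w ` base_orth = (\<lambda>i. basis_vec (p i) - basis_vec (p (next_index i))) ` slots"
      "weyl_sign w = of_int (sign p)" by (rule weyl_group_perm[OF w(1)]) (rule that)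
    note p = this(1,3,4)
    have less: "p i < p (next_index i)" if "i \<in> slots" for i
    proof -
      have "basis_vec (p i) - basis_vec (p (next_index i)) \<in> ?A" using w(2) p(2) that by blast
      then obtain a b where ab: "basis_vec (p i) - basis_vec (p (next_index i)) = basis_vec a - basis_vec b" "a < b"
        unfolding pair_roots_def by blast
      then show ?thesis unfolding basis_vec_diff_eq_iff[OF perm_slot_neq[OF p(1) that]] by simp
    qed
    have "pair_roots (pairing p) = ?A" using pair_roots_pairing_oriented[of p, OF less] p(2) w(2) by simp
    then have "pairing p = pairing \<pi>" using inj_on_pair_roots p(1) \<pi> by (auto dest: inj_onD)
    then have "pf_term (root_matrix d) \<pi> = pf_term (root_matrix d) p"
      by (intro pf_term_pairing[symmetric, OF root_matrix_antisym]) (use p(1) \<pi> in auto)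
    also have "\<dots> = of_int (sign p) * (\<Prod>i\<in>slots. d (basis_vec (p i) - basis_vec (p (next_index i))))"
      using less by (simp add: pf_term_def root_matrix_def)
    also have "(\<Prod>i\<in>slots. d (basis_vec (p i) - basis_vec (p (next_index i)))) = (\<Prod>\<beta>\<in>?A. d \<beta>)"
    proof -
      have inj: "inj_on (\<lambda>i. basis_vec (p i) - basis_vec (p (next_index i)) :: (real, 'n) vec) slots"
      proof (rule inj_onI)
        fix i j assume "i \<in> slots" "basis_vec (p i) - basis_vec (p (next_index i)) = (basis_vec (p j) - basis_vec (p (next_index j)) :: (real, 'n) vec)"
        then have "p i = p j" using basis_vec_diff_eq_iff[OF perm_slot_neq[OF p(1)]] by blast
        then show "i = j" unfolding inj_eq[OF perms_inj[OF p(1)]] .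
      qed
      show ?thesis unfolding w(2)[symmetric] p(2) by (simp add: prod.reindex[OF inj])
    qed
    also have "of_int (sign p) = orth_sign ?A" unfolding orth_sign_def w_def[symmetric] p(3) ..
    finally show ?thesis .
  qed
  then have "pf_sum (root_matrix d) = fiber_card * (\<Sum>m\<in>pairing ` perms. ?h m)" by (rule pf_sum_by_pairing)
  also have "(\<Sum>m\<in>pairing ` perms. ?h m) = (\<Sum>A\<in>orth_collection. orth_sign A * (\<Prod>\<beta>\<in>A. d \<beta>))"
    unfolding orth_collection_eq by (simp add: sum.reindex[OF inj_on_pair_roots])
  finally show ?thesis by simp
qed

lemma orth_collection_props:
  fixes A :: "((real, 'n) vec) set"
  assumes "A \<in> orth_collection" "3 \<le> CARD('n)"
  shows "finite A" "A \<noteq> {}" "A \<subseteq> pos_roots" "\<And>\<beta> \<gamma>. \<beta> \<in> A \<Longrightarrow> \<gamma> \<in> A \<Longrightarrow> \<beta> \<noteq> \<gamma> \<Longrightarrow> \<beta> \<bullet> \<gamma> = (0 :: real)"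
proof -
  obtain w where w: "w \<in> weyl_group" "A = w ` base_orth" "w ` base_orth \<subseteq> pos_roots"
    using assms(1) unfolding orth_collection_def by auto
  obtain p where "p \<in> perms" "\<And>i. w (basis_vec i) = basis_vec (p i)"
    "w ` base_orth = (\<lambda>i. basis_vec (p i) - basis_vec (p (next_index i))) ` slots" "weyl_sign w = of_int (sign p)"
    by (rule weyl_group_perm[OF w(1)]) (rule that)
  note p = this(1,3)
  show "finite A" "A \<subseteq> pos_roots" using w p(2) by auto
  have "1 \<in> {1..CARD('n)}" using assms(2) by simp
  then obtain i :: 'n where "pos i = 1" unfolding range_pos[symmetric] by auto
  then have "pos i < CARD('n)" "odd (pos i)" using assms(2) by simp_all
  then have "i \<in> slots" unfolding slots_def pos_less_CARD by simp
  then have "slots \<noteq> ({} :: 'n set)" by auto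
  then show "A \<noteq> {}" unfolding w(2) p(2) by simp
  fix \<beta> \<gamma> assume \<beta>: "\<beta> \<in> A" and \<gamma>: "\<gamma> \<in> A" and neq: "\<beta> \<noteq> \<gamma>"
  obtain i where i: "i \<in> slots" "\<beta> = basis_vec (p i) - basis_vec (p (next_index i))"
    using \<beta>[unfolded w(2) p(2) image_iff] by (elim bexE) (rule that)
  obtain j where j: "j \<in> slots" "\<gamma> = basis_vec (p j) - basis_vec (p (next_index j))"
    using \<gamma>[unfolded w(2) p(2) image_iff] by (elim bexE) (rule that)
  have "i \<noteq> j" using neq i(2) j(2) by auto
  note ij = i(1) j(1) this i(2) j(2)
  show "\<beta> \<bullet> \<gamma> = 0"
    unfolding ij(4,5) inner_diff_left inner_diff_right inner_axis_axis
    using ij(1-3) by (simp add: inj_eq[OF perms_inj[OF p(1)]])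
qed

end

section \<open>Exit from the alcove\<close>

text \<open>The facets of the alcove: the simple roots at level 0 and the highest root at level
  1.\<close>

definition walls :: "((real, 'n::{finite,linorder}) vec \<times> real) set" where
  "walls = insert (basis_vec (Min UNIV) - basis_vec (Max UNIV), 1)
    ((\<lambda>i. (basis_vec i - basis_vec (next_index i), 0)) ` {i. i \<noteq> Max UNIV})"

lemma finite_walls: "finite walls"
  by (simp add: walls_def)

lemma chain_decreasing:
  fixes y :: "(real, 'n::{finite,linorder}) vec"
  assumes step: "\<And>i. i \<noteq> Max UNIV \<Longrightarrow> y $ next_index i < y $ i"
  shows "i < j \<Longrightarrow> y $ j < y $ i"
proof (induction "pos j - pos i" arbitrary: i rule: less_induct)
  case less
  then have i: "i \<noteq> Max UNIV" using Max_ge[of UNIV j] by auto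
  have "pos i < pos j" using less(2) by (simp add: pos_less_iff)
  show ?case
  proof (cases "next_index i = j")
    case True
    then show ?thesis using step[OF i] by simp
  next
    case False
    then have "pos (next_index i) \<noteq> pos j" by (simp add: pos_eq_iff)
    with \<open>pos i < pos j\<close> have "pos (next_index i) < pos j" "pos j - pos (next_index i) < pos j - pos i"
      unfolding pos_next_index[OF i] by auto
    then have "y $ j < y $ next_index i" using less(1)[of "next_index i"] by (simp add: pos_less_iff)
    then show ?thesis using step[OF i] by simp
  qed
qed

text \<open>The factor \<open>1 - 2 * m\<close> is 1 at level 0 and -1 at level 1, so both kinds of
  inequality become positivity of one signed distance.\<close>

lemma alcove_iff_walls:
  "y \<in> alcove V \<longleftrightarrow> y \<in> V \<and> (\<forall>(\<beta>, m)\<in>walls. 0 < (1 - 2 * m) * (y \<bullet> \<beta> - m))"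
proof -
  have "(\<forall>i j. i < j \<longrightarrow> y $ j < y $ i) \<longleftrightarrow> (\<forall>i. i \<noteq> Max UNIV \<longrightarrow> y $ next_index i < y $ i)"
    using chain_decreasing[of y] next_index_adjacent(1) by blast
  then show ?thesis by (auto simp: alcove_def walls_def inner_diff_right)
qed

lemma alcove_strip:
  assumes y: "y \<in> alcove V" and ij: "i < j"
  shows "0 < y \<bullet> (basis_vec i - basis_vec j)" "y \<bullet> (basis_vec i - basis_vec j) < 1"
proof -
  have dec: "y $ b < y $ a" if "a < b" for a b using y that by (auto simp: alcove_def)
  have "Min UNIV \<le> i" "j \<le> Max UNIV" by simp_all
  then have "Min UNIV = i \<or> Min UNIV < i" "j = Max UNIV \<or> j < Max UNIV" by (auto simp only: le_less)
  then have "y $ i \<le> y $ Min UNIV" "y $ Max UNIV \<le> y $ j"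
    using dec[of "Min UNIV" i] dec[of j "Max UNIV"] by (auto simp: less_imp_le)
  moreover have "y $ Min UNIV < 1 + y $ Max UNIV" using y by (auto simp: alcove_def)
  ultimately show "y \<bullet> (basis_vec i - basis_vec j) < 1" by (simp add: inner_diff_right)
  show "0 < y \<bullet> (basis_vec i - basis_vec j)" using dec[OF ij] by (simp add: inner_diff_right)
qed

lemma alcove_not_integer:
  assumes y: "y \<in> alcove V" and ij: "i \<noteq> j" and m: "m \<in> \<int>"
  shows "y \<bullet> (basis_vec i - basis_vec j) \<noteq> m"
proof -
  obtain k where k: "m = of_int k" using m by (auto elim: Ints_cases)
  show ?thesis
  proof (cases "i < j")
    case True
    then show ?thesis using alcove_strip[OF y True] k by auto
  next
    case False
    then have "j < i" using ij by auto
    from alcove_strip[OF y this] have "y \<bullet> (basis_vec i - basis_vec j) < 0" "- 1 < y \<bullet> (basis_vec i - basis_vec j)"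
      by (simp_all add: inner_diff_right)
    then show ?thesis using k by auto
  qed
qed

text \<open>In coordinates the reflection exchanges the entries \<open>a\<close> and
  \<open>b\<close>, then adds \<open>m\<close> at \<open>a\<close> and subtracts it at
  \<open>b\<close>.\<close>

lemma reflect_at_root_inner:
  assumes "a \<noteq> b"
  defines "\<sigma> \<equiv> swap a b"
  shows "reflect_at (basis_vec a - basis_vec b) m y \<bullet> (basis_vec i - basis_vec j) =
    y \<bullet> (basis_vec (\<sigma> i) - basis_vec (\<sigma> j)) + m * ((basis_vec a - basis_vec b :: (real, 'n::{finite,linorder}) vec) $ i - (basis_vec a - basis_vec b :: (real, 'n) vec) $ j)"
proof -
  define \<beta> :: "(real, 'n) vec" where "\<beta> = basis_vec a - basis_vec b"
  have \<beta>: "\<beta> $ l = (if l = a then 1 else 0) - (if l = b then 1 else 0)" for l by (simp add: \<beta>_def axis_def)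
  have y\<beta>: "y \<bullet> \<beta> = y $ a - y $ b" by (simp add: \<beta>_def inner_diff_right)
  have "reflect_at \<beta> m y $ l = y $ \<sigma> l + m * \<beta> $ l" for l
    using assms(1) unfolding reflect_at_def y\<beta> \<sigma>_def
    by (simp add: \<beta> Transposition.transpose_def algebra_simps)
  then show ?thesis unfolding \<beta>_def[symmetric] by (simp add: inner_diff_right algebra_simps)
qed

lemma rootsI: "i \<noteq> j \<Longrightarrow> basis_vec i - basis_vec j \<in> roots"
  unfolding roots_def by blast

lemma walls_cases:
  assumes "(\<beta>, m) \<in> walls"
  obtains a where "a \<noteq> Max UNIV" "\<beta> = basis_vec a - basis_vec (next_index a)" "m = 0"
  | "\<beta> = basis_vec (Min UNIV) - basis_vec (Max UNIV)" "m = 1"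
  using assms unfolding walls_def by auto

lemma walls_root:
  assumes "(\<beta>, m) \<in> walls" "2 \<le> CARD('n)"
  obtains a b :: "'n::{finite,linorder}" where "a < b" "\<beta> = basis_vec a - basis_vec b" "m \<in> {0, 1}" "m \<in> \<int>" "\<beta> \<in> roots"
proof -
  have "(Min UNIV :: 'n) < Max UNIV"
  proof (rule ccontr)
    assume "\<not> ?thesis"
    then have "(Max UNIV :: 'n) \<le> Min UNIV" by (simp only: not_less)
    moreover have "Min UNIV \<le> a" "a \<le> Max UNIV" for a :: 'n by simp_all
    ultimately have "a = Min UNIV" for a :: 'n by (metis order_trans antisym)
    then have "(UNIV :: 'n set) \<subseteq> {Min UNIV}" by blast
    from card_mono[OF _ this] assms(2) show False by simp
  qed
  note min_max = this
  show ?thesis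
  proof (rule walls_cases[OF assms(1)])
    fix a assume "a \<noteq> Max UNIV" "\<beta> = basis_vec a - basis_vec (next_index a)" "m = 0"
    then show ?thesis
      using that[of a "next_index a"] next_index_adjacent(1)[of a] by (simp add: rootsI less_imp_neq)
  next
    assume "\<beta> = basis_vec (Min UNIV) - basis_vec (Max UNIV)" "m = 1"
    then show ?thesis
      using that[of "Min UNIV" "Max UNIV"] min_max by (simp add: rootsI less_imp_neq)
  qed
qed

context reflectable_process
begin

lemma in_alcove_iff_no_hits:
  assumes \<omega>: "good \<omega>" and x: "x \<in> alcove V" and t: "0 \<le> t"
  shows "(\<forall>s\<in>{0..t}. path \<omega> s \<in> alcove V) \<longleftrightarrow> (\<forall>(\<beta>, m)\<in>walls. \<not> hits t \<beta> m (path \<omega>))"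
proof
  assume "\<forall>s\<in>{0..t}. path \<omega> s \<in> alcove V"
  then show "\<forall>(\<beta>, m)\<in>walls. \<not> hits t \<beta> m (path \<omega>)" unfolding alcove_iff_walls hits_def by fastforce
next
  assume no: "\<forall>(\<beta>, m)\<in>walls. \<not> hits t \<beta> m (path \<omega>)"
  show "\<forall>s\<in>{0..t}. path \<omega> s \<in> alcove V"
    unfolding alcove_iff_walls
  proof (intro ballI conjI)
    fix s assume s: "s \<in> {0..t}"
    show "path \<omega> s \<in> V" using X_in_V[of s \<omega>] \<omega> s by (simp add: path_def good_def)
    fix g :: "(real, 'n) vec \<times> real" assume "g \<in> walls"
    then obtain \<beta> m where g: "g = (\<beta>, m)" "(\<beta>, m) \<in> walls" by (cases g) auto
    let ?f = "\<lambda>u. (1 - 2 * m) * (path \<omega> u \<bullet> \<beta> - m)"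
    have cont: "continuous_on {0..s} ?f"
    proof -
      have "continuous_on {0..s} (path \<omega>)"
        using \<omega> continuous_on_subset[of "{0..}" "path \<omega>" "{0..s}"] by (simp add: good_def)
      then show ?thesis by (intro continuous_intros)
    qed
    have f0: "0 < ?f 0" using x g(2) \<omega> unfolding alcove_iff_walls by (auto simp: good_def)
    have "0 < ?f s"
    proof (rule ccontr)
      assume "\<not> 0 < ?f s"
      then obtain r where r: "0 \<le> r" "r \<le> s" "?f r = 0" using IVT2'[of ?f s 0 0] cont f0 s by auto
      have "m = 0 \<or> m = 1" using g(2) by (auto simp: walls_def)
      with r(3) have "path \<omega> r \<bullet> \<beta> = m" by auto
      then have "hits t \<beta> m (path \<omega>)" unfolding hits_def using r s by auto
      with no g(2) show False by auto
    qed
    then show "case g of (\<beta>, m) \<Rightarrow> 0 < (1 - 2 * m) * (path \<omega> s \<bullet> \<beta> - m)" by (simp add: g)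
  qed
qed

text \<open>The strict inequality needs a margin beyond \<open>t\<close>: the finitely many wall
  times all exceed \<open>t\<close>, hence so does their minimum, which bounds the exit time from
  below.\<close>

lemma exit_time_gt_iff:
  assumes \<omega>: "good \<omega>" and x: "x \<in> alcove V" and t: "0 \<le> t"
  shows "ennreal t < exit_time X (alcove V) \<omega> \<longleftrightarrow> (\<forall>(\<beta>, m)\<in>walls. \<not> hits t \<beta> m (path \<omega>))"
proof
  assume gt: "ennreal t < exit_time X (alcove V) \<omega>"
  have "path \<omega> s \<in> alcove V" if s: "s \<in> {0..t}" for s
  proof (rule ccontr)
    assume "path \<omega> s \<notin> alcove V"
    then have "exit_time X (alcove V) \<omega> \<le> ennreal s"
      unfolding exit_time_def using s by (intro INF_lower) (auto simp: path_def)
    moreover have "ennreal s \<le> ennreal t" using s by (intro ennreal_leI) simp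
    ultimately show False using gt by simp
  qed
  then show "\<forall>(\<beta>, m)\<in>walls. \<not> hits t \<beta> m (path \<omega>)" using in_alcove_iff_no_hits[OF assms] by simp
next
  have p: "continuous_on {0..} (path \<omega>)" using \<omega> by (simp add: good_def)
  assume no: "\<forall>(\<beta>, m)\<in>walls. \<not> hits t \<beta> m (path \<omega>)"
  define W where "W = (\<lambda>g. case_prod wall_time g (path \<omega>)) ` walls"
  have W: "finite W" "W \<noteq> {}" unfolding W_def using finite_walls by (auto simp: walls_def)
  have "ennreal t < Min W"
    unfolding Min_gr_iff[OF W] using no wall_time_le_iff[OF p t] by (auto simp: W_def not_le[symmetric])
  also have "Min W \<le> exit_time X (alcove V) \<omega>"
    unfolding exit_time_def
  proof (rule INF_greatest)
    fix s assume "s \<in> {s. 0 \<le> s \<and> X s \<omega> \<notin> alcove V}"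
    then have s: "0 \<le> s" "path \<omega> s \<notin> alcove V" by (auto simp: path_def)
    then obtain \<beta> m where g: "(\<beta>, m) \<in> walls" "hits s \<beta> m (path \<omega>)"
      using in_alcove_iff_no_hits[OF \<omega> x s(1)] by force
    then have "wall_time \<beta> m (path \<omega>) \<le> ennreal s" using wall_time_le_iff[OF p s(1)] by simp
    moreover have "wall_time \<beta> m (path \<omega>) \<in> W" unfolding W_def using g(1) by force
    then have "Min W \<le> wall_time \<beta> m (path \<omega>)" using W(1) by simp
    ultimately show "Min W \<le> ennreal s" by simp
  qed
  finally show "ennreal t < exit_time X (alcove V) \<omega>" .
qed

lemma hit_time_gt_iff:
  assumes \<omega>: "good \<omega>" and t: "0 \<le> t"
  shows "ennreal t < hit_time X \<beta> v \<omega> \<longleftrightarrow> \<not> hits t \<beta> (v \<bullet> \<beta>) (path \<omega>)"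
proof
  assume gt: "ennreal t < hit_time X \<beta> v \<omega>"
  show "\<not> hits t \<beta> (v \<bullet> \<beta>) (path \<omega>)"
  proof
    assume "hits t \<beta> (v \<bullet> \<beta>) (path \<omega>)"
    then obtain s where s: "0 \<le> s" "s \<le> t" "X s \<omega> \<bullet> \<beta> = v \<bullet> \<beta>" by (auto simp: hits_def path_def)
    then have "hit_time X \<beta> v \<omega> \<le> ennreal s" unfolding hit_time_def by (intro INF_lower) auto
    moreover have "ennreal s \<le> ennreal t" using s by (intro ennreal_leI) simp
    ultimately show False using gt by simp
  qed
next
  have p: "continuous_on {0..} (path \<omega>)" using \<omega> by (simp add: good_def)
  assume "\<not> hits t \<beta> (v \<bullet> \<beta>) (path \<omega>)"
  then have "ennreal t < wall_time \<beta> (v \<bullet> \<beta>) (path \<omega>)" using wall_time_le_iff[OF p t] by (simp add: not_le[symmetric])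
  also have "\<dots> \<le> hit_time X \<beta> v \<omega>"
    unfolding hit_time_def
  proof (rule INF_greatest)
    fix s assume "s \<in> {t. 0 \<le> t \<and> X t \<omega> \<bullet> \<beta> = v \<bullet> \<beta>}"
    then show "wall_time \<beta> (v \<bullet> \<beta>) (path \<omega>) \<le> ennreal s" by (subst wall_time_le_iff[OF p]) (auto simp: hits_def path_def)
  qed
  finally show "ennreal t < hit_time X \<beta> v \<omega>" .
qed

lemma hit_time_set_gt_iff:
  assumes "good \<omega>" "0 \<le> t" "finite A" "A \<noteq> {}"
  shows "ennreal t < hit_time_set X A v \<omega> \<longleftrightarrow> (\<forall>\<beta>\<in>A. \<not> hits t \<beta> (v \<bullet> \<beta>) (path \<omega>))"
  unfolding hit_time_set_def using assms by (subst Min_gr_iff) (auto simp: hit_time_gt_iff)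

definition wall_rank :: "(real, 'n) vec \<times> real \<Rightarrow> nat" where
  "wall_rank = (SOME f. inj_on f walls)"

lemma inj_on_wall_rank: "inj_on wall_rank walls"
proof -
  have "\<exists>f :: (real, 'n) vec \<times> real \<Rightarrow> nat. inj_on f walls" using finite_imp_inj_to_nat_seg[OF finite_walls] by blast
  from someI_ex[OF this] show ?thesis unfolding wall_rank_def .
qed

text \<open>If several walls are hit simultaneously, the one of least rank counts.\<close>

definition exit_through :: "(real, 'n) vec \<times> real \<Rightarrow> 'w \<Rightarrow> ennreal" where
  "exit_through g = first_at g {h\<in>walls. wall_rank h < wall_rank g} {h\<in>walls. wall_rank g < wall_rank h}"

lemma exit_through_finite:
  assumes "exit_through g \<omega> < \<infinity>"
  shows "exit_through g \<omega> = case_prod wall_time g (path \<omega>)"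
    and "h \<in> walls \<Longrightarrow> wall_rank h < wall_rank g \<Longrightarrow> case_prod wall_time g (path \<omega>) < case_prod wall_time h (path \<omega>)"
    and "g \<in> walls \<Longrightarrow> h \<in> walls \<Longrightarrow> case_prod wall_time g (path \<omega>) \<le> case_prod wall_time h (path \<omega>)"
proof -
  let ?t = "\<lambda>g. case_prod wall_time g (path \<omega>)"
  have c: "(\<forall>h\<in>{h\<in>walls. wall_rank h < wall_rank g}. ?t g < ?t h) \<and> (\<forall>h\<in>{h\<in>walls. wall_rank g < wall_rank h}. ?t g \<le> ?t h)"
    (is ?c)
  proof (rule ccontr)
    assume "\<not> ?c"
    then have "exit_through g \<omega> = \<infinity>" unfolding exit_through_def first_at_def by (rule if_not_P)
    with assms show False by simp
  qed
  then show "exit_through g \<omega> = ?t g" unfolding exit_through_def first_at_def by (rule if_P)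
  show lt: "?t g < ?t h" if "h \<in> walls" "wall_rank h < wall_rank g" for h using c that by blast
  assume gh: "g \<in> walls" "h \<in> walls"
  show "?t g \<le> ?t h"
  proof (cases "wall_rank h = wall_rank g")
    case True
    then have "h = g" using inj_onD[OF inj_on_wall_rank True gh(2,1)] by simp
    then show ?thesis by simp
  next
    case False
    then consider "wall_rank h < wall_rank g" | "wall_rank g < wall_rank h" by linarith
    then show ?thesis
    proof cases
      case 1
      then show ?thesis using lt[OF gh(2)] by (intro less_imp_le)
    next
      case 2
      then show ?thesis using c gh(2) by blast
    qed
  qed
qed

text \<open>Either no wall is hit up to \<open>t\<close>, or exactly one of the walls hit first has
  least rank.\<close>

lemma exit_partition:
  assumes \<omega>: "good \<omega>" and t: "0 \<le> t"
  shows "of_bool (\<forall>(\<beta>, m)\<in>walls. \<not> hits t \<beta> m (path \<omega>)) + (\<Sum>g\<in>walls. of_bool (exit_through g \<omega> \<le> ennreal t)) = (1::real)"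
proof -
  have p: "continuous_on {0..} (path \<omega>)" using \<omega> by (simp add: good_def)
  let ?t = "\<lambda>g. case_prod wall_time g (path \<omega>)"
  have fin: "exit_through g \<omega> < \<infinity>" if "exit_through g \<omega> \<le> ennreal t" for g
    using le_less_trans[OF that, of \<infinity>] by simp
  have hits_iff: "hits t \<beta> m (path \<omega>) \<longleftrightarrow> ?t (\<beta>, m) \<le> ennreal t" for \<beta> m using wall_time_le_iff[OF p t] by simp
  show ?thesis
  proof (cases "\<forall>(\<beta>, m)\<in>walls. \<not> hits t \<beta> m (path \<omega>)")
    case True
    have "\<not> exit_through g \<omega> \<le> ennreal t" if "g \<in> walls" for g
    proof
      assume le: "exit_through g \<omega> \<le> ennreal t"
      then have "?t g \<le> ennreal t" using exit_through_finite(1)[OF fin[OF le]] by simp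
      then have "hits t (fst g) (snd g) (path \<omega>)" using hits_iff[of "fst g" "snd g"] by simp
      then show False using True that by (cases g) auto
    qed
    then have "(\<Sum>g\<in>walls. of_bool (exit_through g \<omega> \<le> ennreal t)) = (0::real)" by simp
    with True show ?thesis by simp
  next
    case False
    then obtain h where h: "h \<in> walls" "?t h \<le> ennreal t" using hits_iff by force
    define m where "m = Min (?t ` walls)"
    have m: "m \<in> ?t ` walls" unfolding m_def using h(1) finite_walls by (intro Min_in) auto
    have m_le: "m \<le> ?t g" if "g \<in> walls" for g unfolding m_def using that finite_walls by (intro Min_le) auto
    define R where "R = wall_rank ` {g\<in>walls. ?t g = m}"
    have "finite {g\<in>walls. ?t g = m}" by (rule finite_subset[OF _ finite_walls]) blast
    then have "finite R" unfolding R_def by (rule finite_imageI)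
    moreover have "R \<noteq> {}" unfolding R_def using m by blast
    ultimately have "finite R" "R \<noteq> {}" .
    then have "Min R \<in> R" by (rule Min_in)
    then obtain g where g: "g \<in> walls" "?t g = m" "wall_rank g = Min R" unfolding R_def by auto
    have "?t g < ?t h" if "h \<in> walls" "wall_rank h < wall_rank g" for h
    proof -
      have "?t h \<noteq> m"
      proof
        assume "?t h = m"
        then have "Min R \<le> wall_rank h" using \<open>finite R\<close> that(1) by (intro Min_le) (auto simp: R_def)
        then show False using that(2) g(3) by simp
      qed
      then show ?thesis using m_le[OF that(1)] g(2) by simp
    qed
    moreover have "?t g \<le> ?t h" if "h \<in> walls" for h using m_le[OF that] g(2) by simp
    ultimately have "exit_through g \<omega> = ?t g" unfolding exit_through_def first_at_def by (intro if_P) blast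
    then have le: "exit_through g \<omega> \<le> ennreal t" using m_le[OF h(1)] h(2) g(2) by simp
    have uniq: "exit_through h \<omega> \<le> ennreal t \<longleftrightarrow> h = g" if hw: "h \<in> walls" for h
    proof
      assume leh: "exit_through h \<omega> \<le> ennreal t"
      note eh = exit_through_finite[OF fin[OF leh]] and eg = exit_through_finite[OF fin[OF le]]
      have "\<not> wall_rank h < wall_rank g" using eg(2)[OF hw] eh(3)[OF hw g(1)] by auto
      moreover have "\<not> wall_rank g < wall_rank h" using eh(2)[OF g(1)] eg(3)[OF g(1) hw] by auto
      ultimately have "wall_rank h = wall_rank g" by simp
      then show "h = g" using inj_onD[OF inj_on_wall_rank _ hw g(1)] by simp
    qed (simp add: le)
    have "(\<Sum>h\<in>walls. of_bool (exit_through h \<omega> \<le> ennreal t)) = (\<Sum>h\<in>walls. if h = g then 1 else (0::real))"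
      using uniq by (intro sum.cong) (auto simp: of_bool_def)
    then have "(\<Sum>h\<in>walls. of_bool (exit_through h \<omega> \<le> ennreal t)) = (1::real)" using g(1) by (simp add: finite_walls)
    with False show ?thesis by simp
  qed
qed

lemma alcove_before_exit:
  assumes \<omega>: "good \<omega>" and x: "x \<in> alcove V" and g: "g \<in> walls" and s: "exit_through g \<omega> = ennreal s" "0 \<le> s"
    and u: "0 \<le> u" "u < s"
  shows "path \<omega> u \<in> alcove V"
proof -
  have p: "continuous_on {0..} (path \<omega>)" using \<omega> by (simp add: good_def)
  have fin: "exit_through g \<omega> < \<infinity>" using s by simp
  have "\<not> hits u \<beta> m (path \<omega>)" if "(\<beta>, m) \<in> walls" for \<beta> m
  proof -
    have "ennreal u < ennreal s" using u by (simp add: ennreal_less_iff)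
    also have "\<dots> \<le> wall_time \<beta> m (path \<omega>)" using exit_through_finite(1,3)[OF fin] g that s(1) by (metis case_prod_conv)
    finally show ?thesis using wall_time_le_iff[OF p u(1)] by (simp add: not_le[symmetric])
  qed
  then have "\<forall>s\<in>{0..u}. path \<omega> s \<in> alcove V" using in_alcove_iff_no_hits[OF \<omega> x u(1)] by auto
  then show ?thesis using u by simp
qed

end

section \<open>Reflection at the exit wall\<close>

lemma exits_uminus: "exits t (basis_vec i - basis_vec j) p q w \<longleftrightarrow> exits t (basis_vec j - basis_vec i) (- p) (- q) w"
proof -
  have "y \<bullet> (basis_vec i - basis_vec j) = r \<longleftrightarrow> y \<bullet> (basis_vec j - basis_vec i) = - r" for y :: "(real, 'a) vec" and r
    by (auto simp: inner_diff_right)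
  then show ?thesis unfolding exits_def by simp
qed

text \<open>In terms of roots: a simple reflection permutes the positive roots other than its
  own.\<close>

lemma next_index_transpose_mono:
  fixes a :: "'n::{finite,linorder}"
  assumes "a \<noteq> Max UNIV" "x < y" "\<not> (x = a \<and> y = next_index a)"
  shows "swap a (next_index a) x < swap a (next_index a) y"
proof -
  have adj: "l < a \<longleftrightarrow> l < next_index a" "a < l \<longleftrightarrow> next_index a < l" if "l \<noteq> a" "l \<noteq> next_index a" for l
    using next_index_adjacent(2)[OF assms(1) that] that by (auto simp: not_less_iff_gr_or_eq)
  have less: "a < next_index a" by (rule next_index_adjacent(1)[OF assms(1)])
  consider "x = a" | "x = next_index a" | "x \<noteq> a" "x \<noteq> next_index a" by blast
  then show ?thesis
  proof cases
    case 1
    then have "y \<noteq> a" "y \<noteq> next_index a" using assms by auto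
    then show ?thesis using 1 adj(2) assms(2) by simp
  next
    case 2
    then have "a < y" using less assms(2) by simp
    then show ?thesis using 2 assms(2) by auto
  next
    case 3
    consider "y = a" | "y = next_index a" | "y \<noteq> a" "y \<noteq> next_index a" by blast
    then show ?thesis
    proof cases
      case 1
      then have "x < next_index a" using less assms(2) by simp
      then show ?thesis using 1 3 by simp
    next
      case 2
      then have "x < a" using adj(1)[OF 3] assms(2) by blast
      then show ?thesis using 2 3 by simp
    qed (use 3 assms(2) in simp)
  qed
qed

definition exit_matrix :: "real \<Rightarrow> (real \<Rightarrow> (real, 'n::{finite,linorder}) vec) \<Rightarrow> 'n \<Rightarrow> 'n \<Rightarrow> real" where
  "exit_matrix t p = root_matrix (\<lambda>\<beta>. 1 + exit_sign t \<beta> p)"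

lemma exit_matrix_less: "x < y \<Longrightarrow> exit_matrix t p x y = 1 + exit_sign t (basis_vec x - basis_vec y) p"
  and exit_matrix_greater: "y < x \<Longrightarrow> exit_matrix t p x y = - 1 - exit_sign t (basis_vec y - basis_vec x) p"
  and exit_matrix_diag: "exit_matrix t p x x = 0"
  by (auto simp: exit_matrix_def root_matrix_def)

lemma exit_matrix_antisym: "exit_matrix t p y x = - exit_matrix t p x y"
  unfolding exit_matrix_def by (rule root_matrix_antisym)

context reflectable_process
begin

context
  fixes \<beta> :: "(real, 'n) vec" and m t s :: real and \<omega> :: 'w and a b :: 'n
  assumes \<omega>: "good \<omega>" and x: "x \<in> alcove V" and g: "(\<beta>, m) \<in> walls" and t: "0 \<le> t"
    and ab: "\<beta> = basis_vec a - basis_vec b" "a < b" and m: "m \<in> {0, 1}"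
    and s: "exit_through (\<beta>, m) \<omega> = ennreal s" "0 \<le> s" "s \<le> t"
begin

abbreviation "Y \<equiv> reflect_from (exit_through (\<beta>, m)) (reflect_at \<beta> m) \<omega>"

abbreviation "\<sigma> \<equiv> swap a b"

lemma m_int: "m \<in> \<int>"
  using m by auto

lemma before_exit: "0 \<le> u \<Longrightarrow> u < s \<Longrightarrow> path \<omega> u \<in> alcove V"
  by (rule alcove_before_exit[OF \<omega> x g s(1,2)])

lemma at_exit: "path \<omega> s \<bullet> \<beta> = m"
proof -
  have "exit_through (\<beta>, m) \<omega> < \<infinity>" using s(1) by simp
  then have "X (enn2real (exit_through (\<beta>, m) \<omega>)) \<omega> \<bullet> \<beta> = m"
    unfolding exit_through_def by (rule first_at_attained[OF \<omega>])
  then show ?thesis using s by (simp add: path_def)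
qed

lemma Y_eq: "0 \<le> u \<Longrightarrow> Y u = (if s \<le> u then reflect_at \<beta> m (path \<omega> u) else path \<omega> u)"
  using reflect_from_first_at[of \<omega> "exit_through (\<beta>, m)" s u, OF \<omega> s(1,2)] .

lemma Y_until_exit: "0 \<le> u \<Longrightarrow> u \<le> s \<Longrightarrow> Y u = path \<omega> u"
  using Y_eq[of u] reflect_at_fixed[OF at_exit] by (cases "u = s") auto

text \<open>While the path is still in the alcove no root takes an integer value, so both sides
  fail; from the exit on it is the reflection formula. Levels thus behave as if the whole path were
  reflected.\<close>

lemma reflected_level:
  assumes ij: "i \<noteq> j" and m': "m' \<in> \<int>" and u: "0 \<le> u"
  shows "Y u \<bullet> (basis_vec i - basis_vec j) = m' \<longleftrightarrow>
    path \<omega> u \<bullet> (basis_vec (\<sigma> i) - basis_vec (\<sigma> j)) = m' - m * (\<beta> $ i - \<beta> $ j)"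
proof (cases "s \<le> u")
  case True
  have "Y u \<bullet> (basis_vec i - basis_vec j) = path \<omega> u \<bullet> (basis_vec (\<sigma> i) - basis_vec (\<sigma> j)) + m * (\<beta> $ i - \<beta> $ j)"
    using reflect_at_root_inner[of a b m "path \<omega> u" i j] ab Y_eq[OF u] True by simp
  then show ?thesis by auto
next
  case False
  then have al: "path \<omega> u \<in> alcove V" using before_exit u by simp
  have "\<beta> $ l \<in> \<int>" for l unfolding ab(1) by (simp add: axis_def)
  then have int: "m' - m * (\<beta> $ i - \<beta> $ j) \<in> \<int>" using m' m_int by (intro Ints_diff Ints_mult)
  have "\<sigma> i \<noteq> \<sigma> j" using ij inj_eq[OF perms_inj[OF perms_transpose]] by blast
  then have "path \<omega> u \<bullet> (basis_vec (\<sigma> i) - basis_vec (\<sigma> j)) \<noteq> m' - m * (\<beta> $ i - \<beta> $ j)"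
    by (rule alcove_not_integer[OF al _ int])
  moreover have "Y u \<bullet> (basis_vec i - basis_vec j) \<noteq> m'"
    using alcove_not_integer[OF al ij m'] Y_eq[OF u] False by simp
  ultimately show ?thesis by simp
qed

lemma reflected_exits:
  assumes ij: "i \<noteq> j" and pq: "p \<in> \<int>" "q \<in> \<int>"
  shows "exits t (basis_vec i - basis_vec j) p q Y \<longleftrightarrow>
    exits t (basis_vec (\<sigma> i) - basis_vec (\<sigma> j)) (p - m * (\<beta> $ i - \<beta> $ j)) (q - m * (\<beta> $ i - \<beta> $ j)) (path \<omega>)"
  unfolding exits_def using reflected_level[OF ij pq(1)] reflected_level[OF ij pq(2)]
  by (intro bex_cong refl conj_cong ball_cong) auto

text \<open>Stated for any path that agrees with the given one up to the exit, so that it covers the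
  reflected path too. The strip of \<beta> is left at level \<open>m\<close>, which means the sign 1
  for \<open>m = 1\<close> and -1 for \<open>m = 0\<close>.\<close>

lemma exit_sign_wall:
  assumes q: "\<And>u. 0 \<le> u \<Longrightarrow> u \<le> s \<Longrightarrow> q u = path \<omega> u"
  shows "exit_sign t \<beta> q = 2 * m - 1"
proof -
  have inside: "q u \<bullet> \<beta> \<noteq> l" if "0 \<le> u" "u < s" "l \<in> \<int>" for u l
    using alcove_not_integer[OF before_exit[OF that(1,2)] _ that(3), of a b] ab q[of u] that by simp
  have "exits t \<beta> m (1 - m) q"
    unfolding exits_def
  proof (intro bexI conjI ballI)
    show "s \<in> {0..t}" "q s \<bullet> \<beta> = m" using s q[of s] at_exit by auto
    fix r assume "r \<in> {0..s}"
    then show "q r \<bullet> \<beta> \<noteq> 1 - m"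
      using inside[of r "1 - m"] m_int q[of s] at_exit s(2) m by (cases "r = s") auto
  qed
  moreover have "\<not> exits t \<beta> (1 - m) m q"
  proof
    assume "exits t \<beta> (1 - m) m q"
    then obtain r where r: "0 \<le> r" "q r \<bullet> \<beta> = 1 - m" "\<forall>u\<in>{0..r}. q u \<bullet> \<beta> \<noteq> m" unfolding exits_def by auto
    show False
    proof (cases "r < s")
      case True
      then show False using inside[of r "1 - m"] r m_int by auto
    next
      case False
      then have "q s \<bullet> \<beta> \<noteq> m" using r(3) s(2) by auto
      then show False using q[of s] at_exit s(2) by simp
    qed
  qed
  ultimately show ?thesis using m by (auto simp: exit_sign_def)
qed

lemma reflected_exit_matrix_simple:
  assumes m0: "m = 0" and b: "a \<noteq> Max UNIV" "b = next_index a" and ij: "i < j"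
  shows "exit_matrix t Y i j = exit_matrix t (path \<omega>) (\<sigma> i) (\<sigma> j)"
proof (cases "i = a \<and> j = b")
  \<comment> \<open>At the root of the wall itself \<eta> is -1 for both paths, so both entries are
    0 and the reversal of the indices by \<sigma> does no harm.\<close>
  case True
  then show ?thesis
    using ab exit_sign_wall[of Y] exit_sign_wall[of "path \<omega>"] Y_until_exit m0
    by (simp add: exit_matrix_less exit_matrix_greater)
next
  case False
  then have "\<sigma> i < \<sigma> j" using next_index_transpose_mono[OF b(1) ij] b(2) by simp
  then show ?thesis
    using ij reflected_exits[of i j] m0 by (simp add: exit_matrix_less exit_sign_def)
qed

text \<open>For a root sharing one index with the wall, the levels 0 and 1 change roles while
  \<sigma> reverses the order of the indices; the entry 1 - \<eta> faces -(1 + \<eta>), a shift by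
  2. At the root of the wall the entry 2 faces -2, a shift by 4. The values of \<open>c\<close>
  produce both.\<close>

lemma reflected_exit_matrix_affine:
  assumes m1: "m = 1" and mm: "a = Min UNIV" "b = Max UNIV" and ij: "i < j"
  defines "c \<equiv> (\<lambda>l. if l = a then - 2 else if l = b then 2 else 0)"
  shows "exit_matrix t Y i j = exit_matrix t (path \<omega>) (\<sigma> i) (\<sigma> j) + c (\<sigma> i) - c (\<sigma> j)"
proof -
  have bounds: "a \<le> l" "l \<le> b" for l by (simp_all add: mm)
  have \<beta>: "\<beta> $ l = (if l = a then 1 else 0) - (if l = b then 1 else 0)" for l by (simp add: ab(1) axis_def)
  have neq: "j \<noteq> a" "i \<noteq> b" "i \<noteq> j" using ij bounds[of i] bounds[of j] by auto
  consider "i = a" "j = b" | "i = a" "j \<noteq> b" | "i \<noteq> a" "j = b" | "i \<noteq> a" "j \<noteq> b" by blast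
  then show ?thesis
  proof cases
    case 1
    then show ?thesis
      using ab exit_sign_wall[of Y] exit_sign_wall[of "path \<omega>"] Y_until_exit m1
      by (simp add: exit_matrix_less exit_matrix_greater c_def)
  next
    case 2
    have jb: "j < b" using bounds(2)[of j] 2 by auto
    have \<sigma>: "\<sigma> i = b" "\<sigma> j = j" using 2 neq by (simp_all add: Transposition.transpose_def)
    have "exit_sign t (basis_vec i - basis_vec j) Y = - exit_sign t (basis_vec j - basis_vec b) (path \<omega>)"
      using reflected_exits[OF neq(3), of 1 0] reflected_exits[OF neq(3), of 0 1] 2 neq ab(2)
        exits_uminus[of t b j] m1 unfolding \<sigma> by (simp add: \<beta> exit_sign_def)
    then show ?thesis using ij jb 2 neq ab(2) unfolding \<sigma> by (simp add: exit_matrix_less exit_matrix_greater c_def)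
  next
    case 3
    have ai: "a < i" using bounds(1)[of i] 3 by auto
    have \<sigma>: "\<sigma> i = i" "\<sigma> j = a" using 3 neq by (simp_all add: Transposition.transpose_def)
    have "exit_sign t (basis_vec i - basis_vec j) Y = - exit_sign t (basis_vec a - basis_vec i) (path \<omega>)"
      using reflected_exits[OF neq(3), of 1 0] reflected_exits[OF neq(3), of 0 1] 3 neq ab(2)
        exits_uminus[of t i a] m1 unfolding \<sigma> by (simp add: \<beta> exit_sign_def)
    then show ?thesis using ij ai 3 neq ab(2) unfolding \<sigma> by (simp add: exit_matrix_less exit_matrix_greater c_def)
  next
    case 4
    have \<sigma>: "\<sigma> i = i" "\<sigma> j = j" using 4 neq by (simp_all add: Transposition.transpose_def)
    have "exit_sign t (basis_vec i - basis_vec j) Y = exit_sign t (basis_vec i - basis_vec j) (path \<omega>)"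
      using reflected_exits[OF neq(3), of 1 0] reflected_exits[OF neq(3), of 0 1] 4 neq unfolding \<sigma> by (simp add: \<beta> exit_sign_def)
    then show ?thesis using ij 4 neq unfolding \<sigma> by (simp add: exit_matrix_less c_def)
  qed
qed

lemma reflected_exit_matrix:
  obtains c where "\<And>i j. exit_matrix t Y i j = exit_matrix t (path \<omega>) (\<sigma> i) (\<sigma> j) + c (\<sigma> i) - c (\<sigma> j)"
proof -
  have "\<exists>c. \<forall>i j. i < j \<longrightarrow> exit_matrix t Y i j = exit_matrix t (path \<omega>) (\<sigma> i) (\<sigma> j) + c (\<sigma> i) - c (\<sigma> j)"
  proof (rule walls_cases[OF g])
    fix a' assume a': "a' \<noteq> Max UNIV" "\<beta> = basis_vec a' - basis_vec (next_index a')" "m = 0"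
    then have "a = a'" "b = next_index a'" using basis_vec_diff_eq_iff[of a b a' "next_index a'"] ab by auto
    then show ?thesis using reflected_exit_matrix_simple[OF a'(3)] a'(1) by (intro exI[of _ "\<lambda>_. 0"]) simp
  next
    assume mm: "\<beta> = basis_vec (Min UNIV) - basis_vec (Max UNIV)" "m = 1"
    then have "a = Min UNIV" "b = Max UNIV" using basis_vec_diff_eq_iff[of a b "Min UNIV" "Max UNIV"] ab by auto
    then show ?thesis using reflected_exit_matrix_affine[OF mm(2)]
      by (intro exI[of _ "\<lambda>l. if l = a then - 2 else if l = b then 2 else 0"] allI impI) blast
  qed
  then obtain c where c: "\<And>i j. i < j \<Longrightarrow> exit_matrix t Y i j = exit_matrix t (path \<omega>) (\<sigma> i) (\<sigma> j) + c (\<sigma> i) - c (\<sigma> j)" by blast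
  show ?thesis
  proof (rule that[of c])
    fix i j
    show "exit_matrix t Y i j = exit_matrix t (path \<omega>) (\<sigma> i) (\<sigma> j) + c (\<sigma> i) - c (\<sigma> j)"
    proof (cases i j rule: linorder_cases)
      case greater
      then show ?thesis
        using c[OF greater] exit_matrix_antisym[of t Y i j] exit_matrix_antisym[of t "path \<omega>" "\<sigma> i" "\<sigma> j"] by linarith
    qed (auto simp: c exit_matrix_diag)
  qed
qed

end

lemma pf_sum_reflected:
  assumes \<omega>: "good \<omega>" and x: "x \<in> alcove V" and g: "(\<beta>, m) \<in> walls" and t: "0 \<le> t"
    and le: "exit_through (\<beta>, m) \<omega> \<le> ennreal t" and card: "3 \<le> CARD('n)" "odd CARD('n)"
  shows "slot_structure.pf_sum slots next_index (exit_matrix t (reflect_from (exit_through (\<beta>, m)) (reflect_at \<beta> m) \<omega>)) =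
    - slot_structure.pf_sum slots next_index (exit_matrix t (path \<omega>))"
proof -
  interpret slot_structure "slots :: 'n set" next_index "Max UNIV" by (rule slot_structure_slots[OF card(2)])
  obtain a b where ab: "a < b" "\<beta> = basis_vec a - basis_vec b" "m \<in> {0, 1}" "m \<in> \<int>" "\<beta> \<in> roots"
    by (rule walls_root[OF g]) (use card in auto)
  obtain s where s: "exit_through (\<beta>, m) \<omega> = ennreal s" "0 \<le> s" using le by (cases "exit_through (\<beta>, m) \<omega>") (auto simp: top_unique)
  have "s \<le> t" using le s t by simp
  obtain c where c: "\<And>i j. exit_matrix t (reflect_from (exit_through (\<beta>, m)) (reflect_at \<beta> m) \<omega>) i j =
      exit_matrix t (path \<omega>) (swap a b i) (swap a b j) +
      c (swap a b i) - c (swap a b j)"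
    using reflected_exit_matrix[OF \<omega> x g t ab(2,1,3) s \<open>s \<le> t\<close>] by blast
  have "pf_sum (exit_matrix t (reflect_from (exit_through (\<beta>, m)) (reflect_at \<beta> m) \<omega>)) =
      pf_sum (\<lambda>i j. (\<lambda>i j. exit_matrix t (path \<omega>) i j + c i - c j) (swap a b i) (swap a b j))"
    using c by (intro arg_cong[of _ _ pf_sum]) (simp add: fun_eq_iff)
  also have "\<dots> = - pf_sum (\<lambda>i j. exit_matrix t (path \<omega>) i j + c i - c j)"
    by (rule pf_sum_transpose) (use ab(1) in auto)
  also have "\<dots> = - pf_sum (exit_matrix t (path \<omega>))" unfolding pf_sum_shift ..
  finally show ?thesis .
qed

end

section \<open>The exit probability\<close>

lemma E_sign_eq: "finite A \<Longrightarrow> E_sign A v = (\<Prod>\<beta>\<in>A. if 0 < v \<bullet> \<beta> then - 1 else 1)"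
  unfolding E_sign_def by (simp add: prod.If_cases Int_def)

lemma pos_roots_subset_roots: "pos_roots \<subseteq> roots"
  unfolding pos_roots_def by (auto intro: rootsI)

context
  fixes A :: "((real, 'n::{finite,linorder}) vec) set"
  assumes A: "finite A" "A \<noteq> {}" "A \<subseteq> roots" "\<And>\<beta> \<gamma>. \<beta> \<in> A \<Longrightarrow> \<gamma> \<in> A \<Longrightarrow> \<beta> \<noteq> \<gamma> \<Longrightarrow> \<beta> \<bullet> \<gamma> = 0"
begin

text \<open>The division by 2 compensates for the squared length of a root, so that the inner
  product with \<beta> is exactly m \<beta>.\<close>

definition lattice_point :: "((real, 'n) vec \<Rightarrow> int) \<Rightarrow> (real, 'n) vec" where
  "lattice_point m = (\<Sum>\<beta>\<in>A. (of_int (m \<beta>) / 2) *\<^sub>R \<beta>)"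

lemma orthogonal_sum_inner:
  assumes "\<beta> \<in> A"
  shows "(\<Sum>\<gamma>\<in>A. (c \<gamma> / 2) *\<^sub>R \<gamma>) \<bullet> \<beta> = c \<beta>"
proof -
  have "(\<Sum>\<gamma>\<in>A. (c \<gamma> / 2) *\<^sub>R \<gamma>) \<bullet> \<beta> = (\<Sum>\<gamma>\<in>A. (c \<gamma> / 2) * (\<gamma> \<bullet> \<beta>))" by (simp add: inner_sum_left)
  also have "\<dots> = (\<Sum>\<gamma>\<in>A. if \<gamma> = \<beta> then c \<beta> else 0)"
    using A(3,4) assms roots_norm by (intro sum.cong) (auto simp: subset_iff)
  also have "\<dots> = c \<beta>" using A(1) assms by simp
  finally show ?thesis .
qed

lemma lattice_point_inner: "\<beta> \<in> A \<Longrightarrow> lattice_point m \<bullet> \<beta> = of_int (m \<beta>)"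
  unfolding lattice_point_def by (rule orthogonal_sum_inner)

lemma span_orthogonal_expansion:
  assumes "v \<in> span A"
  shows "v = (\<Sum>\<beta>\<in>A. ((v \<bullet> \<beta>) / 2) *\<^sub>R \<beta>)"
proof -
  define u where "u = v - (\<Sum>\<beta>\<in>A. ((v \<bullet> \<beta>) / 2) *\<^sub>R \<beta>)"
  have "u \<in> span A" unfolding u_def by (intro span_diff assms span_sum span_scale span_base)
  moreover have "orthogonal u \<beta>" if "\<beta> \<in> A" for \<beta>
    using orthogonal_sum_inner[OF that, of "\<lambda>\<beta>. v \<bullet> \<beta>"] by (simp add: u_def orthogonal_def inner_diff_left)
  ultimately have "orthogonal u u" using orthogonal_to_span by blast
  then have "u = 0" by (simp add: orthogonal_self)
  then show ?thesis by (simp add: u_def)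
qed

lemma E_norm_le_iff: "E_norm A v \<le> c \<longleftrightarrow> (\<forall>\<beta>\<in>A. \<bar>v \<bullet> \<beta>\<bar> \<le> c)"
  unfolding E_norm_def using A(1,2) by (subst Max_le_iff) auto

lemma E_norm_nat:
  assumes "v \<in> E_set A"
  obtains k :: nat where "E_norm A v = real k"
proof -
  have "E_norm A v \<in> (\<lambda>\<beta>. \<bar>v \<bullet> \<beta>\<bar>) ` A" unfolding E_norm_def using A(1,2) by (intro Max_in) auto
  then obtain \<beta> where \<beta>: "\<beta> \<in> A" "E_norm A v = \<bar>v \<bullet> \<beta>\<bar>" by auto
  with assms obtain k where "v \<bullet> \<beta> = of_int k" unfolding E_set_def by (auto elim: Ints_cases)
  then show ?thesis using that[of "nat \<bar>k\<bar>"] \<beta>(2) by simp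
qed

text \<open>As \<open>E_norm\<close> is a maximum, its ball is a full box in the coordinates given
  by the inner products with the roots; this lets the lattice sum factorise.\<close>

lemma bij_lattice_point:
  "bij_betw lattice_point (PiE A (\<lambda>_. {- int N..int N})) {v \<in> E_set A. E_norm A v \<le> real N}"
proof (rule bij_betwI[where g="\<lambda>v. \<lambda>\<beta>\<in>A. \<lfloor>v \<bullet> \<beta>\<rfloor>"])
  show "lattice_point \<in> PiE A (\<lambda>_. {- int N..int N}) \<rightarrow> {v \<in> E_set A. E_norm A v \<le> real N}"
  proof
    fix m assume m: "m \<in> PiE A (\<lambda>_. {- int N..int N})"
    have "lattice_point m \<in> span A" unfolding lattice_point_def by (intro span_sum span_scale span_base)
    then have "lattice_point m \<in> E_set A" by (simp add: E_set_def lattice_point_inner)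
    moreover have "\<bar>lattice_point m \<bullet> \<beta>\<bar> \<le> real N" if "\<beta> \<in> A" for \<beta>
    proof -
      have "m \<beta> \<in> {- int N..int N}" using m that by (rule PiE_mem)
      then have "\<bar>m \<beta>\<bar> \<le> int N" by auto
      then show ?thesis unfolding lattice_point_inner[OF that] by linarith
    qed
    ultimately show "lattice_point m \<in> {v \<in> E_set A. E_norm A v \<le> real N}" by (simp add: E_norm_le_iff)
  qed
  show "(\<lambda>v. \<lambda>\<beta>\<in>A. \<lfloor>v \<bullet> \<beta>\<rfloor>) \<in> {v \<in> E_set A. E_norm A v \<le> real N} \<rightarrow> PiE A (\<lambda>_. {- int N..int N})"
  proof
    fix v assume v: "v \<in> {v \<in> E_set A. E_norm A v \<le> real N}"
    have "\<lfloor>v \<bullet> \<beta>\<rfloor> \<in> {- int N..int N}" if "\<beta> \<in> A" for \<beta>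
    proof -
      have "\<bar>v \<bullet> \<beta>\<bar> \<le> real N" using v that by (simp add: E_norm_le_iff)
      then show ?thesis by (auto simp: le_floor_iff floor_le_iff)
    qed
    then show "(\<lambda>\<beta>\<in>A. \<lfloor>v \<bullet> \<beta>\<rfloor>) \<in> PiE A (\<lambda>_. {- int N..int N})" by (rule restrict_PiE_iff[THEN iffD2, rule_format])
  qed
  show "(\<lambda>\<beta>\<in>A. \<lfloor>lattice_point m \<bullet> \<beta>\<rfloor>) = m" if "m \<in> PiE A (\<lambda>_. {- int N..int N})" for m
  proof
    fix \<beta> show "(\<lambda>\<beta>\<in>A. \<lfloor>lattice_point m \<bullet> \<beta>\<rfloor>) \<beta> = m \<beta>"
      using PiE_arb[OF that, of \<beta>] by (cases "\<beta> \<in> A") (simp_all add: lattice_point_inner)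
  qed
  show "lattice_point (\<lambda>\<beta>\<in>A. \<lfloor>v \<bullet> \<beta>\<rfloor>) = v" if "v \<in> {v \<in> E_set A. E_norm A v \<le> real N}" for v
  proof -
    have "lattice_point (\<lambda>\<beta>\<in>A. \<lfloor>v \<bullet> \<beta>\<rfloor>) = (\<Sum>\<beta>\<in>A. ((v \<bullet> \<beta>) / 2) *\<^sub>R \<beta>)"
      unfolding lattice_point_def using that by (intro sum.cong) (auto simp: E_set_def)
    also have "\<dots> = v" using that by (intro span_orthogonal_expansion[symmetric]) (simp add: E_set_def)
    finally show ?thesis .
  qed
qed

text \<open>Norms on \<open>E_set A\<close> are natural numbers, so the shells 0 to \<open>N\<close>
  exhaust the ball of radius \<open>N\<close>, including its boundary.\<close>

lemma sum_over_shells: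
  fixes f :: "(real, 'n) vec \<Rightarrow> real"
  shows "(\<Sum>n<Suc N. \<Sum>v | v \<in> E_set A \<and> E_norm A v = real n. f v) =
    (\<Sum>m\<in>PiE A (\<lambda>_. {- int N..int N}). f (lattice_point m))"
proof -
  let ?E = "{v \<in> E_set A. E_norm A v \<le> real N}"
  have fin: "finite ?E"
    using bij_betw_finite[OF bij_lattice_point] A(1) by (simp add: finite_PiE)
  have floor: "nat \<lfloor>E_norm A v\<rfloor> = n \<longleftrightarrow> E_norm A v = real n" if "v \<in> E_set A" for v n
    by (rule E_norm_nat[OF that]) auto
  have "(\<Sum>n<Suc N. \<Sum>v | v \<in> E_set A \<and> E_norm A v = real n. f v) =
      (\<Sum>n\<in>{..<Suc N}. \<Sum>v\<in>{v\<in>?E. nat \<lfloor>E_norm A v\<rfloor> = n}. f v)"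
  proof (rule sum.cong)
    fix n assume "n \<in> {..<Suc N}"
    then have "v \<in> E_set A \<and> E_norm A v = real n \<longleftrightarrow> v \<in> ?E \<and> nat \<lfloor>E_norm A v\<rfloor> = n" for v
      using floor[of v n] by auto
    then have "{v. v \<in> E_set A \<and> E_norm A v = real n} = {v\<in>?E. nat \<lfloor>E_norm A v\<rfloor> = n}" by blast
    then show "(\<Sum>v | v \<in> E_set A \<and> E_norm A v = real n. f v) = (\<Sum>v\<in>{v\<in>?E. nat \<lfloor>E_norm A v\<rfloor> = n}. f v)" by simp
  qed simp
  also have "\<dots> = (\<Sum>v\<in>?E. f v)"
  proof (rule sum.group[OF fin])
    show "(\<lambda>v. nat \<lfloor>E_norm A v\<rfloor>) ` ?E \<subseteq> {..<Suc N}"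
      by (clarsimp simp: less_Suc_eq_le nat_le_iff) linarith
  qed simp
  also have "\<dots> = (\<Sum>m\<in>PiE A (\<lambda>_. {- int N..int N}). f (lattice_point m))"
    by (rule sum.reindex_bij_betw[OF bij_lattice_point, symmetric])
  finally show ?thesis .
qed

lemma E_sign_lattice_point: "E_sign A (lattice_point m) = (\<Prod>\<beta>\<in>A. half_sign (m \<beta>))"
  unfolding E_sign_eq[OF A(1)] by (intro prod.cong) (simp_all add: lattice_point_inner half_sign_def)

end

section \<open>From the expected Pfaffian sum to the exit probability\<close>

context reflectable_process
begin

text \<open>Measurability of the event comes from completeness: its indicator agrees almost surely
  with a measurable function.\<close>

lemma measure_eq_integral:
  assumes \<phi>: "path_functional \<phi>" and eq: "\<And>\<omega>. good \<omega> \<Longrightarrow> of_bool (R \<omega>) = \<phi> (path \<omega>)"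
  shows "measure \<mu> {\<omega>\<in>space M. R \<omega>} = (\<integral>\<omega>. \<phi> (path \<omega>) \<partial>\<mu>)"
proof -
  have \<phi>m: "(\<lambda>\<omega>. \<phi> (path \<omega>)) \<in> borel_measurable \<mu>" by (rule path_functional_measurable[OF \<phi>])
  let ?I = "indicator {\<omega>\<in>space M. R \<omega>} :: 'w \<Rightarrow> real"
  have ae: "AE \<omega> in \<mu>. ?I \<omega> = \<phi> (path \<omega>)"
    using AE_good by eventually_elim (simp add: eq[symmetric] good_def indicator_def)
  have m: "?I \<in> borel_measurable \<mu>"
    using borel_measurable_completion_AE[OF \<phi>m[unfolded \<mu>_def] ae[unfolded \<mu>_def]] by (simp add: \<mu>_def)
  have "{\<omega>\<in>space M. R \<omega>} \<inter> space \<mu> \<in> sets \<mu>" using m unfolding borel_measurable_indicator_iff .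
  moreover have "{\<omega>\<in>space M. R \<omega>} \<inter> space \<mu> = {\<omega>\<in>space M. R \<omega>}" by auto
  ultimately have "measure \<mu> {\<omega>\<in>space M. R \<omega>} = (\<integral>\<omega>. ?I \<omega> \<partial>\<mu>)" by simp
  also have "\<dots> = (\<integral>\<omega>. \<phi> (path \<omega>) \<partial>\<mu>)" by (rule integral_cong_AE[OF m \<phi>m ae])
  finally show ?thesis .
qed

lemma inner_series:
  assumes x: "x \<in> alcove V" and t: "0 \<le> t" and card: "3 \<le> CARD('n)" "odd CARD('n)" and A: "A \<in> orth_collection"
  shows "(\<lambda>n::nat. \<Sum>v | v \<in> E_set A \<and> E_norm A v = real n.
      c * E_sign A v * measure \<mu> {\<omega>\<in>space M. hit_time_set X A v \<omega> > ennreal t}) sums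
    (c * (\<integral>\<omega>. (\<Prod>\<beta>\<in>A. 1 + exit_sign t \<beta> (path \<omega>)) \<partial>\<mu>))" (is "?F sums ?L")
proof -
  note props = orth_collection_props[OF card(2) A card(1)]
  have roots: "A \<subseteq> roots" using props(3) pos_roots_subset_roots by blast
  note ctx = props(1,2) roots props(4)
  have strip: "0 < x \<bullet> \<beta> \<and> x \<bullet> \<beta> < 1" if "\<beta> \<in> A" for \<beta>
    using props(3) that alcove_strip[OF x] unfolding pos_roots_def by blast
  have not_hit: "measure \<mu> {\<omega>\<in>space M. hit_time_set X A v \<omega> > ennreal t} =
      (\<integral>\<omega>. (\<Prod>\<beta>\<in>A. of_bool (\<not> hits t \<beta> (v \<bullet> \<beta>) (path \<omega>))) \<partial>\<mu>)" for v
  proof (rule measure_eq_integral)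
    show "path_functional (\<lambda>p. \<Prod>\<beta>\<in>A. of_bool (\<not> hits t \<beta> (v \<bullet> \<beta>) p))"
      using t by (intro path_functional_prod path_functional_not_hits)
    fix \<omega> assume \<omega>: "good \<omega>"
    have "of_bool (\<forall>\<beta>\<in>A. \<not> hits t \<beta> (v \<bullet> \<beta>) (path \<omega>)) = (\<Prod>\<beta>\<in>A. of_bool (\<not> hits t \<beta> (v \<bullet> \<beta>) (path \<omega>)) :: real)"
      using props(1) by (induction A rule: finite_induct) auto
    then show "of_bool (ennreal t < hit_time_set X A v \<omega>) = (\<Prod>\<beta>\<in>A. of_bool (\<not> hits t \<beta> (v \<bullet> \<beta>) (path \<omega>)) :: real)"
      unfolding hit_time_set_gt_iff[OF \<omega> t props(1,2)] .
  qed
  have "(\<Sum>n<Suc N. ?F n) = c * (\<integral>\<omega>. (\<Prod>\<beta>\<in>A. trunc_factor N t \<beta> (path \<omega>)) \<partial>\<mu>)" for N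
  proof -
    let ?B = "PiE A (\<lambda>_. {- int N..int N})"
    let ?g = "\<lambda>m p. \<Prod>\<beta>\<in>A. half_sign (m \<beta>) * of_bool (\<not> hits t \<beta> (of_int (m \<beta>)) p)"
    have int: "integrable \<mu> (\<lambda>\<omega>. ?g m (path \<omega>))" for m
      using t by (intro path_functional_integrable path_functional_prod path_functional_times path_functional_const
          path_functional_not_hits)
    have "(\<Sum>n<Suc N. ?F n) = (\<Sum>m\<in>?B. c * E_sign A (lattice_point A m) *
        measure \<mu> {\<omega>\<in>space M. hit_time_set X A (lattice_point A m) \<omega> > ennreal t})"
      by (rule sum_over_shells[OF ctx])
    also have "\<dots> = (\<Sum>m\<in>?B. c * (\<integral>\<omega>. ?g m (path \<omega>) \<partial>\<mu>))"
    proof (rule sum.cong)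
      fix m
      have "measure \<mu> {\<omega>\<in>space M. hit_time_set X A (lattice_point A m) \<omega> > ennreal t} =
          (\<integral>\<omega>. (\<Prod>\<beta>\<in>A. of_bool (\<not> hits t \<beta> (of_int (m \<beta>)) (path \<omega>))) \<partial>\<mu>)"
        unfolding not_hit by (intro Bochner_Integration.integral_cong prod.cong refl) (simp add: lattice_point_inner[OF ctx])
      then show "c * E_sign A (lattice_point A m) * measure \<mu> {\<omega>\<in>space M. hit_time_set X A (lattice_point A m) \<omega> > ennreal t}
          = c * (\<integral>\<omega>. ?g m (path \<omega>) \<partial>\<mu>)"
        by (simp add: E_sign_lattice_point[OF ctx] prod.distrib)
    qed simp
    also have "\<dots> = c * (\<integral>\<omega>. (\<Sum>m\<in>?B. ?g m (path \<omega>)) \<partial>\<mu>)"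
      by (subst Bochner_Integration.integral_sum) (simp_all add: int sum_distrib_left)
    \<comment> \<open>Distributivity: the sum over the box of products over the roots is the product
      of the one-dimensional sums.\<close>
    also have "(\<lambda>\<omega>. \<Sum>m\<in>?B. ?g m (path \<omega>)) = (\<lambda>\<omega>. \<Prod>\<beta>\<in>A. trunc_factor N t \<beta> (path \<omega>))"
      unfolding trunc_factor_def by (subst prod_sum_PiE) (use props(1) in auto)
    finally show ?thesis .
  qed
  then have "(\<lambda>N. \<Sum>n<Suc N. ?F n) \<longlonglongrightarrow> ?L"
    using tendsto_mult[OF tendsto_const trunc_factors_limit[OF props(1) roots props(4) strip t]] by simp
  then show ?thesis unfolding sums_def by (rule LIMSEQ_imp_Suc)
qed

lemma path_functional_exit_matrix: "0 \<le> t \<Longrightarrow> path_functional (\<lambda>p. exit_matrix t p i j)"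
  by (cases i j rule: linorder_cases)
    (auto simp: exit_matrix_less exit_matrix_greater exit_matrix_diag intro!: path_functional_diff path_functional_add)

text \<open>Split by the wall of exit, each part equals its own negative:
  \<open>wall_reflection\<close> keeps the integral and \<open>pf_sum_reflected\<close> reverses the
  integrand. What remains is the event of no exit, where the matrix is \<open>order_sign\<close> and
  its sum is \<open>fiber_card\<close>.\<close>

lemma integral_pf_sum:
  assumes x: "x \<in> alcove V" and t: "0 \<le> t" and card: "3 \<le> CARD('n)" "odd CARD('n)"
  shows "(\<integral>\<omega>. slot_structure.pf_sum slots next_index (exit_matrix t (path \<omega>)) \<partial>\<mu>) =
    slot_structure.fiber_card (slots :: 'n set) next_index * measure \<mu> {\<omega>\<in>space M. exit_time X (alcove V) \<omega> > ennreal t}"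
proof -
  interpret slot_structure "slots :: 'n set" next_index "Max UNIV" by (rule slot_structure_slots[OF card(2)])
  define \<psi> :: "(real \<Rightarrow> (real, 'n) vec) \<Rightarrow> real" where "\<psi> p = pf_sum (exit_matrix t p)" for p
  have \<psi>_pm: "path_functional \<psi>"
    unfolding \<psi>_def[abs_def] pf_sum_def pf_term_def
    using t by (intro path_functional_sum path_functional_times path_functional_const path_functional_prod path_functional_exit_matrix)
  have stop: "stopping_time NF (exit_through g)" for g
    unfolding exit_through_def by (rule stopping_time_first_at) (auto intro: finite_subset[OF _ finite_walls])
  have int: "integrable \<mu> (\<lambda>\<omega>. of_bool (exit_through g \<omega> \<le> ennreal t) * \<psi> (path \<omega>))" for g
    by (rule integrable_stopped[OF stop \<psi>_pm])
  have zero: "(\<integral>\<omega>. of_bool (exit_through g \<omega> \<le> ennreal t) * \<psi> (path \<omega>) \<partial>\<mu>) = 0" if g: "g \<in> walls" for g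
  proof -
    obtain \<beta> m where bm: "g = (\<beta>, m)" by (cases g)
    obtain a b where ab: "a < b" "\<beta> = basis_vec a - basis_vec b" "m \<in> {0, 1}" "m \<in> \<int>" "\<beta> \<in> roots"
      by (rule walls_root[of \<beta> m]) (use g bm card in auto)
    have "(\<integral>\<omega>. of_bool (exit_through g \<omega> \<le> ennreal t) * \<psi> (path \<omega>) \<partial>\<mu>) =
        (\<integral>\<omega>. of_bool (exit_through g \<omega> \<le> ennreal t) * \<psi> (reflect_from (exit_through g) (reflect_at \<beta> m) \<omega>) \<partial>\<mu>)"
      unfolding exit_through_def bm
      by (rule wall_reflection[OF _ _ ab(5,4) \<psi>_pm]) (auto intro: finite_subset[OF _ finite_walls])
    also have "\<dots> = (\<integral>\<omega>. - (of_bool (exit_through g \<omega> \<le> ennreal t) * \<psi> (path \<omega>)) \<partial>\<mu>)"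
    proof (rule integral_cong_good)
      show "(\<lambda>\<omega>. - (of_bool (exit_through g \<omega> \<le> ennreal t) * \<psi> (path \<omega>))) \<in> borel_measurable \<mu>"
        by (intro borel_measurable_uminus borel_measurable_integrable int)
      fix \<omega> assume "good \<omega>"
      then show "of_bool (exit_through g \<omega> \<le> ennreal t) * \<psi> (reflect_from (exit_through g) (reflect_at \<beta> m) \<omega>) =
          - (of_bool (exit_through g \<omega> \<le> ennreal t) * \<psi> (path \<omega>))"
        using pf_sum_reflected[OF _ x g[unfolded bm] t _ card, of \<omega>] unfolding \<psi>_def bm
        by (cases "exit_through (\<beta>, m) \<omega> \<le> ennreal t") simp_all
    qed
    finally show ?thesis by simp
  qed
  define \<phi> :: "(real \<Rightarrow> (real, 'n) vec) \<Rightarrow> real" where "\<phi> p = (\<Prod>g\<in>walls. of_bool (\<not> hits t (fst g) (snd g) p) :: real)" for p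
  have \<phi>_pm: "path_functional \<phi>"
    unfolding \<phi>_def[abs_def] using t by (intro path_functional_prod path_functional_not_hits)
  have \<phi>_eq: "\<phi> p = of_bool (\<forall>(\<beta>, m)\<in>walls. \<not> hits t \<beta> m p)" for p
  proof -
    have "(\<Prod>g\<in>G. of_bool (\<not> hits t (fst g) (snd g) p)) = (of_bool (\<forall>(\<beta>, m)\<in>G. \<not> hits t \<beta> m p) :: real)"
      if "finite G" for G using that by (induction G rule: finite_induct) auto
    then show ?thesis unfolding \<phi>_def using finite_walls by blast
  qed
  have \<phi>_int: "integrable \<mu> (\<lambda>\<omega>. fiber_card * \<phi> (path \<omega>))"
    by (intro integrable_mult_right path_functional_integrable[OF \<phi>_pm])
  have "(\<integral>\<omega>. \<psi> (path \<omega>) \<partial>\<mu>) = (\<integral>\<omega>. fiber_card * \<phi> (path \<omega>) +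
      (\<Sum>g\<in>walls. of_bool (exit_through g \<omega> \<le> ennreal t) * \<psi> (path \<omega>)) \<partial>\<mu>)"
  proof (rule integral_cong_good)
    show "(\<lambda>\<omega>. fiber_card * \<phi> (path \<omega>) + (\<Sum>g\<in>walls. of_bool (exit_through g \<omega> \<le> ennreal t) * \<psi> (path \<omega>))) \<in> borel_measurable \<mu>"
      by (intro borel_measurable_integrable Bochner_Integration.integrable_add \<phi>_int Bochner_Integration.integrable_sum int)
    fix \<omega> assume \<omega>: "good \<omega>"
    have "\<phi> (path \<omega>) * \<psi> (path \<omega>) = fiber_card * \<phi> (path \<omega>)"
    proof (cases "\<forall>(\<beta>, m)\<in>walls. \<not> hits t \<beta> m (path \<omega>)")
      case True
      then have al: "path \<omega> s \<in> alcove V" if "s \<in> {0..t}" for s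
        using in_alcove_iff_no_hits[OF \<omega> x t] that by blast
      have "exit_sign t (basis_vec i - basis_vec j) (path \<omega>) = 0" if "i < j" for i j
      proof -
        have "path \<omega> s \<bullet> (basis_vec i - basis_vec j) \<noteq> 0" "path \<omega> s \<bullet> (basis_vec i - basis_vec j) \<noteq> 1" if "s \<in> {0..t}" for s
          using alcove_strip[OF al[OF that] \<open>i < j\<close>] by auto
        then show ?thesis unfolding exit_sign_def exits_def by simp
      qed
      then have "exit_matrix t (path \<omega>) = order_sign"
        by (intro ext) (auto simp: exit_matrix_def root_matrix_def order_sign_def)
      then show ?thesis by (simp add: \<psi>_def pf_sum_order_sign)
    qed (simp add: \<phi>_eq)
    moreover have "\<phi> (path \<omega>) + (\<Sum>g\<in>walls. of_bool (exit_through g \<omega> \<le> ennreal t)) = 1"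
      unfolding \<phi>_eq by (rule exit_partition[OF \<omega> t])
    ultimately show "\<psi> (path \<omega>) = fiber_card * \<phi> (path \<omega>) + (\<Sum>g\<in>walls. of_bool (exit_through g \<omega> \<le> ennreal t) * \<psi> (path \<omega>))"
      unfolding sum_distrib_right[symmetric] by algebra
  qed
  also have "\<dots> = fiber_card * (\<integral>\<omega>. \<phi> (path \<omega>) \<partial>\<mu>)"
    using \<phi>_int int zero
    by (subst Bochner_Integration.integral_add) (auto simp: Bochner_Integration.integral_sum)
  also have "(\<integral>\<omega>. \<phi> (path \<omega>) \<partial>\<mu>) = measure \<mu> {\<omega>\<in>space M. exit_time X (alcove V) \<omega> > ennreal t}"
    by (rule measure_eq_integral[OF \<phi>_pm, symmetric]) (simp add: exit_time_gt_iff[OF _ x t] \<phi>_eq)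
  finally show ?thesis unfolding \<psi>_def .
qed

lemma exit_probability:
  assumes x: "x \<in> alcove V" and t: "0 \<le> t" and card: "3 \<le> CARD('n)" "odd CARD('n)"
  shows "measure \<mu> {\<omega>\<in>space M. exit_time X (alcove V) \<omega> > ennreal t} =
    (\<Sum>A\<in>orth_collection. orth_sign A * (\<integral>\<omega>. (\<Prod>\<beta>\<in>A. 1 + exit_sign t \<beta> (path \<omega>)) \<partial>\<mu>))"
proof -
  interpret slot_structure "slots :: 'n set" next_index "Max UNIV" by (rule slot_structure_slots[OF card(2)])
  have int: "integrable \<mu> (\<lambda>\<omega>. \<Prod>\<beta>\<in>A. 1 + exit_sign t \<beta> (path \<omega>))" for A :: "((real, 'n) vec) set"
    using t by (intro path_functional_integrable path_functional_prod path_functional_add path_functional_const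
        path_functional_exit_sign)
  have "fiber_card * (\<Sum>A\<in>orth_collection. orth_sign A * (\<integral>\<omega>. (\<Prod>\<beta>\<in>A. 1 + exit_sign t \<beta> (path \<omega>)) \<partial>\<mu>)) =
      (\<integral>\<omega>. fiber_card * (\<Sum>A\<in>orth_collection. orth_sign A * (\<Prod>\<beta>\<in>A. 1 + exit_sign t \<beta> (path \<omega>))) \<partial>\<mu>)"
    using int by (simp add: Bochner_Integration.integral_sum)
  also have "\<dots> = (\<integral>\<omega>. pf_sum (exit_matrix t (path \<omega>)) \<partial>\<mu>)"
    unfolding orth_collection_sum[OF card(2)] exit_matrix_def ..
  also have "\<dots> = fiber_card * measure \<mu> {\<omega>\<in>space M. exit_time X (alcove V) \<omega> > ennreal t}"
    by (rule integral_pf_sum[OF x t card])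
  finally show ?thesis using fiber_card_pos by simp
qed

end

theorem theorem8:
  fixes V :: "(real ^ 'n::{finite,linorder}) set"
    and M :: "'w measure"
    and P :: "real ^ 'n::{finite,linorder} \<Rightarrow> 'w measure"
    and X :: "real \<Rightarrow> 'w \<Rightarrow> real ^ 'n::{finite,linorder}"
    and x :: "real ^ 'n::{finite,linorder}"
    and t :: real
  assumes "3 \<le> CARD('n)" and "odd CARD('n)"
    and "V = UNIV \<or> V = {y. (\<Sum>i\<in>UNIV. y $ i) = 0}"
    and "reflectable V M P X"
    and "x \<in> alcove V"
    and "0 \<le> t"
    and "\<forall>A\<in>orth_collection. summable (\<lambda>n::nat.
           \<Sum>v | v \<in> E_set A \<and> E_norm A v = real n.
             orth_sign A * E_sign A v *
             measure (completion (P x)) {\<omega>\<in>space M. hit_time_set X A v \<omega> > ennreal t})"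
  shows "measure (completion (P x)) {\<omega>\<in>space M. exit_time X (alcove V) \<omega> > ennreal t} =
    (\<Sum>A\<in>orth_collection. \<Sum>n::nat.
       \<Sum>v | v \<in> E_set A \<and> E_norm A v = real n.
         orth_sign A * E_sign A v *
         measure (completion (P x)) {\<omega>\<in>space M. hit_time_set X A v \<omega> > ennreal t})"
proof -
  interpret reflectable_process V M P X x
    using assms(4,5) by unfold_locales (auto simp: alcove_def)
  have "(\<Sum>n::nat. \<Sum>v | v \<in> E_set A \<and> E_norm A v = real n.
         orth_sign A * E_sign A v * measure \<mu> {\<omega>\<in>space M. hit_time_set X A v \<omega> > ennreal t}) =
      orth_sign A * (\<integral>\<omega>. (\<Prod>\<beta>\<in>A. 1 + exit_sign t \<beta> (path \<omega>)) \<partial>\<mu>)" if "A \<in> orth_collection" for A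
    by (rule sums_unique[symmetric, OF inner_series[OF assms(5,6,1,2) that]])
  then show ?thesis
    using exit_probability[OF assms(5,6,1,2)] unfolding \<mu>_def by (simp cong: sum.cong)
qed

end
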